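(* Let $n\ge 1$ and let ${\bf F}=(F_1,\ldots,F_n)$ be the system of polynomials in $\mathbb{Z}[X_1,\ldots,X_n]$ given by \[F_i(X_1,\ldots,X_n)=X_i\,G_i(X_{i+1},\ldots,X_n)+H_i(X_{i+1},\ldots,X_n),\quad i=1,\ldots,n-1,\qquad F_n=g_nX_n+h_n,\] where $G_i,H_i\in\mathbb{Z}[X_{i+1},\ldots,X_n]$, $g_n,h_n\in\mathbb{Z}$, $g_n\neq 0$. Assume that for each $i=1,\ldots,n-1$ the polynomial $G_i$ has a unique leading monomial, i.e. \[G_i=g_iX_{i+1}^{s_{i,i+1}}\cdots X_n^{s_{i,n}}+\tilde G_i,\qquad g_i\in\mathbb{Z}\setminus\{0\},\ \tilde G_i\in\mathbb{Z}[X_{i+1},\ldots,X_n],\] with $\deg_{X_j}\tilde G_i<s_{i,j}$ and $\deg_{X_j}H_i<s_{i,j}$ for $j=i+1,\ldots,n$, and that $s_{i,i+1}\neq 0$ for $i=1,\ldots,n-1$. Set $d=\max_j\deg F_j$ and $h=\max_j h(F_j)$. Let $k\ge 1$ and suppose that ${\bf F}$ has finitely many periodic points of order $k$ over $\mathbb{C}$. Then there exists an integer $\mathfrak{B}_1\in\mathbb{N}$ with \[\log\mathfrak{B}_1\ll_{d,h,n}k^{n(3n-1)}\] such that if $p$ is a prime not dividing $\mathfrak{B}_1$, then the reduction of ${\bf F}$ modulo $p$ has $O_{d,h,n}(k^{n(n-1)/2})$ periodic points of order $k$ (over $\overline{\mathbb{F}}_p$).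
   Context: For $L\in\mathbb{Z}[X_1,\ldots,X_n]$, the height $h(L)$ is the logarithm of the maximum of the absolute values of its coefficients. ${\bf F}^{(k)}$ denotes the $k$-fold composition ${\bf F}\circ\cdots\circ{\bf F}$. A point ${\bf w}$ is a periodic point of order $k$ (is $k$-periodic) for ${\bf F}$ if ${\bf F}^{(k)}({\bf w})={\bf w}$; for the reduction modulo $p$, one uses the system ${\bf F}_p$ obtained by reducing the coefficients of $F_1,\ldots,F_n$ modulo $p$, with points in $\overline{\mathbb{F}}_p^n$. The notation $f\ll_{d,h,n}g$ and $f=O_{d,h,n}(g)$ means $|f|\le c\,g$ for a constant $c$ depending only on $d,h,n$. *)

theory Defs
  imports
    Complex_Main
    "HOL-Library.Poly_Mapping"
    "HOL-Library.Extended_Real"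
    "HOL-Library.FuncSet"
    "HOL-Number_Theory.Residues"
    "HOL-Algebra.Algebraic_Closure_Type"
begin

text \<open>
  An integer polynomial in the variables X_1, X_2, ... is a finitely supported function from
  monomials to coefficients, a monomial being a finitely supported function from variable
  indices to exponents.
\<close>

type_synonym int_mpoly = "(nat \<Rightarrow>\<^sub>0 nat) \<Rightarrow>\<^sub>0 int"

definition Var :: "nat \<Rightarrow> int_mpoly" where
  "Var i = Poly_Mapping.single (Poly_Mapping.single i 1) 1"

definition poly_over :: "nat set \<Rightarrow> int_mpoly set" where
  "poly_over I = {P. \<forall>m\<in>Poly_Mapping.keys P. Poly_Mapping.keys m \<subseteq> I}"

text \<open>The degree in X_j of the zero polynomial is minus infinity (a supremum over the empty set).\<close>

definition deg_in :: "nat \<Rightarrow> int_mpoly \<Rightarrow> ereal" where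
  "deg_in j P = (SUP m\<in>Poly_Mapping.keys P. ereal (real (Poly_Mapping.lookup m j)))"

text \<open>
  The next two notions are only meaningful for a nonzero polynomial; the components of a
  triangular system as below are never zero.
\<close>

definition total_deg :: "int_mpoly \<Rightarrow> nat" where
  "total_deg P =
     Max ((\<lambda>m. \<Sum>i\<in>Poly_Mapping.keys m. Poly_Mapping.lookup m i) ` Poly_Mapping.keys P)"

definition height :: "int_mpoly \<Rightarrow> real" where
  "height P =
     ln (real_of_int (Max ((\<lambda>m. \<bar>Poly_Mapping.lookup P m\<bar>) ` Poly_Mapping.keys P)))"

definition system_deg :: "nat \<Rightarrow> (nat \<Rightarrow> int_mpoly) \<Rightarrow> nat" where
  "system_deg n F = Max ((\<lambda>j. total_deg (F j)) ` {1..n})"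

definition system_height :: "nat \<Rightarrow> (nat \<Rightarrow> int_mpoly) \<Rightarrow> real" where
  "system_height n F = Max ((\<lambda>j. height (F j)) ` {1..n})"

text \<open>
  Only the components F 1, ..., F n matter. By the convention for \<^const>\<open>deg_in\<close>, an exponent
  s i j = 0 forces the remainder G' i and the polynomial H i to vanish.
\<close>

definition triangular_system :: "nat \<Rightarrow> (nat \<Rightarrow> int_mpoly) \<Rightarrow> bool" where
  "triangular_system n F \<longleftrightarrow>
     (\<exists>(G :: nat \<Rightarrow> int_mpoly) (G' :: nat \<Rightarrow> int_mpoly) (H :: nat \<Rightarrow> int_mpoly)
       (g :: nat \<Rightarrow> int) (hn :: int) (s :: nat \<Rightarrow> nat \<Rightarrow> nat).
        (\<forall>i\<in>{1..<n}.
           G i \<in> poly_over {i<..n} \<and> H i \<in> poly_over {i<..n} \<and> G' i \<in> poly_over {i<..n} \<and>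
           F i = Var i * G i + H i \<and>
           G i = of_int (g i) * (\<Prod>j\<in>{i<..n}. Var j ^ s i j) + G' i \<and>
           g i \<noteq> 0 \<and>
           (\<forall>j\<in>{i<..n}. deg_in j (G' i) < ereal (real (s i j)) \<and>
                        deg_in j (H i) < ereal (real (s i j))) \<and>
           s i (i + 1) \<noteq> 0) \<and>
        F n = of_int (g n) * Var n + of_int hn \<and> g n \<noteq> 0)"

text \<open>
  Evaluation of P at the point w over the ring R, where the coefficients of P are mapped into R
  by \<open>\<phi>\<close>.
\<close>

definition mpoly_eval ::
    "('a, 'b) ring_scheme \<Rightarrow> (int \<Rightarrow> 'a) \<Rightarrow> int_mpoly \<Rightarrow> (nat \<Rightarrow> 'a) \<Rightarrow> 'a" where
  "mpoly_eval R \<phi> P w =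
     (\<Oplus>\<^bsub>R\<^esub>m\<in>Poly_Mapping.keys P. \<phi> (Poly_Mapping.lookup P m) \<otimes>\<^bsub>R\<^esub>
        (\<Otimes>\<^bsub>R\<^esub>i\<in>Poly_Mapping.keys m. w i [^]\<^bsub>R\<^esub> Poly_Mapping.lookup m i))"

text \<open>Points of affine n-space over R are the extensional functions on {1..n}.\<close>

definition system_map ::
    "('a, 'b) ring_scheme \<Rightarrow> (int \<Rightarrow> 'a) \<Rightarrow> nat \<Rightarrow> (nat \<Rightarrow> int_mpoly) \<Rightarrow>
     (nat \<Rightarrow> 'a) \<Rightarrow> (nat \<Rightarrow> 'a)" where
  "system_map R \<phi> n F w = (\<lambda>i\<in>{1..n}. mpoly_eval R \<phi> (F i) w)"

definition periodic_points ::
    "('a, 'b) ring_scheme \<Rightarrow> (int \<Rightarrow> 'a) \<Rightarrow> nat \<Rightarrow> (nat \<Rightarrow> int_mpoly) \<Rightarrow> nat \<Rightarrow>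
     (nat \<Rightarrow> 'a) set" where
  "periodic_points R \<phi> n F k =
     {w \<in> {1..n} \<rightarrow>\<^sub>E carrier R. (system_map R \<phi> n F ^^ k) w = w}"

definition complex_periodic_points ::
    "nat \<Rightarrow> (nat \<Rightarrow> int_mpoly) \<Rightarrow> nat \<Rightarrow> (nat \<Rightarrow> complex) set" where
  "complex_periodic_points n F k =
     periodic_points (ring_of_type_algebra :: complex ring) of_int n F k"

text \<open>
  The reduced polynomial has coefficients in {0..p-1}, the carrier of \<^term>\<open>residue_ring (int p)\<close>;
  \<open>indexed_const\<close> is the library's embedding of a field into its algebraic closure.
\<close>

definition reduce_mod :: "nat \<Rightarrow> int_mpoly \<Rightarrow> int_mpoly" where
  "reduce_mod p P = Poly_Mapping.map (\<lambda>c. c mod int p) P"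

definition periodic_points_mod ::
    "nat \<Rightarrow> nat \<Rightarrow> (nat \<Rightarrow> int_mpoly) \<Rightarrow> nat \<Rightarrow> (nat \<Rightarrow> (int list \<times> nat) multiset \<Rightarrow> int) set" where
  "periodic_points_mod p n F k =
     periodic_points (field.alg_closure (residue_ring (int p)))
       (ring.indexed_const (residue_ring (int p))) n (\<lambda>i. reduce_mod p (F i)) k"

end

theory Submission
  imports Defs "Jordan_Normal_Form.Char_Poly" "HOL-Analysis.Continuum_Not_Denumerable"
begin

text \<open>
  Write \<open>F\<^sup>k i = V i * A i + B i\<close>, where \<open>A i\<close> and \<open>B i\<close> only involve variables after \<open>V i\<close>. If there are only
  finitely many complex periodic points, then no \<open>A i\<close> takes the value \<open>1\<close> at any of them: for the smallest such
  \<open>i\<close> the \<open>i\<close>-th coordinate could be varied freely. So for each \<open>j\<close> the polynomials \<open>F\<^sup>k i - V i\<close> and \<open>A j - 1\<close>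
  have no common complex zero, and an arithmetic Nullstellensatz gives a nonzero integer of controlled size in
  the ideal which they generate over the integers. Modulo a prime that divides none of these integers, all \<open>A i\<close>
  differ from \<open>1\<close> at each periodic point; the equations then determine the coordinates of such a point one after
  another, and there is at most one periodic point.

  For the Nullstellensatz, let \<open>f s\<close> be integer polynomials of degree at most \<open>D\<close> without common complex zero. Let \<open>z\<close>
  be a new variable, and let \<open>g\<close> and \<open>h i\<close> be suitable small integer combinations of the \<open>f s\<close>. All polynomials form a
  free module over the ring generated by \<open>z\<close> and the elements \<open>Y i = V i ^ (D + 1) + z * h i\<close>, and multiplication by \<open>g\<close>
  has a determinant \<open>G\<close> which is a polynomial in \<open>z\<close> over the \<open>Y i\<close> and a multiple of \<open>g\<close>. Since \<open>1\<close> is a complex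
  combination of the \<open>f s\<close>, Noether normalisation shows that \<open>z\<close> is integral over the ring generated by the \<open>Y i\<close> and
  \<open>z * g\<close>. It follows that \<open>G\<close> divides a monic polynomial in \<open>z\<close>, so that its leading coefficient is a constant. This
  constant lies in the ideal of the \<open>f s\<close>, and it is bounded by the size of the determinant.
\<close>

section \<open>Evaluation, degrees and norms of polynomials\<close>

text \<open>The cofactors in a relation that expresses \<open>1\<close> by the \<open>f s\<close>
  come without any degree bound. They are therefore used only over the complex numbers, to show that
  a leading coefficient is constant; the integer itself is read off a determinant of known shape.
  With \<open>D = O(k^(n-1))\<close> this determinant has at most \<open>(D+1)^n\<close> rows, and
  the logarithm of the norm of an entry is at most of order \<open>D\<close> times the logarithm of
  \<open>1 + H1\<close>, where \<open>H1\<close> bounds the norms of \<open>g\<close> and the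
  \<open>h i\<close>. The integer combinations must have small coefficients too: a grid argument
  supplies coefficients polynomial in \<open>D\<close>. With the estimate \<open>O(k^(n*n))\<close>
  for \<open>log H1\<close> the exponent becomes \<open>n*(n-1) + (n-1) + n*n = 2*n*n - 1\<close>,
  and multiplying the integers for the different \<open>j\<close> does not change it. The power
  \<open>D + 1\<close> exceeds the degree of the perturbations, so these never touch the parts of
  top degree. Hence normal forms are unique, and products of multipliers correspond to products of
  matrices; this is how divisibility of polynomials becomes divisibility of determinants.\<close>

type_synonym 'a mpoly = "(nat \<Rightarrow>\<^sub>0 nat) \<Rightarrow>\<^sub>0 'a"

abbreviation "keys \<equiv> Poly_Mapping.keys"

abbreviation "lookup \<equiv> Poly_Mapping.lookup"

abbreviation Const :: "'a::zero \<Rightarrow> 'a mpoly" where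
  "Const c \<equiv> Poly_Mapping.single 0 c"

text \<open>The variables over an arbitrary coefficient ring; \<open>Var\<close> is the integer
  case.\<close>

definition V :: "nat \<Rightarrow> 'a::zero_neq_one mpoly" where
  "V i = Poly_Mapping.single (Poly_Mapping.single i 1) 1"

definition mval :: "(nat \<Rightarrow> 'b::comm_monoid_mult) \<Rightarrow> (nat \<Rightarrow>\<^sub>0 nat) \<Rightarrow> 'b" where
  "mval w m = (\<Prod>i\<in>keys m. w i ^ lookup m i)"

text \<open>The coefficient map \<open>\<phi>\<close> lets one evaluation serve several purposes:
  \<open>ev Const v\<close> substitutes polynomials, \<open>ev of_int w\<close> takes values at
  complex points, and \<open>ev TConst\<close> maps into polynomials in a further variable.\<close>

definition ev :: "('a::zero \<Rightarrow> 'b::comm_semiring_1) \<Rightarrow> (nat \<Rightarrow> 'b) \<Rightarrow> 'a mpoly \<Rightarrow> 'b" where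
  "ev \<phi> w P = (\<Sum>m\<in>keys P. \<phi> (lookup P m) * mval w m)"

lemma mval_superset:
  assumes "finite A" "keys m \<subseteq> A"
  shows "mval w m = (\<Prod>i\<in>A. w i ^ lookup m i)"
  unfolding mval_def by (rule prod.mono_neutral_left) (use assms in \<open>auto simp: in_keys_iff\<close>)

lemma keys_add_nat: "keys (a + b) = keys a \<union> keys (b :: 'a \<Rightarrow>\<^sub>0 nat)"
  by (auto simp: in_keys_iff lookup_add)

lemma mval_add: "mval w (a + b) = mval w a * mval w b"
proof -
  let ?A = "keys a \<union> keys b"
  have "mval w (a + b) = (\<Prod>i\<in>?A. w i ^ lookup (a + b) i)"
    by (rule mval_superset) (auto simp: keys_add_nat)
  also have "\<dots> = (\<Prod>i\<in>?A. w i ^ lookup a i) * (\<Prod>i\<in>?A. w i ^ lookup b i)"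
    by (simp add: lookup_add power_add prod.distrib)
  also have "\<dots> = mval w a * mval w b"
    by (subst (1 2) mval_superset[where A = ?A]) auto
  finally show ?thesis .
qed

lemma mval_0 [simp]: "mval w 0 = 1"
  by (simp add: mval_def)

lemma mval_single [simp]: "mval w (Poly_Mapping.single i k) = w i ^ k"
  by (simp add: mval_def)

lemma ev_superset:
  assumes "finite A" "keys P \<subseteq> A" "\<phi> 0 = 0"
  shows "ev \<phi> w P = (\<Sum>m\<in>A. \<phi> (lookup P m) * mval w m)"
  unfolding ev_def
  by (rule sum.mono_neutral_left) (use assms in \<open>auto simp: in_keys_iff\<close>)

lemma ev_add:
  assumes "\<phi> 0 = 0" "\<And>a b. \<phi> (a + b) = \<phi> a + \<phi> b"
  shows "ev \<phi> w (P + Q) = ev \<phi> w P + ev \<phi> w Q"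
proof -
  let ?A = "keys P \<union> keys Q"
  have "ev \<phi> w (P + Q) = (\<Sum>m\<in>?A. \<phi> (lookup (P + Q) m) * mval w m)"
    by (rule ev_superset) (use assms keys_add[of P Q] in auto)
  also have "\<dots> = (\<Sum>m\<in>?A. \<phi> (lookup P m) * mval w m) + (\<Sum>m\<in>?A. \<phi> (lookup Q m) * mval w m)"
    by (simp add: lookup_add assms distrib_right sum.distrib)
  also have "\<dots> = ev \<phi> w P + ev \<phi> w Q"
    by (subst (1 2) ev_superset[where A = ?A]) (use assms in auto)
  finally show ?thesis .
qed

lemma ev_0 [simp]: "ev \<phi> w 0 = 0"
  by (simp add: ev_def)

lemma ev_single: "\<phi> 0 = 0 \<Longrightarrow> ev \<phi> w (Poly_Mapping.single m c) = \<phi> c * mval w m"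
  by (simp add: ev_def)

lemma ev_sum:
  assumes "\<phi> 0 = 0" "\<And>a b. \<phi> (a + b) = \<phi> a + \<phi> b"
  shows "ev \<phi> w (sum P A) = (\<Sum>a\<in>A. ev \<phi> w (P a))"
  by (induction A rule: infinite_finite_induct) (auto simp: ev_add[of \<phi>] assms)

lemma sum_singles: "P = (\<Sum>m\<in>keys P. Poly_Mapping.single m (lookup P m))"
proof (rule poly_mapping_eqI)
  fix k
  have "lookup (\<Sum>m\<in>keys P. Poly_Mapping.single m (lookup P m)) k
      = (\<Sum>m\<in>keys P. if m = k then lookup P m else 0)"
    unfolding lookup_sum by (rule sum.cong) (auto simp: lookup_single when_def)
  also have "\<dots> = lookup P k"
    by (auto simp: in_keys_iff)
  finally show "lookup P k = lookup (\<Sum>m\<in>keys P. Poly_Mapping.single m (lookup P m)) k" by simp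
qed

lemma mult_singles:
  fixes P Q :: "'k::monoid_add \<Rightarrow>\<^sub>0 'a::semiring_0"
  shows "P * Q = (\<Sum>m\<in>keys P. \<Sum>m'\<in>keys Q. Poly_Mapping.single (m + m') (lookup P m * lookup Q m'))"
proof -
  have "P * Q = (\<Sum>m\<in>keys P. Poly_Mapping.single m (lookup P m)) * (\<Sum>m'\<in>keys Q. Poly_Mapping.single m' (lookup Q m'))"
    using sum_singles[of P] sum_singles[of Q] by simp
  then show ?thesis
    by (simp add: sum_product mult_single)
qed

lemma ev_mult:
  assumes "comm_ring_hom \<phi>"
  shows "ev \<phi> w (P * Q) = ev \<phi> w P * ev \<phi> w Q"
proof -
  interpret comm_ring_hom \<phi> by fact
  have "ev \<phi> w (P * Q) = (\<Sum>m\<in>keys P. \<Sum>m'\<in>keys Q. \<phi> (lookup P m * lookup Q m') * mval w (m + m'))"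
    by (subst mult_singles) (simp add: ev_sum hom_add ev_single)
  also have "\<dots> = ev \<phi> w P * ev \<phi> w Q"
    unfolding ev_def sum_product by (simp add: hom_mult mval_add algebra_simps)
  finally show ?thesis .
qed

lemma ev_hom:
  assumes "comm_ring_hom (\<phi> :: 'a::comm_ring_1 \<Rightarrow> 'b::comm_ring_1)"
  shows "comm_ring_hom (ev \<phi> w)"
proof -
  interpret comm_ring_hom \<phi> by fact
  show ?thesis
    by unfold_locales (auto simp: ev_add hom_add ev_mult[OF assms] ev_single simp flip: single_one)
qed

lemma ev_hom_comp:
  assumes "comm_ring_hom h"
  shows "h (ev \<phi> w P) = ev (\<lambda>c. h (\<phi> c)) (\<lambda>i. h (w i)) P"
proof -
  interpret comm_ring_hom h by fact
  show ?thesis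
    by (simp add: ev_def mval_def hom_sum hom_mult hom_prod hom_power)
qed

lemma Const_hom: "comm_ring_hom (Const :: 'a::comm_ring_1 \<Rightarrow> 'a mpoly)"
  by unfold_locales (auto simp: single_add mult_single)

lemma ev_Const:
  assumes "comm_ring_hom \<phi>"
  shows "ev \<phi> w (Const c) = \<phi> c"
proof -
  interpret comm_ring_hom \<phi> by fact
  show ?thesis by (simp add: ev_single)
qed

lemma ev_V:
  assumes "comm_ring_hom \<phi>"
  shows "ev \<phi> w (V i) = w i"
proof -
  interpret comm_ring_hom \<phi> by fact
  show ?thesis by (simp add: V_def ev_single)
qed

lemma mval_V: "mval V m = Poly_Mapping.single m (1::'a::comm_ring_1)"
proof (induction m rule: Poly_Mapping.update_induct)
  case const
  then show ?case by simp
next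
  case (update m a b)
  have eq: "Poly_Mapping.update a b m = m + Poly_Mapping.single a b"
    by (rule poly_mapping_eqI) (use update in \<open>auto simp: lookup_update lookup_add lookup_single in_keys_iff when_def\<close>)
  have "V a ^ b = Poly_Mapping.single (Poly_Mapping.single a b) (1::'a)"
    by (induction b) (auto simp: V_def mult_single simp flip: single_add)
  then show ?case
    by (simp add: eq mval_add update mult_single)
qed

text \<open>A polynomial as its own evaluation: that a subring contains all polynomials then reduces
  to constants and variables.\<close>

lemma ev_Const_V: "ev Const V P = (P :: 'a::comm_ring_1 mpoly)"
  by (subst (2) sum_singles[of P]) (simp add: ev_def mval_V mult_single)

lemma hom_eq_ev:
  assumes "comm_ring_hom h"
  shows "h P = ev (\<lambda>c. h (Const c)) (\<lambda>i. h (V i)) (P :: 'a::comm_ring_1 mpoly)"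
  using ev_hom_comp[OF assms, of Const V P] by (simp add: ev_Const_V)

lemma ev_cong:
  assumes "\<And>m. m \<in> keys P \<Longrightarrow> \<phi> (lookup P m) = \<psi> (lookup P m)"
    and "\<And>m i. m \<in> keys P \<Longrightarrow> i \<in> keys m \<Longrightarrow> v i = w i"
  shows "ev \<phi> v P = ev \<psi> w P"
  unfolding ev_def mval_def by (intro sum.cong prod.cong refl arg_cong2[where f = "(*)"]) (auto simp: assms)

text \<open>Subrings are sets inside a fixed ring, since integrality is considered over many
  subrings of the same polynomial ring.\<close>

locale subring_closed =
  fixes S :: "'a::comm_ring_1 set"
  assumes zero_closed: "0 \<in> S" and one_closed: "1 \<in> S"
    and add_closed: "\<And>a b. a \<in> S \<Longrightarrow> b \<in> S \<Longrightarrow> a + b \<in> S"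
    and mult_closed: "\<And>a b. a \<in> S \<Longrightarrow> b \<in> S \<Longrightarrow> a * b \<in> S"
    and uminus_closed: "\<And>a. a \<in> S \<Longrightarrow> - a \<in> S"
begin

lemma sum_closed: "(\<And>a. a \<in> A \<Longrightarrow> f a \<in> S) \<Longrightarrow> sum f A \<in> S"
  by (induction A rule: infinite_finite_induct) (auto intro: zero_closed add_closed)

lemma prod_closed: "(\<And>a. a \<in> A \<Longrightarrow> f a \<in> S) \<Longrightarrow> prod f A \<in> S"
  by (induction A rule: infinite_finite_induct) (auto intro: one_closed mult_closed)

lemma power_closed: "a \<in> S \<Longrightarrow> a ^ k \<in> S"
  by (induction k) (auto intro: one_closed mult_closed)

lemma ev_closed:
  assumes "\<And>c. \<phi> c \<in> S" "\<And>m i. m \<in> keys P \<Longrightarrow> i \<in> keys m \<Longrightarrow> w i \<in> S"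
  shows "ev \<phi> w P \<in> S"
  unfolding ev_def mval_def
  by (intro sum_closed mult_closed prod_closed power_closed) (use assms in auto)

end

section \<open>Degree bounds with prescribed variables\<close>

definition mdeg :: "(nat \<Rightarrow>\<^sub>0 nat) \<Rightarrow> nat" where
  "mdeg m = (\<Sum>i\<in>keys m. lookup m i)"

lemma mdeg_superset: "finite A \<Longrightarrow> keys m \<subseteq> A \<Longrightarrow> mdeg m = (\<Sum>i\<in>A. lookup m i)"
  unfolding mdeg_def by (rule sum.mono_neutral_left) (auto simp: in_keys_iff)

lemma mdeg_add: "mdeg (a + b) = mdeg a + mdeg b"
proof -
  let ?A = "keys a \<union> keys b"
  have "mdeg (a + b) = (\<Sum>i\<in>?A. lookup a i) + (\<Sum>i\<in>?A. lookup b i)"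
    by (subst mdeg_superset[where A = ?A]) (auto simp: keys_add_nat lookup_add sum.distrib)
  then show ?thesis
    by (subst (1 2) mdeg_superset[where A = ?A]) auto
qed

lemma mdeg_0 [simp]: "mdeg 0 = 0"
  by (simp add: mdeg_def)

lemma mdeg_single [simp]: "mdeg (Poly_Mapping.single i k) = k"
  by (simp add: mdeg_def)

lemma lookup_le_mdeg: "lookup m i \<le> mdeg m"
  by (cases "i \<in> keys m") (auto simp: mdeg_def in_keys_iff intro: member_le_sum)

definition bdeg :: "nat set \<Rightarrow> nat \<Rightarrow> 'a::zero mpoly set" where
  "bdeg I d = {P. \<forall>m\<in>keys P. keys m \<subseteq> I \<and> mdeg m \<le> d}"

lemma bdeg_mono: "P \<in> bdeg I d \<Longrightarrow> I \<subseteq> J \<Longrightarrow> d \<le> e \<Longrightarrow> P \<in> bdeg J e"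
  by (fastforce simp: bdeg_def)

lemma bdeg_0 [simp]: "0 \<in> bdeg I d"
  by (simp add: bdeg_def)

lemma bdeg_Const [simp]: "Const c \<in> bdeg I d"
  by (simp add: bdeg_def)

lemma bdeg_1 [simp]: "1 \<in> bdeg I d"
  by (simp add: bdeg_def)

lemma bdeg_V [simp]: "i \<in> I \<Longrightarrow> 1 \<le> d \<Longrightarrow> V i \<in> bdeg I d"
  by (simp add: bdeg_def V_def)

lemma bdeg_add: "P \<in> bdeg I d \<Longrightarrow> Q \<in> bdeg I d \<Longrightarrow> P + Q \<in> bdeg I d"
  using keys_add[of P Q] by (auto simp: bdeg_def)

lemma bdeg_uminus: "P \<in> bdeg I d \<Longrightarrow> - P \<in> bdeg I (d::nat)" for P :: "'a::ab_group_add mpoly"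
  by (auto simp: bdeg_def in_keys_iff)

lemma bdeg_diff: "P \<in> bdeg I d \<Longrightarrow> Q \<in> bdeg I d \<Longrightarrow> P - Q \<in> bdeg I d" for P :: "'a::ab_group_add mpoly"
  using bdeg_add[of P I d "- Q"] bdeg_uminus[of Q I d] by simp

lemma bdeg_mult:
  fixes P Q :: "'a::comm_ring_1 mpoly"
  shows "P \<in> bdeg I d \<Longrightarrow> Q \<in> bdeg I e \<Longrightarrow> P * Q \<in> bdeg I (d + e)"
  using keys_mult[of P Q] by (fastforce simp: bdeg_def mdeg_add keys_add_nat)

lemma bdeg_sum: "(\<And>a. a \<in> A \<Longrightarrow> f a \<in> bdeg I d) \<Longrightarrow> sum f A \<in> bdeg I d"
  by (induction A rule: infinite_finite_induct) (auto intro: bdeg_add)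

lemma bdeg_power:
  fixes P :: "'a::comm_ring_1 mpoly"
  shows "P \<in> bdeg I d \<Longrightarrow> P ^ k \<in> bdeg I (k * d)"
  by (induction k) (auto intro: bdeg_mult simp: add.commute)

lemma bdeg_prod:
  fixes f :: "'b \<Rightarrow> 'a::comm_ring_1 mpoly"
  shows "(\<And>a. a \<in> A \<Longrightarrow> f a \<in> bdeg I (d a)) \<Longrightarrow> prod f A \<in> bdeg I (sum d A)"
  by (induction A rule: infinite_finite_induct) (auto intro: bdeg_mult)

lemma bdeg_ev:
  fixes w :: "nat \<Rightarrow> 'b::comm_ring_1 mpoly"
  assumes "P \<in> bdeg I d" "\<And>c. \<phi> c \<in> bdeg J 0" "\<And>i. i \<in> I \<Longrightarrow> w i \<in> bdeg J e"
  shows "ev \<phi> w P \<in> bdeg J (d * e)"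
  unfolding ev_def
proof (rule bdeg_sum)
  fix m assume m: "m \<in> keys P"
  have "mval w m \<in> bdeg J (\<Sum>i\<in>keys m. lookup m i * e)"
    unfolding mval_def by (intro bdeg_prod bdeg_power assms) (use m assms(1) in \<open>auto simp: bdeg_def\<close>)
  also have "(\<Sum>i\<in>keys m. lookup m i * e) = mdeg m * e"
    by (simp add: mdeg_def sum_distrib_right)
  finally have "\<phi> (lookup P m) * mval w m \<in> bdeg J (0 + mdeg m * e)"
    by (intro bdeg_mult assms)
  then show "\<phi> (lookup P m) * mval w m \<in> bdeg J (d * e)"
    by (rule bdeg_mono) (use m assms(1) in \<open>auto simp: bdeg_def\<close>)
qed

text \<open>These are the properties that a determinant estimate uses. They pass from the
  coefficients to \<open>l1\<close> and from there to \<open>pl1\<close>, so the locale is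
  interpreted in a tower of three rings.\<close>

locale seminorm =
  fixes \<nu> :: "'a::comm_ring_1 \<Rightarrow> real"
  assumes nu_0 [simp]: "\<nu> 0 = 0" and nu_nonneg [simp]: "0 \<le> \<nu> a" and nu_1: "\<nu> 1 \<le> 1"
    and nu_add: "\<nu> (a + b) \<le> \<nu> a + \<nu> b"
    and nu_mult: "\<nu> (a * b) \<le> \<nu> a * \<nu> b"
    and nu_uminus [simp]: "\<nu> (- a) = \<nu> a"
begin

lemma nu_sum: "\<nu> (sum f A) \<le> (\<Sum>a\<in>A. \<nu> (f a))"
  by (induction A rule: infinite_finite_induct) (auto intro: order_trans[OF nu_add])

lemma nu_power: "\<nu> (a ^ k) \<le> \<nu> a ^ k"
  by (induction k) (auto simp: nu_1 intro!: order_trans[OF nu_mult] mult_left_mono)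

lemma nu_prod: "\<nu> (prod f A) \<le> (\<Prod>a\<in>A. \<nu> (f a))"
  by (induction A rule: infinite_finite_induct) (auto simp: nu_1 intro!: order_trans[OF nu_mult] mult_left_mono)

end

abbreviation iabs :: "int \<Rightarrow> real" where
  "iabs c \<equiv> \<bar>real_of_int c\<bar>"

lemma seminorm_int: "seminorm iabs"
  by unfold_locales (auto simp: abs_mult simp flip: of_int_add)

lemma seminorm_complex: "seminorm (norm :: complex \<Rightarrow> real)"
  by unfold_locales (auto simp: norm_mult norm_triangle_ineq)

section \<open>Coefficient norms of polynomials\<close>

definition l1 :: "('a::zero \<Rightarrow> real) \<Rightarrow> ('k \<Rightarrow>\<^sub>0 'a) \<Rightarrow> real" where
  "l1 \<nu> P = (\<Sum>m\<in>keys P. \<nu> (lookup P m))"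

definition pl1 :: "('a::zero \<Rightarrow> real) \<Rightarrow> 'a poly \<Rightarrow> real" where
  "pl1 \<nu> p = (\<Sum>i\<le>Polynomial.degree p. \<nu> (Polynomial.coeff p i))"

context seminorm
begin

lemma l1_superset: "finite A \<Longrightarrow> keys P \<subseteq> A \<Longrightarrow> l1 \<nu> P = (\<Sum>m\<in>A. \<nu> (lookup P m))"
  unfolding l1_def by (rule sum.mono_neutral_left) (auto simp: in_keys_iff)

lemma l1_add: "l1 \<nu> (P + Q) \<le> l1 \<nu> P + l1 \<nu> Q"
proof -
  let ?A = "keys P \<union> keys Q"
  have "l1 \<nu> (P + Q) = (\<Sum>m\<in>?A. \<nu> (lookup (P + Q) m))"
    by (rule l1_superset) (use keys_add[of P Q] in auto)
  also have "\<dots> \<le> (\<Sum>m\<in>?A. \<nu> (lookup P m) + \<nu> (lookup Q m))"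
    by (rule sum_mono) (simp add: lookup_add nu_add)
  also have "\<dots> = l1 \<nu> P + l1 \<nu> Q"
    by (subst (1 2) l1_superset[where A = ?A]) (auto simp: sum.distrib)
  finally show ?thesis .
qed

lemma l1_single [simp]: "l1 \<nu> (Poly_Mapping.single m c) = \<nu> c"
  by (simp add: l1_def)

lemma l1_sum: "l1 \<nu> (sum f A) \<le> (\<Sum>a\<in>A. l1 \<nu> (f a))"
  by (induction A rule: infinite_finite_induct)
    (auto simp: l1_def[of _ 0] intro: order_trans[OF l1_add])

lemma l1_nonneg [simp]: "0 \<le> l1 \<nu> P"
  unfolding l1_def by (intro sum_nonneg) auto

lemma seminorm_l1: "seminorm (l1 \<nu> :: ('k::comm_monoid_add \<Rightarrow>\<^sub>0 'a) \<Rightarrow> real)"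
proof
  fix P Q :: "'k \<Rightarrow>\<^sub>0 'a"
  have "l1 \<nu> (P * Q) \<le> (\<Sum>m\<in>keys P. \<Sum>m'\<in>keys Q. \<nu> (lookup P m * lookup Q m'))"
    by (subst mult_singles, rule order_trans[OF l1_sum], intro sum_mono, rule order_trans[OF l1_sum]) simp
  also have "\<dots> \<le> (\<Sum>m\<in>keys P. \<Sum>m'\<in>keys Q. \<nu> (lookup P m) * \<nu> (lookup Q m'))"
    by (intro sum_mono nu_mult)
  also have "\<dots> = l1 \<nu> P * l1 \<nu> Q"
    by (simp add: l1_def sum_product)
  finally show "l1 \<nu> (P * Q) \<le> l1 \<nu> P * l1 \<nu> Q" .
  show "l1 \<nu> (- P) = l1 \<nu> P"
    by (simp add: l1_def)
qed (auto simp: l1_add nu_1 l1_def[of _ 0] simp flip: single_one)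

lemma pl1_superset: "Polynomial.degree p \<le> n \<Longrightarrow> pl1 \<nu> p = (\<Sum>i\<le>n. \<nu> (Polynomial.coeff p i))"
  unfolding pl1_def by (rule sum.mono_neutral_left) (auto simp: Polynomial.coeff_eq_0)

lemma pl1_pCons [simp]: "pl1 \<nu> (pCons a p) = \<nu> a + pl1 \<nu> p"
proof -
  have "pl1 \<nu> (pCons a p) = (\<Sum>i\<le>Suc (Polynomial.degree p). \<nu> (Polynomial.coeff (pCons a p) i))"
    by (rule pl1_superset) (simp add: degree_pCons_le)
  also have "\<dots> = \<nu> a + (\<Sum>i\<le>Polynomial.degree p. \<nu> (Polynomial.coeff p i))"
    by (subst sum.atMost_Suc_shift) simp
  finally show ?thesis by (simp add: pl1_def)
qed

lemma pl1_0 [simp]: "pl1 \<nu> 0 = 0"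
  by (simp add: pl1_def)

lemma pl1_nonneg [simp]: "0 \<le> pl1 \<nu> p"
  unfolding pl1_def by (intro sum_nonneg) auto

lemma pl1_add: "pl1 \<nu> (p + q) \<le> pl1 \<nu> p + pl1 \<nu> q"
proof -
  let ?n = "max (Polynomial.degree p) (Polynomial.degree q)"
  have "pl1 \<nu> (p + q) = (\<Sum>i\<le>?n. \<nu> (Polynomial.coeff (p + q) i))"
    by (rule pl1_superset) (simp add: degree_add_le_max)
  also have "\<dots> \<le> (\<Sum>i\<le>?n. \<nu> (Polynomial.coeff p i) + \<nu> (Polynomial.coeff q i))"
    by (intro sum_mono) (simp add: nu_add)
  also have "\<dots> = pl1 \<nu> p + pl1 \<nu> q"
    by (subst (1 2) pl1_superset[where n = ?n]) (auto simp: sum.distrib)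
  finally show ?thesis .
qed

lemma pl1_smult: "pl1 \<nu> (Polynomial.smult a p) \<le> \<nu> a * pl1 \<nu> p"
  by (induction p) (auto simp: distrib_left intro!: add_mono nu_mult)

lemma coeff_le_pl1: "\<nu> (Polynomial.coeff p i) \<le> pl1 \<nu> p"
proof -
  have "\<nu> (Polynomial.coeff p i) \<le> (\<Sum>i\<le>max i (Polynomial.degree p). \<nu> (Polynomial.coeff p i))"
    by (rule member_le_sum) auto
  also have "\<dots> = pl1 \<nu> p"
    by (rule pl1_superset[symmetric]) auto
  finally show ?thesis .
qed

lemma seminorm_pl1: "seminorm (pl1 \<nu>)"
proof
  fix p q :: "'a poly"
  show "pl1 \<nu> (p * q) \<le> pl1 \<nu> p * pl1 \<nu> q"
  proof (induction p)
    case (pCons a p)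
    have "pl1 \<nu> (pCons a p * q) \<le> pl1 \<nu> (Polynomial.smult a q) + pl1 \<nu> (pCons 0 (p * q))"
      by (simp add: pl1_add del: pl1_pCons)
    also have "\<dots> \<le> \<nu> a * pl1 \<nu> q + pl1 \<nu> p * pl1 \<nu> q"
      using pCons pl1_smult[of a q] by simp
    finally show ?case by (simp add: distrib_right)
  qed simp
  show "pl1 \<nu> (- p) = pl1 \<nu> p"
    by (simp add: pl1_def)
qed (auto simp: pl1_add nu_1 one_pCons)

lemma l1_ev:
  fixes \<phi> :: "'b::zero \<Rightarrow> 'a" and B :: real
  assumes "P \<in> bdeg I d" "\<And>i. i \<in> I \<Longrightarrow> \<nu> (w i) \<le> B" "1 \<le> B"
  shows "\<nu> (ev \<phi> w P) \<le> l1 (\<lambda>c. \<nu> (\<phi> c)) P * B ^ d"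
proof -
  have "\<nu> (\<phi> (lookup P m) * mval w m) \<le> \<nu> (\<phi> (lookup P m)) * B ^ d" if m: "m \<in> keys P" for m
  proof -
    have "\<nu> (mval w m) \<le> (\<Prod>i\<in>keys m. B ^ lookup m i)"
      unfolding mval_def
      by (rule order_trans[OF nu_prod], rule prod_mono)
        (use m assms in \<open>auto simp: bdeg_def intro!: order_trans[OF nu_power] power_mono\<close>)
    also have "\<dots> = B ^ mdeg m"
      by (simp add: mdeg_def power_sum)
    also have "\<dots> \<le> B ^ d"
      using m assms by (intro power_increasing) (auto simp: bdeg_def)
    finally show ?thesis
      by (intro order_trans[OF nu_mult] mult_left_mono) auto
  qed
  then show ?thesis
    unfolding ev_def l1_def sum_distrib_right
    by (intro order_trans[OF nu_sum] sum_mono)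
qed

end

section \<open>The weak Nullstellensatz over the complex numbers\<close>

text \<open>Gaussian elimination by induction on the equations: a pivot removes one equation and one
  unknown. This is the dimension count behind both the Nullstellensatz and Noether
  normalisation.\<close>

lemma ex_linear_relation:
  fixes c :: "'i \<Rightarrow> 'j \<Rightarrow> 'a::field"
  assumes "finite J" "finite I" "card J < card I"
  shows "\<exists>l. (\<exists>i\<in>I. l i \<noteq> 0) \<and> (\<forall>j\<in>J. (\<Sum>i\<in>I. l i * c i j) = 0)"
  using assms
proof (induction J arbitrary: I c rule: finite_induct)
  case empty
  then show ?case by (intro exI[of _ "\<lambda>_. 1"]) (auto simp: card_gt_0_iff)
next
  case (insert j J)
  show ?case
  proof (cases "\<forall>i\<in>I. c i j = 0")
    case True
    with insert.IH[of I c] insert.prems insert.hyps show ?thesis by auto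
  next
    case False
    then obtain p where p: "p \<in> I" "c p j \<noteq> 0" by auto
    let ?I = "I - {p}"
    have "card J < card ?I"
      using insert.prems insert.hyps p by simp
    \<comment> \<open>Equation \<open>j\<close> forces the value of the unknown with index
      \<open>p\<close>; substituting it into the other equations changes their coefficients in this
      way.\<close>
    from insert.IH[OF _ this, of "\<lambda>i j'. c i j' - c i j / c p j * c p j'"] insert.prems
    obtain l where l: "\<exists>i\<in>?I. l i \<noteq> 0"
      "\<And>j'. j' \<in> J \<Longrightarrow> (\<Sum>i\<in>?I. l i * (c i j' - c i j / c p j * c p j')) = 0" by auto
    define l' where "l' = l(p := - (\<Sum>i\<in>?I. l i * c i j) / c p j)"
    have eq: "(\<Sum>i\<in>I. l' i * c i j') = (\<Sum>i\<in>?I. l i * c i j') - (\<Sum>i\<in>?I. l i * c i j) / c p j * c p j'" for j'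
    proof -
      have "(\<Sum>i\<in>I. l' i * c i j') = l' p * c p j' + (\<Sum>i\<in>?I. l' i * c i j')"
        by (rule sum.remove) (use p insert.prems in auto)
      also have "(\<Sum>i\<in>?I. l' i * c i j') = (\<Sum>i\<in>?I. l i * c i j')"
        by (rule sum.cong) (auto simp: l'_def)
      finally show ?thesis by (simp add: l'_def)
    qed
    have "(\<Sum>i\<in>I. l' i * c i j') = 0" if "j' \<in> J" for j'
      using l(2)[OF that] unfolding eq
      by (simp add: algebra_simps sum_subtractf sum_distrib_left sum_distrib_right sum_divide_distrib)
    moreover have "(\<Sum>i\<in>I. l' i * c i j) = 0"
      unfolding eq using p by simp
    moreover have "\<exists>i\<in>I. l' i \<noteq> 0"
      using l(1) by (auto simp: l'_def)
    ultimately show ?thesis by auto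
  qed
qed

lemma monomials_inj:
  "inj_on (\<lambda>m. restrict (lookup m) I) {m. keys m \<subseteq> I \<and> mdeg m \<le> d}"
proof (intro inj_onI poly_mapping_eqI)
  fix m m' :: "nat \<Rightarrow>\<^sub>0 nat" and k
  assume "m \<in> {m. keys m \<subseteq> I \<and> mdeg m \<le> d}" "m' \<in> {m. keys m \<subseteq> I \<and> mdeg m \<le> d}"
    "restrict (lookup m) I = restrict (lookup m') I"
  then show "lookup m k = lookup m' k"
    by (cases "k \<in> I") (force dest: fun_cong[of _ _ k], metis (no_types, lifting) in_keys_iff mem_Collect_eq subsetD)
qed

lemma monomials_image:
  "(\<lambda>m. restrict (lookup m) I) ` {m. keys m \<subseteq> I \<and> mdeg m \<le> d} \<subseteq> PiE I (\<lambda>_. {..d})"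
  by (auto intro: order_trans[OF lookup_le_mdeg])

lemma finite_monomials: "finite I \<Longrightarrow> finite {m. keys m \<subseteq> I \<and> mdeg m \<le> d}"
  by (rule inj_on_finite[OF monomials_inj monomials_image]) (auto intro: finite_PiE)

lemma card_monomials: "finite I \<Longrightarrow> card {m. keys m \<subseteq> I \<and> mdeg m \<le> d} \<le> (d + 1) ^ card I"
  using card_inj_on_le[OF monomials_inj[of I d] monomials_image] by (simp add: card_PiE finite_PiE)

text \<open>With a single parameter for variables and degree the polynomial ring becomes a countable
  union of finite-dimensional spaces.\<close>

lemma ex_bdeg: "\<exists>d. P \<in> bdeg {..<d} d"
proof -
  define d where "d = (\<Sum>m\<in>keys P. mdeg m) + (\<Sum>m\<in>keys P. \<Sum>i\<in>keys m. Suc i)"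
  have "mdeg m \<le> d" if "m \<in> keys P" for m
    unfolding d_def by (intro trans_le_add1 member_le_sum) (use that in auto)
  moreover have "i < d" if "m \<in> keys P" "i \<in> keys m" for m i
  proof -
    have "Suc i \<le> (\<Sum>i\<in>keys m. Suc i)" by (intro member_le_sum) (use that in auto)
    also have "\<dots> \<le> (\<Sum>m\<in>keys P. \<Sum>i\<in>keys m. Suc i)"
      using that member_le_sum[of m "keys P" "\<lambda>m. \<Sum>i\<in>keys m. Suc i"] by auto
    finally show ?thesis by (simp add: d_def)
  qed
  ultimately show ?thesis by (auto simp: bdeg_def intro!: exI[of _ d])
qed

section \<open>Ideals, maximal ideals and points\<close>

locale ideal_set =
  fixes M :: "'a::comm_ring_1 set"
  assumes zero: "0 \<in> M" and add: "\<And>a b. a \<in> M \<Longrightarrow> b \<in> M \<Longrightarrow> a + b \<in> M"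
    and mult: "\<And>a b. b \<in> M \<Longrightarrow> a * b \<in> M"
begin

lemma sum: "(\<And>a. a \<in> A \<Longrightarrow> f a \<in> M) \<Longrightarrow> sum f A \<in> M"
  by (induction A rule: infinite_finite_induct) (auto intro: zero add)

lemma uminus: "a \<in> M \<Longrightarrow> - a \<in> M"
  using mult[of a "- 1"] by simp

lemma diff: "a \<in> M \<Longrightarrow> b \<in> M \<Longrightarrow> a - b \<in> M"
  using add[of a "- b"] uminus by simp

end

definition idl :: "'i set \<Rightarrow> ('i \<Rightarrow> 'a::comm_ring_1) \<Rightarrow> 'a set" where
  "idl A f = {P. \<exists>q. P = (\<Sum>s\<in>A. q s * f s)}"

lemma ideal_set_idl: "ideal_set (idl A f)"
proof
  show "0 \<in> idl A f" by (auto simp: idl_def intro!: exI[of _ "\<lambda>_. 0"])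
next
  fix a b assume "a \<in> idl A f" "b \<in> idl A f"
  then obtain q r where "a = (\<Sum>s\<in>A. q s * f s)" "b = (\<Sum>s\<in>A. r s * f s)" by (auto simp: idl_def)
  then have "a + b = (\<Sum>s\<in>A. (q s + r s) * f s)" by (simp add: distrib_right sum.distrib)
  then show "a + b \<in> idl A f" by (auto simp: idl_def)
next
  fix a b assume "b \<in> idl A f"
  then obtain q where "b = (\<Sum>s\<in>A. q s * f s)" by (auto simp: idl_def)
  then have "a * b = (\<Sum>s\<in>A. (a * q s) * f s)" by (simp add: sum_distrib_left mult.assoc)
  then show "a * b \<in> idl A f" by (auto simp: idl_def)
qed

lemma idl_base: "finite A \<Longrightarrow> s \<in> A \<Longrightarrow> f s \<in> idl A f"
  unfolding idl_def
  by (auto simp: if_distrib[of "\<lambda>x. x * _"] cong: if_cong intro!: exI[of _ "\<lambda>t. if t = s then 1 else 0"])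

text \<open>Zorn's lemma for proper ideals. The last clause says that the quotient is a field,
  without forming the quotient.\<close>

lemma ex_maximal_ideal:
  assumes "ideal_set I" "1 \<notin> I"
  shows "\<exists>M. ideal_set M \<and> I \<subseteq> M \<and> 1 \<notin> M \<and> (\<forall>t. t \<notin> M \<longrightarrow> (\<exists>r. r * t - 1 \<in> M))"
proof -
  define \<A> where "\<A> = {J. ideal_set J \<and> I \<subseteq> J \<and> 1 \<notin> J}"
  have "\<exists>M\<in>\<A>. \<forall>J\<in>\<A>. M \<subseteq> J \<longrightarrow> J = M"
  proof (rule subset_Zorn_nonempty)
    show "\<A> \<noteq> {}" using assms by (auto simp: \<A>_def)
  next
    fix \<C> assume C: "\<C> \<noteq> {}" "subset.chain \<A> \<C>"
    have sub: "\<C> \<subseteq> \<A>" and chain: "\<And>S T. S \<in> \<C> \<Longrightarrow> T \<in> \<C> \<Longrightarrow> S \<subseteq> T \<or> T \<subseteq> S"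
      using C(2) by (auto simp: subset_chain_def)
    have id: "ideal_set S" if "S \<in> \<C>" for S using sub that by (auto simp: \<A>_def)
    have "ideal_set (\<Union>\<C>)"
    proof
      show "0 \<in> \<Union>\<C>" using C(1) id ideal_set.zero by fast
      show "a + b \<in> \<Union>\<C>" if ab: "a \<in> \<Union>\<C>" "b \<in> \<Union>\<C>" for a b
      proof -
        obtain S T where "a \<in> S" "b \<in> T" "S \<in> \<C>" "T \<in> \<C>" using ab by auto
        then show ?thesis using chain[of S T] id ideal_set.add by (metis UnionI subsetD)
      qed
      show "a * b \<in> \<Union>\<C>" if "b \<in> \<Union>\<C>" for a b
        using that id ideal_set.mult by fast
    qed
    then show "\<Union>\<C> \<in> \<A>" using C(1) sub unfolding \<A>_def by blast
  qed
  then obtain M where M: "M \<in> \<A>" "\<And>J. J \<in> \<A> \<Longrightarrow> M \<subseteq> J \<Longrightarrow> J = M" by auto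
  interpret ideal_set M using M by (auto simp: \<A>_def)
  have "\<exists>r. r * t - 1 \<in> M" if t: "t \<notin> M" for t
  proof (rule ccontr)
    assume no: "\<nexists>r. r * t - 1 \<in> M"
    \<comment> \<open>The ideal generated by \<open>M\<close> and \<open>t\<close>; without an
      inverse of \<open>t\<close> modulo \<open>M\<close> it would be proper, against
      maximality.\<close>
    define J where "J = {x. \<exists>r. x - r * t \<in> M}"
    have "ideal_set J"
    proof
      show "0 \<in> J" using zero by (auto simp: J_def intro!: exI[of _ 0])
      show "a + b \<in> J" if ab: "a \<in> J" "b \<in> J" for a b
      proof -
        obtain r r' where "a - r * t \<in> M" "b - r' * t \<in> M" using ab by (auto simp: J_def)
        from add[OF this] show ?thesis by (auto simp: J_def algebra_simps intro!: exI[of _ "r + r'"])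
      qed
      show "a * b \<in> J" if b: "b \<in> J" for a b
      proof -
        obtain r where "b - r * t \<in> M" using b by (auto simp: J_def)
        from mult[OF this, of a] show ?thesis by (auto simp: J_def algebra_simps intro!: exI[of _ "a * r"])
      qed
    qed
    moreover have MJ: "M \<subseteq> J" by (auto simp: J_def intro!: exI[of _ 0])
    moreover have "1 \<notin> J"
      using no uminus by (force simp: J_def)
    moreover have "I \<subseteq> J" using M(1) MJ by (auto simp: \<A>_def)
    ultimately have "J = M" using M(2)[of J] by (auto simp: \<A>_def)
    moreover have "t \<in> J" using zero by (auto simp: J_def intro!: exI[of _ 1])
    ultimately show False using t by simp
  qed
  then show ?thesis using M(1) by (auto simp: \<A>_def)
qed

abbreviation evc :: "(nat \<Rightarrow> 'a::comm_ring_1) \<Rightarrow> 'a mpoly \<Rightarrow> 'a" where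
  "evc \<equiv> ev (\<lambda>c. c)"

lemma id_hom: "comm_ring_hom (\<lambda>c. c)"
  by unfold_locales auto

text \<open>The complex numbers are uncountable, while the residue field modulo \<open>M\<close> has
  countable dimension. If \<open>V i\<close> were congruent to no constant, the inverses of the
  \<open>V i - c\<close> would be uncountably many linearly independent elements.\<close>

lemma maximal_ideal_point:
  fixes M :: "complex mpoly set"
  assumes M: "ideal_set M" and one: "1 \<notin> M" and max: "\<And>t. t \<notin> M \<Longrightarrow> \<exists>r. r * t - 1 \<in> M"
  shows "\<exists>c. V i - Const c \<in> M"
proof (rule ccontr)
  interpret ideal_set M by fact
  interpret C: comm_ring_hom "Const :: complex \<Rightarrow> complex mpoly" by (rule Const_hom)
  interpret CP: map_poly_comm_ring_hom "Const :: complex \<Rightarrow> complex mpoly" ..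
  assume "\<nexists>c. V i - Const c \<in> M"
  then have no: "V i - Const c \<notin> M" for c by blast
  let ?\<eta> = "\<lambda>p. poly (map_poly Const p) (V i)"
  \<comment> \<open>A nonzero polynomial in \<open>V i\<close> splits into a constant and linear
    factors, all invertible modulo \<open>M\<close>; so \<open>V i\<close> is transcendental modulo
    \<open>M\<close>.\<close>
  have \<eta>: "?\<eta> p \<notin> M" if "p \<noteq> 0" for p
    using that
  proof (induction "Polynomial.degree p" arbitrary: p rule: less_induct)
    case less
    show ?case
    proof (cases "Polynomial.degree p = 0")
      case True
      then obtain a where a: "p = [:a:]" "a \<noteq> 0" using less.prems by (metis degree_eq_zeroE pCons_0_0)
      show ?thesis
      proof
        assume "?\<eta> p \<in> M"
        from mult[OF this, of "Const (1 / a)"] a one show False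
          by (simp add: mult_single)
      qed
    next
      case False
      then obtain z where "poly p z = 0"
        using fundamental_theorem_of_algebra[of p] constant_degree[of p] by auto
      then obtain q where q: "p = [:- z, 1:] * q" by (auto simp: poly_eq_0_iff_dvd elim: dvdE)
      then have q0: "q \<noteq> 0" "Polynomial.degree q < Polynomial.degree p"
        using less.prems by (auto simp: degree_mult_eq simp del: mult_pCons_left)
      have "map_poly Const p = map_poly Const [:- z, 1:] * map_poly Const q"
        unfolding q by (rule CP.hom_mult)
      then have eq: "?\<eta> p = (V i - Const z) * ?\<eta> q"
        by (simp add: C.hom_uminus left_diff_distrib)
      show ?thesis
      proof
        assume p: "?\<eta> p \<in> M"
        obtain r where "r * (V i - Const z) - 1 \<in> M" using max no by blast
        from diff[OF mult[OF p, of r] mult[OF this, of "?\<eta> q"]] have "?\<eta> q \<in> M"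
          unfolding eq by (simp add: algebra_simps)
        with less.hyps q0 show False by blast
      qed
    qed
  qed
  have "\<exists>q. q * (V i - Const c) - 1 \<in> M" for c using max no by blast
  then obtain q where q: "\<And>c. q c * (V i - Const c) - 1 \<in> M" by metis
  \<comment> \<open>Uncountably many \<open>c\<close> are distributed over countably many
    finite-dimensional spaces, so one of these contains infinitely many of the chosen
    inverses.\<close>
  have "\<exists>d. infinite {c. q c \<in> bdeg {..<d} d}"
  proof (rule ccontr)
    assume "\<not> ?thesis"
    then have "countable (\<Union>d. {c. q c \<in> bdeg {..<d} d})" by (auto intro: countable_finite)
    moreover have "(\<Union>d. {c. q c \<in> bdeg {..<d} d}) = UNIV" using ex_bdeg by auto
    ultimately have "countable (UNIV :: complex set)" by simp
    with uncountable_UNIV_complex show False by simp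
  qed
  then obtain d where d: "infinite {c. q c \<in> bdeg {..<d} d}" by auto
  define K where "K = {m. keys m \<subseteq> {..<d} \<and> mdeg m \<le> d}"
  have K: "finite K" unfolding K_def by (rule finite_monomials) auto
  obtain S where S: "S \<subseteq> {c. q c \<in> bdeg {..<d} d}" "finite S" "card S = Suc (card K)"
    using infinite_arbitrarily_large[OF d] by blast
  obtain l where l: "\<exists>c\<in>S. l c \<noteq> 0" "\<And>m. m \<in> K \<Longrightarrow> (\<Sum>c\<in>S. l c * lookup (q c) m) = 0"
    using ex_linear_relation[OF K S(2), of "\<lambda>c m. lookup (q c) m"] S(3) by auto
  have lk: "lookup (Const a * P) m = a * lookup P m" for a :: complex and P m
    by (simp add: Poly_Mapping.map.rep_eq when_def flip: mult_map_scale_conv_mult)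
  have zero': "(\<Sum>c\<in>S. Const (l c) * q c) = 0"
  proof (rule poly_mapping_eqI)
    fix m
    have "lookup (q c) m = 0" if "c \<in> S" "m \<notin> K" for c
    proof -
      have "q c \<in> bdeg {..<d} d" using that S(1) by auto
      then have "m \<notin> keys (q c)" using that by (auto simp: K_def bdeg_def)
      then show ?thesis by (simp only: in_keys_iff not_not)
    qed
    then show "lookup (\<Sum>c\<in>S. Const (l c) * q c) m = lookup 0 m"
      using l(2)[of m] by (cases "m \<in> K") (auto simp: lookup_sum lk)
  qed
  \<comment> \<open>The numerator of the sum of the fractions \<open>l c / (X - c)\<close> over the
    common denominator; at \<open>c0\<close> only one summand survives.\<close>
  define p where "p = (\<Sum>c\<in>S. Polynomial.smult (l c) (\<Prod>c'\<in>S - {c}. [:- c', 1:]))"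
  obtain c0 where c0: "c0 \<in> S" "l c0 \<noteq> 0" using l(1) by auto
  have "poly p c0 = (\<Sum>c\<in>S. l c * (\<Prod>c'\<in>S - {c}. c0 - c'))"
    by (simp add: p_def poly_sum poly_prod)
  also have "\<dots> = (\<Sum>c\<in>S. if c = c0 then l c0 * (\<Prod>c'\<in>S - {c0}. c0 - c') else 0)"
    using S(2) c0 by (intro sum.cong refl) auto
  also have "\<dots> = l c0 * (\<Prod>c'\<in>S - {c0}. c0 - c')"
    using S(2) c0 by simp
  also have "\<dots> \<noteq> 0" using c0 S(2) by auto
  finally have "p \<noteq> 0" by auto
  have "?\<eta> p = (\<Sum>c\<in>S. Const (l c) * (\<Prod>c'\<in>S - {c}. V i - Const c'))"
    by (simp add: p_def CP.hom_sum CP.hom_prod poly_sum poly_prod C.hom_uminus C.map_poly_hom_smult)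
  \<comment> \<open>Modulo \<open>M\<close> the factor \<open>V i - c\<close> missing in the summand
    of \<open>c\<close> may be supplied together with its inverse \<open>q c\<close>.\<close>
  also have "\<dots> = (\<Sum>c\<in>S. Const (l c) * q c) * (\<Prod>c\<in>S. V i - Const c)
      - (\<Sum>c\<in>S. Const (l c) * (\<Prod>c'\<in>S - {c}. V i - Const c') * (q c * (V i - Const c) - 1))"
    unfolding sum_distrib_right sum_subtractf[symmetric]
  proof (rule sum.cong[OF refl])
    fix c assume "c \<in> S"
    then have eq: "(\<Prod>c\<in>S. V i - Const c) = (V i - Const c) * (\<Prod>c'\<in>S - {c}. V i - Const c')"
      using S(2) by (rule prod.remove[rotated])
    show "Const (l c) * (\<Prod>c'\<in>S - {c}. V i - Const c') =
      Const (l c) * q c * (\<Prod>c\<in>S. V i - Const c) -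
      Const (l c) * (\<Prod>c'\<in>S - {c}. V i - Const c') * (q c * (V i - Const c) - 1)"
      unfolding eq by (simp add: algebra_simps)
  qed
  also have "\<dots> \<in> M" unfolding zero' by (simp, intro uminus sum mult q)
  finally show False using \<eta>[OF \<open>p \<noteq> 0\<close>] by simp
qed

text \<open>A maximal ideal containing the \<open>f s\<close> yields a point \<open>w\<close>. Every
  polynomial is congruent to its value at \<open>w\<close>, so the values of the \<open>f s\<close>
  are constants in a proper ideal, hence zero.\<close>

theorem weak_nullstellensatz:
  fixes f :: "'i \<Rightarrow> complex mpoly"
  assumes A: "finite A" and no_zero: "\<And>w. \<exists>s\<in>A. evc w (f s) \<noteq> 0"
  shows "1 \<in> idl A f"
proof (rule ccontr)
  assume "1 \<notin> idl A f"
  from ex_maximal_ideal[OF ideal_set_idl this] obtain M where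
    M: "ideal_set M" "idl A f \<subseteq> M" "1 \<notin> M" "\<And>t. t \<notin> M \<Longrightarrow> \<exists>r. r * t - 1 \<in> M" by blast
  interpret ideal_set M by fact
  interpret C: comm_ring_hom "Const :: complex \<Rightarrow> complex mpoly" by (rule Const_hom)
  have "\<exists>c. V i - Const c \<in> M" for i
    by (rule maximal_ideal_point[OF M(1,3,4)])
  then obtain w where w: "\<And>i. V i - Const (w i) \<in> M" by metis
  interpret E: comm_ring_hom "evc w" by (rule ev_hom[OF id_hom])
  define S where "S = {P. P - Const (evc w P) \<in> M}"
  interpret S: subring_closed S
  proof
    fix a b assume ab: "a \<in> S" "b \<in> S"
    then have "a - Const (evc w a) \<in> M" "b - Const (evc w b) \<in> M" by (auto simp: S_def)
    from add[OF this] show "a + b \<in> S"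
      by (simp add: S_def E.hom_add C.hom_add algebra_simps)
    have "b * (a - Const (evc w a)) + Const (evc w a) * (b - Const (evc w b)) \<in> M"
      using ab by (intro add mult) (auto simp: S_def)
    then show "a * b \<in> S"
      by (simp add: S_def E.hom_mult C.hom_mult algebra_simps)
  next
    fix a assume "a \<in> S"
    then have "- (a - Const (evc w a)) \<in> M" by (intro uminus) (auto simp: S_def)
    then show "- a \<in> S" by (simp add: S_def E.hom_uminus C.hom_uminus)
  qed (auto simp: S_def zero)
  have "ev Const V P \<in> S" for P
    by (rule S.ev_closed) (auto simp: S_def w zero ev_V[OF id_hom] ev_Const[OF id_hom])
  then have S: "P - Const (evc w P) \<in> M" for P by (simp add: ev_Const_V S_def)
  obtain s where s: "s \<in> A" "evc w (f s) \<noteq> 0" using no_zero by blast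
  have "f s \<in> M" using idl_base[OF A s(1)] M(2) by blast
  from diff[OF this S[of "f s"]] have "Const (evc w (f s)) \<in> M" by simp
  from mult[OF this, of "Const (1 / evc w (f s))"] have "1 \<in> M" using s(2) by (simp add: mult_single)
  with M(3) show False by simp
qed

section \<open>Finitely generated modules and integrality\<close>

definition fspan :: "'a::comm_ring_1 set \<Rightarrow> nat \<Rightarrow> (nat \<Rightarrow> 'a) \<Rightarrow> 'a set" where
  "fspan S N b = {x. \<exists>c. (\<forall>i<N. c i \<in> S) \<and> x = (\<Sum>i<N. c i * b i)}"

text \<open>Containing \<open>1\<close> makes the module faithful, which is what the determinant
  trick needs.\<close>

definition fg_module :: "'a::comm_ring_1 set \<Rightarrow> 'a set \<Rightarrow> bool" where
  "fg_module S M \<longleftrightarrow> (\<exists>N b. M = fspan S N b) \<and> 1 \<in> M"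

text \<open>Multipliers of a finitely generated module are integral over the base ring and form a
  ring. Enlarging one module step by step therefore replaces the transitivity of integral
  extensions.\<close>

definition multiplier :: "'a::comm_ring_1 set \<Rightarrow> 'a set" where
  "multiplier M = {t. \<forall>x\<in>M. t * x \<in> M}"

definition integral_over :: "'a::comm_ring_1 set \<Rightarrow> 'a \<Rightarrow> bool" where
  "integral_over S t \<longleftrightarrow> (\<exists>p. Polynomial.lead_coeff p = 1 \<and> (\<forall>i. Polynomial.coeff p i \<in> S) \<and> poly p t = 0)"

lemma mixed_radix_less: "j < d \<Longrightarrow> i < N \<Longrightarrow> j * N + i < d * (N::nat)"
proof -
  assume "j < d" "i < N"
  then have "j * N + i < Suc j * N" by simp
  also have "\<dots> \<le> d * N" using \<open>j < d\<close> by (intro mult_le_mono1) simp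
  finally show ?thesis .
qed

lemma fspan_sum_closed:
  assumes "subring_closed S" "finite A" "\<And>a. a \<in> A \<Longrightarrow> x a \<in> fspan S N b"
  shows "sum x A \<in> fspan S N b"
proof -
  interpret subring_closed S by fact
  have "\<forall>a\<in>A. \<exists>c. (\<forall>i<N. c i \<in> S) \<and> x a = (\<Sum>i<N. c i * b i)"
    using assms(3) by (auto simp: fspan_def)
  then obtain c where c: "\<And>a i. a \<in> A \<Longrightarrow> i < N \<Longrightarrow> c a i \<in> S" "\<And>a. a \<in> A \<Longrightarrow> x a = (\<Sum>i<N. c a i * b i)"
    by (auto simp: bchoice_iff)
  have "sum x A = (\<Sum>i<N. (\<Sum>a\<in>A. c a i) * b i)"
    by (simp add: c(2) sum_distrib_right) (rule sum.swap)
  then show ?thesis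
    unfolding fspan_def using c(1) by (auto intro!: exI[of _ "\<lambda>i. \<Sum>a\<in>A. c a i"] sum_closed)
qed

lemma fspan_scale:
  assumes "subring_closed S" "s \<in> S" "x \<in> fspan S N b"
  shows "s * x \<in> fspan S N b"
proof -
  interpret subring_closed S by fact
  from assms(3) obtain c where "\<forall>i<N. c i \<in> S" "x = (\<Sum>i<N. c i * b i)" by (auto simp: fspan_def)
  then show ?thesis
    using assms(2) unfolding fspan_def
    by (auto simp: sum_distrib_left mult.assoc intro!: exI[of _ "\<lambda>i. s * c i"] mult_closed)
qed

lemma fspan_base:
  assumes "subring_closed S" "i < N"
  shows "b i \<in> fspan S N b"
proof -
  interpret subring_closed S by fact
  have "b i = (\<Sum>j<N. (if j = i then 1 else 0) * b j)"
    using assms(2) by (simp add: if_distrib[of "\<lambda>x. x * _"] cong: if_cong)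
  then show ?thesis
    unfolding fspan_def by (auto intro!: exI[of _ "\<lambda>j. if j = i then 1 else 0"] zero_closed one_closed)
qed

lemma multiplier_subring:
  assumes S: "subring_closed S" and M: "fg_module S M"
  shows "subring_closed (multiplier M)" "S \<subseteq> multiplier M"
proof -
  interpret subring_closed S by fact
  obtain N b where N: "M = fspan S N b" using M by (auto simp: fg_module_def)
  have add: "x + y \<in> M" if "x \<in> M" "y \<in> M" for x y
    using fspan_sum_closed[OF S, of "UNIV :: bool set" "\<lambda>a. if a then x else y" N b] that
    by (simp add: N UNIV_bool add.commute)
  have scale: "s * x \<in> M" if "s \<in> S" "x \<in> M" for s x
    using fspan_scale[OF S] that by (simp add: N)
  show "S \<subseteq> multiplier M" by (auto simp: multiplier_def scale)
  show "subring_closed (multiplier M)"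
  proof
    show "0 \<in> multiplier M" using scale[OF zero_closed] by (auto simp: multiplier_def)
    show "1 \<in> multiplier M" by (auto simp: multiplier_def)
    show "a + b \<in> multiplier M" if "a \<in> multiplier M" "b \<in> multiplier M" for a b
      using that add by (auto simp: multiplier_def distrib_right)
    show "a * b \<in> multiplier M" if "a \<in> multiplier M" "b \<in> multiplier M" for a b
      using that by (auto simp: multiplier_def mult.assoc)
    show "- a \<in> multiplier M" if "a \<in> multiplier M" for a
      using that scale[OF uminus_closed[OF one_closed]] by (auto simp: multiplier_def)
  qed
qed

text \<open>The powers of \<open>t\<close> below the degree of its equation multiply the generators of \<open>M\<close>.\<close>

lemma fg_module_adjoin:
  assumes S: "subring_closed S" and M: "fg_module S M" and t: "integral_over (multiplier M) t"
  shows "\<exists>M'. fg_module S M' \<and> multiplier M \<subseteq> multiplier M' \<and> t \<in> multiplier M'"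
proof -
  interpret S: subring_closed S by fact
  interpret T: subring_closed "multiplier M" by (rule multiplier_subring[OF S M])
  obtain p where p: "Polynomial.lead_coeff p = 1" "\<And>i. Polynomial.coeff p i \<in> multiplier M" "poly p t = 0"
    using t by (auto simp: integral_over_def)
  obtain N b where N: "M = fspan S N b" and one: "1 \<in> M" using M by (auto simp: fg_module_def)
  \<comment> \<open>The powers up to and including the degree are kept, so \<open>j = 0\<close>
    always occurs and \<open>1\<close> is in \<open>M'\<close> without a case distinction.\<close>
  define d where "d = Suc (Polynomial.degree p)"
  define M' where "M' = {x. \<exists>m. (\<forall>j<d. m j \<in> M) \<and> x = (\<Sum>j<d. t ^ j * m j)}"
  \<comment> \<open>The generators \<open>t ^ j * b i\<close> are numbered by
    \<open>k = j * N + i\<close>.\<close>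
  define b' where "b' k = t ^ (k div N) * b (k mod N)" for k
  have split: "(\<Sum>k<d * N. g (k div N) (k mod N)) = (\<Sum>j<d. \<Sum>i<N. g j i)" for g :: "nat \<Rightarrow> nat \<Rightarrow> 'a"
  proof (cases "N = 0")
    case False
    have "(\<Sum>j<d. \<Sum>i<N. g j i) = (\<Sum>(j, i)\<in>{..<d} \<times> {..<N}. g j i)" by (simp add: sum.cartesian_product)
    also have "\<dots> = (\<Sum>k<d * N. g (k div N) (k mod N))"
      by (rule sum.reindex_bij_witness[where j = "\<lambda>(j, i). j * N + i" and i = "\<lambda>k. (k div N, k mod N)"])
        (use False in \<open>auto simp: less_mult_imp_div_less mixed_radix_less\<close>)
    finally show ?thesis by simp
  qed simp
  have M'_eq: "M' = fspan S (d * N) b'"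
  proof (intro equalityI subsetI)
    fix x assume "x \<in> M'"
    then obtain m where m: "\<And>j. j < d \<Longrightarrow> m j \<in> M" "x = (\<Sum>j<d. t ^ j * m j)" by (auto simp: M'_def)
    then have "\<forall>j\<in>{..<d}. \<exists>c. (\<forall>i<N. c i \<in> S) \<and> m j = (\<Sum>i<N. c i * b i)" by (auto simp: N fspan_def)
    then obtain c where c: "\<And>j i. j < d \<Longrightarrow> i < N \<Longrightarrow> c j i \<in> S" "\<And>j. j < d \<Longrightarrow> m j = (\<Sum>i<N. c j i * b i)"
      by (auto simp: bchoice_iff)
    have "x = (\<Sum>j<d. \<Sum>i<N. c j i * (t ^ j * b i))"
      unfolding m(2) by (intro sum.cong refl) (simp add: c(2) sum_distrib_left algebra_simps)
    also have "\<dots> = (\<Sum>k<d * N. c (k div N) (k mod N) * b' k)"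
      unfolding b'_def by (rule split[symmetric])
    finally have "x = (\<Sum>k<d * N. c (k div N) (k mod N) * b' k)" .
    moreover have "c (k div N) (k mod N) \<in> S" if "k < d * N" for k
    proof (rule c(1))
      show "k div N < d" using that by (rule less_mult_imp_div_less)
      show "k mod N < N" using that by (cases "N = 0") auto
    qed
    ultimately show "x \<in> fspan S (d * N) b'"
      unfolding fspan_def by (intro CollectI exI[of _ "\<lambda>k. c (k div N) (k mod N)"] conjI allI impI) auto
  next
    fix x assume "x \<in> fspan S (d * N) b'"
    then obtain c where c: "\<And>k. k < d * N \<Longrightarrow> c k \<in> S" "x = (\<Sum>k<d * N. c k * b' k)" by (auto simp: fspan_def)
    have "x = (\<Sum>k<d * N. c (k div N * N + k mod N) * (t ^ (k div N) * b (k mod N)))"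
      by (simp add: c(2) b'_def)
    also have "\<dots> = (\<Sum>j<d. \<Sum>i<N. c (j * N + i) * (t ^ j * b i))" by (rule split)
    also have "\<dots> = (\<Sum>j<d. t ^ j * (\<Sum>i<N. c (j * N + i) * b i))"
      by (simp add: sum_distrib_left algebra_simps)
    finally have "x = (\<Sum>j<d. t ^ j * (\<Sum>i<N. c (j * N + i) * b i))" .
    moreover have "(\<Sum>i<N. c (j * N + i) * b i) \<in> M" if "j < d" for j
      unfolding N fspan_def using c(1) that by (auto intro!: exI[of _ "\<lambda>i. c (j * N + i)"] simp: mixed_radix_less)
    ultimately show "x \<in> M'"
      unfolding M'_def by (intro CollectI exI[of _ "\<lambda>j. \<Sum>i<N. c (j * N + i) * b i"]) auto
  qed
  have addM: "x + y \<in> M" if "x \<in> M" "y \<in> M" for x y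
    using fspan_sum_closed[OF S, of "UNIV :: bool set" "\<lambda>a. if a then x else y" N b] that
    by (simp add: N UNIV_bool add.commute)
  have mulM: "a * x \<in> M" if "a \<in> multiplier M" "x \<in> M" for a x
    using that by (auto simp: multiplier_def)
  have zeroM: "0 \<in> M" using mulM[OF T.zero_closed one] by simp
  have "1 \<in> M'"
    unfolding M'_def using one zeroM
    by (intro CollectI exI[of _ "\<lambda>j. if j = 0 then 1 else 0"])
      (auto simp: d_def if_distrib[of "\<lambda>x. _ * x"] cong: if_cong)
  then have fg: "fg_module S M'"
    unfolding fg_module_def using M'_eq by auto
  have "multiplier M \<subseteq> multiplier M'"
  proof
    fix a assume a: "a \<in> multiplier M"
    have "a * x \<in> M'" if x: "x \<in> M'" for x
    proof -
      obtain m where m: "\<And>j. j < d \<Longrightarrow> m j \<in> M" "x = (\<Sum>j<d. t ^ j * m j)" using x by (auto simp: M'_def)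
      then show ?thesis
        unfolding M'_def using a
        by (intro CollectI exI[of _ "\<lambda>j. a * m j"]) (auto simp: sum_distrib_left algebra_simps intro: mulM)
    qed
    then show "a \<in> multiplier M'" by (simp add: multiplier_def)
  qed
  moreover have "t \<in> multiplier M'"
  proof -
    have "t * x \<in> M'" if x: "x \<in> M'" for x
    proof -
      obtain m where m: "\<And>j. j < d \<Longrightarrow> m j \<in> M" "x = (\<Sum>j<d. t ^ j * m j)" using x by (auto simp: M'_def)
      let ?e = "Polynomial.degree p"
      define l where "l = m ?e"
      have "poly p t = (\<Sum>j\<le>?e. Polynomial.coeff p j * t ^ j)" by (rule poly_altdef)
      also have "\<dots> = (\<Sum>j<?e. Polynomial.coeff p j * t ^ j) + t ^ ?e"
        using p(1) by (simp add: lessThan_Suc_atMost[symmetric])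
      finally have te: "t ^ ?e = - (\<Sum>j<?e. Polynomial.coeff p j * t ^ j)"
        using p(3) by (simp add: eq_neg_iff_add_eq_0 add.commute)
      \<comment> \<open>rewrite the top term \<open>t * t ^ degree p * l\<close> by the equation of \<open>t\<close>\<close>
      define m' where "m' j = (if j = 0 then 0 else m (j - 1) - Polynomial.coeff p (j - 1) * l)" for j
      have "(\<Sum>j<d. t ^ j * m' j) = (\<Sum>j<?e. t ^ Suc j * m' (Suc j))"
        unfolding d_def by (subst sum.lessThan_Suc_shift) (simp add: m'_def)
      also have "\<dots> = (\<Sum>j<?e. t * (t ^ j * m j)) - (\<Sum>j<?e. t * (Polynomial.coeff p j * t ^ j * l))"
        by (simp add: m'_def algebra_simps flip: sum_subtractf)
      also have "(\<Sum>j<?e. t * (Polynomial.coeff p j * t ^ j * l)) = t * (\<Sum>j<?e. Polynomial.coeff p j * t ^ j) * l"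
        by (simp add: sum_distrib_left sum_distrib_right algebra_simps)
      also have "(\<Sum>j<?e. t * (t ^ j * m j)) - \<dots> = t * ((\<Sum>j<?e. t ^ j * m j) + t ^ ?e * l)"
        unfolding te by (simp add: sum_distrib_left algebra_simps)
      also have "\<dots> = t * x" by (simp add: m(2) d_def l_def)
      finally have "t * x = (\<Sum>j<d. t ^ j * m' j)" by simp
      moreover have "m' j \<in> M" if "j < d" for j
      proof -
        have "- Polynomial.coeff p (j - 1) * l \<in> M"
          using m(1)[of ?e] by (intro mulM T.uminus_closed p) (auto simp: l_def d_def)
        with addM[OF m(1)[of "j - 1"] this] show ?thesis
          using that by (auto simp: m'_def zeroM)
      qed
      ultimately show ?thesis by (auto simp: M'_def)
    qed
    then show ?thesis by (simp add: multiplier_def)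
  qed
  ultimately show ?thesis using fg by blast
qed

lemma (in subring_closed) det_closed:
  assumes "A \<in> carrier_mat N N" "\<And>i j. i < N \<Longrightarrow> j < N \<Longrightarrow> A $$ (i, j) \<in> S"
  shows "det A \<in> S"
proof -
  have "signof p \<in> S" for p :: "nat \<Rightarrow> nat"
    by (cases p rule: sign_cases) (auto intro: one_closed uminus_closed)
  then show ?thesis
    unfolding det_def'[OF assms(1)]
    by (intro sum_closed mult_closed prod_closed) (auto intro!: assms(2) simp: permutes_in_image)
qed

lemma (in subring_closed) subring_poly: "subring_closed {q. \<forall>i. Polynomial.coeff q i \<in> S}"
  by unfold_locales
    (auto simp: coeff_mult intro: zero_closed one_closed add_closed uminus_closed
      intro!: sum_closed mult_closed simp flip: one_poly_eq_simps simp: coeff_pCons split: nat.split)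

text \<open>The determinant trick (Cayley--Hamilton for the matrix of multiplication by \<open>t\<close>).\<close>

lemma integral_of_multiplier:
  assumes S: "subring_closed S" and M: "fg_module S M" and t: "t \<in> multiplier M"
  shows "integral_over S t"
proof -
  interpret S: subring_closed S by fact
  obtain N b where N: "M = fspan S N b" and one: "1 \<in> M" using M by (auto simp: fg_module_def)
  have "\<forall>i\<in>{..<N}. \<exists>c. (\<forall>j<N. c j \<in> S) \<and> t * b i = (\<Sum>j<N. c j * b j)"
    using t fspan_base[OF S, of _ N b] by (auto simp: multiplier_def N fspan_def)
  then obtain c where c: "\<And>i j. i < N \<Longrightarrow> j < N \<Longrightarrow> c i j \<in> S" "\<And>i. i < N \<Longrightarrow> t * b i = (\<Sum>j<N. c i j * b j)"
    by (auto simp: bchoice_iff)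
  define A where "A = mat N N (\<lambda>(i, j). c i j)"
  have A: "A \<in> carrier_mat N N" by (simp add: A_def)
  let ?p = "char_poly A"
  interpret SP: subring_closed "{q. \<forall>i. Polynomial.coeff q i \<in> S}" by (rule S.subring_poly)
  have coeffs: "?p \<in> {q. \<forall>i. Polynomial.coeff q i \<in> S}"
    unfolding char_poly_def
    by (rule SP.det_closed[OF char_poly_matrix_closed[OF A]])
      (use c(1) in \<open>auto simp: char_poly_matrix_def A_def coeff_pCons
        intro: S.zero_closed S.one_closed S.add_closed S.uminus_closed split: nat.split\<close>)
  define B where "B = mat N N (\<lambda>(i, j). (if i = j then t else 0) - c i j)"
  have B: "B \<in> carrier_mat N N" by (simp add: B_def)
  have "poly ?p t = det B"
    unfolding char_poly_def
    by (rule poly_det_cong[OF B char_poly_matrix_closed[OF A]]) (auto simp: char_poly_matrix_def A_def B_def)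
  have Bb: "(\<Sum>j<N. B $$ (i, j) * b j) = 0" if "i < N" for i
    using that c(2)[OF that] by (simp add: B_def left_diff_distrib sum_subtractf if_distrib[of "\<lambda>x. x * _"] cong: if_cong)
  have detb: "det B * b k = 0" if k: "k < N" for k
  proof -
    note adj = adj_mat[OF B]
    have "(\<Sum>i<N. adj_mat B $$ (k, i) * (\<Sum>j<N. B $$ (i, j) * b j)) = 0" using Bb by simp
    also have "(\<Sum>i<N. adj_mat B $$ (k, i) * (\<Sum>j<N. B $$ (i, j) * b j))
        = (\<Sum>j<N. (\<Sum>i<N. adj_mat B $$ (k, i) * B $$ (i, j)) * b j)"
      by (simp add: sum_distrib_left sum_distrib_right mult.assoc) (rule sum.swap)
    also have "\<dots> = (\<Sum>j<N. (adj_mat B * B) $$ (k, j) * b j)"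
      using adj(1) B k by (intro sum.cong refl) (simp add: scalar_prod_def lessThan_atLeast0)
    also have "\<dots> = (\<Sum>j<N. (if k = j then det B else 0) * b j)"
      using k by (intro sum.cong refl) (simp add: adj(3))
    also have "\<dots> = det B * b k"
      using k by (simp add: if_distrib[of "\<lambda>x. x * _"] cong: if_cong)
    finally show ?thesis by simp
  qed
  \<comment> \<open>\<open>det B\<close> kills every generator, hence also \<open>1\<close>, which
    belongs to the module.\<close>
  obtain e where "1 = (\<Sum>i<N. e i * b i)" using one by (auto simp: N fspan_def)
  then have "det B = det B * (\<Sum>i<N. e i * b i)" by simp
  also have "\<dots> = (\<Sum>i<N. e i * (det B * b i))"
    by (simp add: sum_distrib_left algebra_simps)
  finally have "det B = (\<Sum>i<N. e i * (det B * b i))" .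
  then have "poly ?p t = 0" using detb \<open>poly ?p t = det B\<close> by simp
  moreover have "Polynomial.lead_coeff ?p = 1" using degree_monic_char_poly[OF A] by simp
  ultimately show ?thesis using coeffs by (auto simp: integral_over_def)
qed

section \<open>Noether normalisation\<close>

text \<open>Sort by the exponent of the last variable. For fixed other coordinates the resulting
  polynomial has degree at most \<open>d\<close> and \<open>d + 1\<close> roots, so its
  coefficients, polynomials in fewer variables, vanish on the smaller grid. The index set of the
  terms is abstract, since the exponent vectors to which this is applied have one more entry than
  there are variables.\<close>

lemma grid_nonzero:
  fixes c :: "'m \<Rightarrow> complex" and e :: "'m \<Rightarrow> nat \<Rightarrow> nat"
  assumes "finite M" "\<And>m i. m \<in> M \<Longrightarrow> i < n \<Longrightarrow> e m i \<le> d"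
    and "\<And>m m'. m \<in> M \<Longrightarrow> m' \<in> M \<Longrightarrow> (\<And>i. i < n \<Longrightarrow> e m i = e m' i) \<Longrightarrow> m = m'"
    and "\<And>a. (\<And>i. a i \<le> d) \<Longrightarrow> (\<Sum>m\<in>M. c m * (\<Prod>i<n. of_nat (a i) ^ e m i)) = 0"
  shows "\<forall>m\<in>M. c m = 0"
  using assms
proof (induction n arbitrary: M)
  case 0
  show ?case
  proof
    fix m assume m: "m \<in> M"
    then have "M = {m}" using "0.prems"(3) by blast
    then show "c m = 0" using "0.prems"(4)[of "\<lambda>_. 0"] by simp
  qed
next
  case (Suc n)
  define Mj where "Mj j = {m\<in>M. e m n = j}" for j
  have "\<forall>m\<in>Mj j. c m = 0" for j
  proof (rule Suc.IH)
    show "finite (Mj j)" using Suc.prems(1) by (simp add: Mj_def)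
    show "e m i \<le> d" if "m \<in> Mj j" "i < n" for m i
      using Suc.prems(2)[of m i] that by (simp add: Mj_def)
    show "m = m'" if "m \<in> Mj j" "m' \<in> Mj j" "\<And>i. i < n \<Longrightarrow> e m i = e m' i" for m m'
    proof (rule Suc.prems(3))
      show "e m i = e m' i" if "i < Suc n" for i
        using that \<open>m \<in> Mj j\<close> \<open>m' \<in> Mj j\<close> \<open>\<And>i. i < n \<Longrightarrow> e m i = e m' i\<close> by (cases "i = n") (auto simp: Mj_def)
    qed (use that in \<open>auto simp: Mj_def\<close>)
    fix a :: "nat \<Rightarrow> nat" assume a: "\<And>i. a i \<le> d"
    define S where "S j = (\<Sum>m\<in>Mj j. c m * (\<Prod>i<n. of_nat (a i) ^ e m i))" for j
    define p where "p = (\<Sum>j\<le>d. Polynomial.monom (S j) j)"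
    have root: "poly p (of_nat x) = 0" if x: "x \<le> d" for x
    proof -
      have "0 = (\<Sum>m\<in>M. c m * (\<Prod>i<Suc n. of_nat ((a(n := x)) i) ^ e m i))"
        using Suc.prems(4)[of "a(n := x)"] a x by simp
      also have "\<dots> = (\<Sum>m\<in>M. c m * (\<Prod>i<n. of_nat (a i) ^ e m i) * of_nat x ^ e m n)"
        by (intro sum.cong refl) (simp add: mult.assoc)
      also have "\<dots> = (\<Sum>j\<le>d. \<Sum>m\<in>Mj j. c m * (\<Prod>i<n. of_nat (a i) ^ e m i) * of_nat x ^ e m n)"
        unfolding Mj_def by (rule sum.group[symmetric]) (use Suc.prems(1,2) in auto)
      also have "\<dots> = (\<Sum>j\<le>d. S j * of_nat x ^ j)"
        unfolding S_def sum_distrib_right by (intro sum.cong refl) (simp add: Mj_def)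
      also have "\<dots> = poly p (of_nat x)"
        by (simp add: p_def poly_sum poly_monom)
      finally show ?thesis by simp
    qed
    have "p = 0"
    proof (rule ccontr)
      assume "p \<noteq> 0"
      have "Polynomial.degree p \<le> d"
        unfolding p_def by (intro degree_sum_le) (auto intro: order_trans[OF degree_monom_le])
      moreover have "card (of_nat ` {..d} :: complex set) \<le> card {x. poly p x = 0}"
        by (rule card_mono) (use root \<open>p \<noteq> 0\<close> poly_roots_finite in auto)
      moreover have "card {x. poly p x = 0} \<le> Polynomial.degree p"
        using \<open>p \<noteq> 0\<close> by (rule poly_roots_degree)
      ultimately show False by (simp add: card_image inj_on_def)
    qed
    moreover have "Polynomial.coeff p j = S j" if "j \<le> d"
      using that by (simp add: p_def coeff_sum if_distrib cong: if_cong)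
    moreover have "S j = 0" if "\<not> j \<le> d"
    proof -
      have "Mj j = {}" using Suc.prems(2)[of _ n] that by (force simp: Mj_def)
      then show ?thesis by (simp add: S_def)
    qed
    ultimately show "(\<Sum>m\<in>Mj j. c m * (\<Prod>i<n. of_nat (a i) ^ e m i)) = 0"
      by (cases "j \<le> d") (auto simp: S_def)
  qed
  then show ?case by (auto simp: Mj_def)
qed

text \<open>From here on \<open>'a mpoly poly\<close> is the ring of polynomials in the \<open>V i\<close> and a further variable \<open>z\<close>.\<close>

abbreviation TConst :: "'a::comm_ring_1 \<Rightarrow> 'a mpoly poly" where
  "TConst c \<equiv> [:Const c:]"

lemma TConst_hom: "comm_ring_hom (TConst :: 'a::comm_ring_1 \<Rightarrow> _)"
proof -
  interpret C: comm_ring_hom "Const :: 'a \<Rightarrow> 'a mpoly" by (rule Const_hom)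
  show ?thesis by unfold_locales (auto simp: C.hom_add C.hom_mult one_pCons)
qed

text \<open>The total degree in the \<open>V i\<close> and \<open>z\<close> together, with
  \<open>z\<close> of weight one.\<close>

definition tbdeg :: "nat set \<Rightarrow> nat \<Rightarrow> 'a::zero mpoly poly set" where
  "tbdeg I L = {t. \<forall>j. \<forall>m\<in>keys (Polynomial.coeff t j). keys m \<subseteq> I \<and> j + mdeg m \<le> L}"

lemma tbdeg_mono: "t \<in> tbdeg I L \<Longrightarrow> L \<le> L' \<Longrightarrow> t \<in> tbdeg I L'"
  by (fastforce simp: tbdeg_def)

lemma tbdeg_0 [simp]: "0 \<in> tbdeg I L"
  by (simp add: tbdeg_def)

lemma tbdeg_add: "s \<in> tbdeg I L \<Longrightarrow> t \<in> tbdeg I L \<Longrightarrow> s + t \<in> tbdeg I L"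
  for s t :: "'a::comm_ring_1 mpoly poly"
proof -
  assume st: "s \<in> tbdeg I L" "t \<in> tbdeg I L"
  have "keys (Polynomial.coeff (s + t) j) \<subseteq> keys (Polynomial.coeff s j) \<union> keys (Polynomial.coeff t j)" for j
    by (simp add: Poly_Mapping.keys_add)
  with st show ?thesis by (fastforce simp: tbdeg_def)
qed

lemma tbdeg_uminus: "s \<in> tbdeg I L \<Longrightarrow> - s \<in> tbdeg I L"
  for s :: "'a::comm_ring_1 mpoly poly"
  by (auto simp: tbdeg_def in_keys_iff)

lemma tbdeg_mult:
  fixes s t :: "'a::comm_ring_1 mpoly poly"
  assumes "s \<in> tbdeg I K" "t \<in> tbdeg I L"
  shows "s * t \<in> tbdeg I (K + L)"
  unfolding tbdeg_def
proof (intro CollectI allI ballI)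
  fix j m assume "m \<in> keys (Polynomial.coeff (s * t) j)"
  then obtain i where i: "i \<le> j" "m \<in> keys (Polynomial.coeff s i * Polynomial.coeff t (j - i))"
    using keys_sum[of "\<lambda>i. Polynomial.coeff s i * Polynomial.coeff t (j - i)" "{..j}"]
    by (auto simp: coeff_mult)
  then obtain a b where ab: "m = a + b" "a \<in> keys (Polynomial.coeff s i)" "b \<in> keys (Polynomial.coeff t (j - i))"
    using keys_mult by blast
  with assms have "keys a \<subseteq> I" "i + mdeg a \<le> K" "keys b \<subseteq> I" "j - i + mdeg b \<le> L"
    by (auto simp: tbdeg_def)
  then show "keys m \<subseteq> I \<and> j + mdeg m \<le> K + L"
    using i by (auto simp: ab keys_add_nat mdeg_add)
qed

lemma tbdeg_const: "P \<in> bdeg I L \<Longrightarrow> [:P:] \<in> tbdeg I L"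
  by (auto simp: tbdeg_def bdeg_def coeff_pCons split: nat.split)

lemma tbdeg_1 [simp]: "1 \<in> tbdeg I L"
  by (simp add: one_pCons tbdeg_const)

lemma tbdeg_power:
  fixes t :: "'a::comm_ring_1 mpoly poly"
  shows "t \<in> tbdeg I L \<Longrightarrow> t ^ k \<in> tbdeg I (k * L)"
  by (induction k) (auto intro: tbdeg_mult simp: add.commute)

lemma tbdeg_prod:
  fixes f :: "'b \<Rightarrow> 'a::comm_ring_1 mpoly poly"
  shows "(\<And>a. a \<in> A \<Longrightarrow> f a \<in> tbdeg I (d a)) \<Longrightarrow> prod f A \<in> tbdeg I (sum d A)"
  by (induction A rule: infinite_finite_induct) (auto intro: tbdeg_mult)

lemma tbdeg_sum: "(\<And>a. a \<in> A \<Longrightarrow> f a \<in> tbdeg I L) \<Longrightarrow> sum f A \<in> tbdeg I L"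
  for f :: "'b \<Rightarrow> 'a::comm_ring_1 mpoly poly"
  by (induction A rule: infinite_finite_induct) (auto intro: tbdeg_add)

text \<open>A formal leading coefficient: \<open>c\<close> may be zero, so the notion is
  multiplicative without any cancellation property.\<close>

definition top_coeff :: "'a::comm_ring_1 poly \<Rightarrow> nat \<Rightarrow> 'a \<Rightarrow> bool" where
  "top_coeff p d c \<longleftrightarrow> Polynomial.degree p \<le> d \<and> Polynomial.coeff p d = c"

lemma top_coeff_mult: "top_coeff p d c \<Longrightarrow> top_coeff q e b \<Longrightarrow> top_coeff (p * q) (d + e) (c * b)"
proof -
  assume pq: "top_coeff p d c" "top_coeff q e b"
  have deg: "Polynomial.degree (p * q) \<le> d + e"
    using pq degree_mult_le[of p q] by (auto simp: top_coeff_def)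
  have "Polynomial.coeff (p * q) (d + e) = (\<Sum>i\<le>d + e. Polynomial.coeff p i * Polynomial.coeff q (d + e - i))"
    by (rule coeff_mult)
  also have "\<dots> = (\<Sum>i\<in>{d}. Polynomial.coeff p i * Polynomial.coeff q (d + e - i))"
  proof (rule sum.mono_neutral_right)
    show "\<forall>i\<in>{..d + e} - {d}. Polynomial.coeff p i * Polynomial.coeff q (d + e - i) = 0"
    proof
      fix i assume "i \<in> {..d + e} - {d}"
      then have "i > d \<or> d + e - i > e" by auto
      then show "Polynomial.coeff p i * Polynomial.coeff q (d + e - i) = 0"
        using pq Polynomial.coeff_eq_0[of p i] Polynomial.coeff_eq_0[of q "d + e - i"] by (auto simp: top_coeff_def)
    qed
  qed auto
  finally show ?thesis using deg pq by (simp add: top_coeff_def)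
qed

lemma top_coeff_power: "top_coeff p d c \<Longrightarrow> top_coeff (p ^ k) (k * d) (c ^ k)"
proof (induction k)
  case 0
  then show ?case by (simp add: top_coeff_def)
next
  case (Suc k)
  then show ?case using top_coeff_mult[of p d c "p ^ k"] by simp
qed

lemma top_coeff_prod:
  "(\<And>a. a \<in> A \<Longrightarrow> top_coeff (f a) (d a) (c a)) \<Longrightarrow> top_coeff (prod f A) (sum d A) (prod c A)"
proof (induction A rule: infinite_finite_induct)
  case (insert x A)
  then show ?case using top_coeff_mult[of "f x" "d x" "c x"] by simp
qed (auto simp: top_coeff_def)

text \<open>
  Noether normalisation: in a polynomial ring in \<open>n + 1\<close> variables the \<open>n + 2\<close> elements \<open>W 0, \<dots>, W n, u\<close>
  satisfy an algebraic relation by a dimension count; after a generic shift \<open>W i - a i * u\<close>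
  this relation becomes monic in \<open>u\<close>. The constant below bounds the degree of the relation, hence the
  size of a grid on which its top form has a nonzero value.
\<close>

definition noether_bound :: "nat \<Rightarrow> nat \<Rightarrow> nat" where
  "noether_bound n E = (n + 2) * (((n + 3) * E) ^ (n + 1) + 1)"

lemma noether_step:
  fixes W :: "nat \<Rightarrow> complex mpoly poly"
  assumes W: "\<And>i. i \<le> n \<Longrightarrow> W i \<in> tbdeg {1..n} E" and u: "u \<in> tbdeg {1..n} E" and E: "E \<ge> 1"
  shows "\<exists>a :: nat \<Rightarrow> nat. (\<forall>i. a i \<le> noether_bound n E) \<and>
    (\<forall>S. subring_closed S \<longrightarrow> range TConst \<subseteq> S \<longrightarrow> (\<forall>i\<le>n. W i - of_nat (a i) * u \<in> S) \<longrightarrow> integral_over S u)"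
proof -
  interpret C: comm_ring_hom "TConst :: complex \<Rightarrow> _" by (rule TConst_hom)
  \<comment> \<open>There are \<open>\<mu> ^ (n + 2)\<close> products and at most
    \<open>(L + 1) ^ (n + 1)\<close> coefficients, where \<open>L + 1\<close> is at most
    \<open>(n + 3) * E * \<mu>\<close>. This choice makes the products outnumber the
    coefficients.\<close>
  define \<mu> where "\<mu> = ((n + 3) * E) ^ (n + 1) + 1"
  define L where "L = (n + 2) * \<mu> * E"
  define I where "I = PiE {..n + 1} (\<lambda>_. {..<\<mu>})"
  define pw where "pw \<alpha> = (\<Prod>i\<le>n. W i ^ \<alpha> i) * u ^ \<alpha> (n + 1)" for \<alpha> :: "nat \<Rightarrow> nat"
  define J where "J = {..L} \<times> {m. keys m \<subseteq> {1..n} \<and> mdeg m \<le> L}"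
  have finI: "finite I" unfolding I_def by (intro finite_PiE) auto
  have cardI: "card I = \<mu> ^ (n + 2)" by (simp add: I_def card_PiE)
  have finJ: "finite J" unfolding J_def by (auto intro: finite_monomials)
  have \<mu>: "\<mu> \<ge> 1" by (simp add: \<mu>_def)
  have "card J \<le> (L + 1) ^ (n + 1)"
    unfolding J_def card_cartesian_product using mult_le_mono2[OF card_monomials[of "{1..n}" L], of "L + 1"] by simp
  also have "L + 1 \<le> (n + 3) * E * \<mu>"
    using \<mu> E by (simp add: L_def algebra_simps)
  then have "(L + 1) ^ (n + 1) \<le> ((n + 3) * E * \<mu>) ^ (n + 1)" by (rule power_mono) simp
  also have "\<dots> = ((n + 3) * E) ^ (n + 1) * \<mu> ^ (n + 1)" by (simp only: power_mult_distrib)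
  also have "\<dots> < \<mu> * \<mu> ^ (n + 1)"
    using \<mu> by (intro mult_strict_right_mono) (auto simp: \<mu>_def)
  also have "\<dots> = card I" by (simp add: cardI)
  finally have card: "card J < card I" .
  obtain l where l: "\<exists>\<alpha>\<in>I. l \<alpha> \<noteq> 0"
    "\<And>j. j \<in> J \<Longrightarrow> (\<Sum>\<alpha>\<in>I. l \<alpha> * lookup (Polynomial.coeff (pw \<alpha>) (fst j)) (snd j)) = 0"
    using ex_linear_relation[OF finJ finI card, of "\<lambda>\<alpha> j. lookup (Polynomial.coeff (pw \<alpha>) (fst j)) (snd j)"] by auto
  define sz where "sz \<alpha> = (\<Sum>i\<le>n. \<alpha> i) + \<alpha> (n + 1)" for \<alpha> :: "nat \<Rightarrow> nat"
  have szb: "sz \<alpha> \<le> (n + 2) * \<mu>" if "\<alpha> \<in> I" for \<alpha>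
  proof -
    have "\<alpha> i \<le> \<mu>" if "i \<le> n + 1" for i
      using \<open>\<alpha> \<in> I\<close> that by (fastforce simp: I_def PiE_def Pi_def)
    then have "(\<Sum>i\<le>n. \<alpha> i) + \<alpha> (n + 1) \<le> (\<Sum>i\<le>n. \<mu>) + \<mu>"
      by (intro add_mono sum_mono) auto
    then show ?thesis by (simp add: sz_def)
  qed
  have pw: "pw \<alpha> \<in> tbdeg {1..n} L" if \<alpha>: "\<alpha> \<in> I" for \<alpha>
  proof -
    have "pw \<alpha> \<in> tbdeg {1..n} ((\<Sum>i\<le>n. \<alpha> i * E) + \<alpha> (n + 1) * E)"
      unfolding pw_def by (intro tbdeg_mult tbdeg_prod tbdeg_power) (use W u in auto)
    moreover have "(\<Sum>i\<le>n. \<alpha> i * E) + \<alpha> (n + 1) * E = sz \<alpha> * E"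
      by (simp add: sz_def sum_distrib_right distrib_right)
    moreover have "sz \<alpha> * E \<le> L" using szb[OF \<alpha>] by (simp add: L_def)
    ultimately show ?thesis by (auto intro: tbdeg_mono)
  qed
  have lk: "lookup (Const a * P) m = a * lookup P m" for a :: complex and P m
    by (simp add: Poly_Mapping.map.rep_eq when_def flip: mult_map_scale_conv_mult)
  have rel: "(\<Sum>\<alpha>\<in>I. TConst (l \<alpha>) * pw \<alpha>) = 0"
  proof (rule poly_eqI, rule poly_mapping_eqI)
    fix j m
    have "lookup (Polynomial.coeff (\<Sum>\<alpha>\<in>I. TConst (l \<alpha>) * pw \<alpha>) j) m
        = (\<Sum>\<alpha>\<in>I. l \<alpha> * lookup (Polynomial.coeff (pw \<alpha>) j) m)"
      by (simp add: coeff_sum lookup_sum lk)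
    also have "\<dots> = 0"
    proof (cases "(j, m) \<in> J")
      case True
      then show ?thesis using l(2)[of "(j, m)"] by simp
    next
      case False
      have "lookup (Polynomial.coeff (pw \<alpha>) j) m = 0" if "\<alpha> \<in> I" for \<alpha>
      proof -
        have "m \<notin> keys (Polynomial.coeff (pw \<alpha>) j)"
          using pw[OF that] False unfolding J_def tbdeg_def by fastforce
        then show ?thesis by (simp only: in_keys_iff not_not)
      qed
      then show ?thesis by simp
    qed
    finally show "lookup (Polynomial.coeff (\<Sum>\<alpha>\<in>I. TConst (l \<alpha>) * pw \<alpha>) j) m = lookup (Polynomial.coeff 0 j) m"
      by simp
  qed
  define I' where "I' = {\<alpha>\<in>I. l \<alpha> \<noteq> 0}"
  have I': "finite I'" "I' \<noteq> {}" using finI l(1) by (auto simp: I'_def)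
  define d where "d = Max (sz ` I')"
  have d: "sz \<alpha> \<le> d" if "\<alpha> \<in> I'" for \<alpha> using that I' by (simp add: d_def)
  have dK: "d \<le> noether_bound n E"
    using I' szb by (auto simp: d_def I'_def noether_bound_def \<mu>_def)
  define Id where "Id = {\<alpha>\<in>I'. sz \<alpha> = d}"
  have "d \<in> sz ` I'" unfolding d_def using I' by (intro Max_in) auto
  then have "Id \<noteq> {}" by (auto simp: Id_def)
  have "\<exists>a. (\<forall>i. a i \<le> d) \<and> (\<Sum>\<alpha>\<in>Id. l \<alpha> * (\<Prod>i<Suc n. of_nat (a i) ^ \<alpha> i)) \<noteq> 0"
  proof (rule ccontr)
    assume no: "\<not> ?thesis"
    have "\<forall>\<alpha>\<in>Id. l \<alpha> = 0"
    proof (rule grid_nonzero[where e = "\<lambda>\<alpha> i. \<alpha> i" and d = d and n = "Suc n"])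
      show "finite Id" using I' by (simp add: Id_def)
      show "\<alpha> i \<le> d" if "\<alpha> \<in> Id" "i < Suc n" for \<alpha> i
        using that member_le_sum[of i "{..n}" \<alpha>] by (auto simp: Id_def sz_def)
      \<comment> \<open>All exponent vectors in \<open>Id\<close> have the same sum, so the last
        entry is determined by the others.\<close>
      show "\<alpha> = \<beta>" if "\<alpha> \<in> Id" "\<beta> \<in> Id" and eq: "\<And>i. i < Suc n \<Longrightarrow> \<alpha> i = \<beta> i" for \<alpha> \<beta>
      proof -
        have "(\<Sum>i\<le>n. \<alpha> i) = (\<Sum>i\<le>n. \<beta> i)" using eq by (intro sum.cong) auto
        then have "\<alpha> (n + 1) = \<beta> (n + 1)" using that(1,2) by (simp add: Id_def sz_def)
        moreover have "\<alpha> \<in> I" "\<beta> \<in> I" using that by (auto simp: Id_def I'_def)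
        ultimately show ?thesis using eq unfolding I_def
          by (intro PiE_ext[of \<alpha> "{..n + 1}" _ \<beta>]) (auto simp: le_Suc_eq less_Suc_eq_le)
      qed
    qed (use no in auto)
    then show False using \<open>Id \<noteq> {}\<close> by (auto simp: Id_def I'_def)
  qed
  then obtain a where a: "\<And>i. a i \<le> d" "(\<Sum>\<alpha>\<in>Id. l \<alpha> * (\<Prod>i<Suc n. of_nat (a i) ^ \<alpha> i)) \<noteq> 0" by auto
  \<comment> \<open>The top-degree form of the relation at the point \<open>(a, 1)\<close>; the
    exponent of \<open>u\<close> contributes a factor \<open>1\<close> and is therefore
    absent.\<close>
  define h where "h = (\<Sum>\<alpha>\<in>Id. l \<alpha> * (\<Prod>i\<le>n. of_nat (a i) ^ \<alpha> i))"
  have h: "h \<noteq> 0" using a(2) by (simp add: h_def lessThan_Suc_atMost)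
  have "integral_over S u" if S: "subring_closed S" "range TConst \<subseteq> S" "\<And>i. i \<le> n \<Longrightarrow> W i - of_nat (a i) * u \<in> S" for S
  proof -
    interpret S: subring_closed S by fact
    interpret SP: subring_closed "{q. \<forall>i. Polynomial.coeff q i \<in> S}" by (rule S.subring_poly)
    \<comment> \<open>Write \<open>W i\<close> as \<open>(W i - a i * u) + a i * u\<close> and
      replace every explicit \<open>u\<close> by an indeterminate: each product becomes a polynomial
      over \<open>S\<close> of formal degree \<open>sz \<alpha>\<close>. Division by
      \<open>h\<close> then makes the relation monic.\<close>
    define t where "t \<alpha> = (\<Prod>i\<le>n. [:W i - of_nat (a i) * u, of_nat (a i):] ^ \<alpha> i) * [:0, 1:] ^ \<alpha> (n + 1)" for \<alpha> :: "nat \<Rightarrow> nat"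
    define R where "R = (\<Sum>\<alpha>\<in>I'. [:TConst (l \<alpha> / h):] * t \<alpha>)"
    have natS: "of_nat k \<in> S" for k
      by (induction k) (auto intro: S.zero_closed S.one_closed S.add_closed)
    have cS: "TConst c \<in> S" for c using S(2) by auto
    have t_top: "top_coeff (t \<alpha>) (sz \<alpha>) (TConst (\<Prod>i\<le>n. (of_nat (a i) :: complex) ^ \<alpha> i))" for \<alpha>
    proof -
      have "top_coeff [:W i - of_nat (a i) * u, of_nat (a i):] 1 (of_nat (a i))" for i
        by (simp add: top_coeff_def)
      then have "top_coeff (\<Prod>i\<le>n. [:W i - of_nat (a i) * u, of_nat (a i):] ^ \<alpha> i) (\<Sum>i\<le>n. \<alpha> i * 1) (\<Prod>i\<le>n. of_nat (a i) ^ \<alpha> i)"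
        by (intro top_coeff_prod top_coeff_power)
      then have "top_coeff (\<Prod>i\<le>n. [:W i - of_nat (a i) * u, of_nat (a i):] ^ \<alpha> i) (\<Sum>i\<le>n. \<alpha> i) (\<Prod>i\<le>n. of_nat (a i) ^ \<alpha> i)"
        by simp
      moreover have "top_coeff [:0, 1 :: complex mpoly poly:] 1 1" by (simp add: top_coeff_def)
      from top_coeff_power[OF this, of "\<alpha> (n + 1)"]
      have "top_coeff ([:0, 1 :: complex mpoly poly:] ^ \<alpha> (n + 1)) (\<alpha> (n + 1)) 1" by simp
      ultimately have "top_coeff (t \<alpha>) (sz \<alpha>) ((\<Prod>i\<le>n. of_nat (a i) ^ \<alpha> i) * 1)"
        unfolding t_def sz_def by (rule top_coeff_mult)
      moreover have "TConst (\<Prod>i\<le>n. (of_nat (a i) :: complex) ^ \<alpha> i) = (\<Prod>i\<le>n. of_nat (a i) ^ \<alpha> i)"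
      proof -
        have nat: "TConst (of_nat c ^ e) = (of_nat c ^ e :: complex mpoly poly)" for c e
          using C.hom_power[of "of_nat c" e] C.hom_of_nat[of c] by argo
        show ?thesis using C.hom_prod[of "\<lambda>i. of_nat (a i) ^ \<alpha> i" "{..n}"] unfolding nat .
      qed
      ultimately show ?thesis by simp
    qed
    have degR: "Polynomial.degree R \<le> d"
      unfolding R_def using t_top d
      by (intro degree_sum_le I') (auto simp: top_coeff_def intro!: order_trans[OF degree_smult_le] intro: order_trans)
    have "Polynomial.coeff R d = (\<Sum>\<alpha>\<in>I'. TConst (l \<alpha> / h) * Polynomial.coeff (t \<alpha>) d)"
      by (simp add: R_def coeff_sum)
    also have "\<dots> = (\<Sum>\<alpha>\<in>Id. TConst (l \<alpha> / h) * Polynomial.coeff (t \<alpha>) d)"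
    proof (rule sum.mono_neutral_right)
      show "\<forall>\<alpha>\<in>I' - Id. TConst (l \<alpha> / h) * Polynomial.coeff (t \<alpha>) d = 0"
      proof
        fix \<alpha> assume "\<alpha> \<in> I' - Id"
        then have "sz \<alpha> < d" using d by (force simp: Id_def)
        then have "Polynomial.degree (t \<alpha>) < d" using t_top[of \<alpha>] by (auto simp: top_coeff_def)
        then show "TConst (l \<alpha> / h) * Polynomial.coeff (t \<alpha>) d = 0" by (simp only: coeff_eq_0 mult_zero_right)
      qed
    qed (use I' in \<open>auto simp: Id_def\<close>)
    also have "\<dots> = (\<Sum>\<alpha>\<in>Id. TConst (l \<alpha> / h) * TConst (\<Prod>i\<le>n. of_nat (a i) ^ \<alpha> i))"
      by (intro sum.cong refl) (use t_top in \<open>auto simp: top_coeff_def Id_def\<close>)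
    also have "\<dots> = TConst (\<Sum>\<alpha>\<in>Id. l \<alpha> / h * (\<Prod>i\<le>n. of_nat (a i) ^ \<alpha> i))"
      by (simp only: C.hom_sum C.hom_mult)
    also have "(\<Sum>\<alpha>\<in>Id. l \<alpha> / h * (\<Prod>i\<le>n. of_nat (a i) ^ \<alpha> i)) = 1"
      using h by (simp add: h_def flip: sum_divide_distrib)
    finally have topR: "Polynomial.coeff R d = 1" by simp
    then have "Polynomial.degree R = d" using degR le_degree[of R d] by simp
    with topR have lead: "Polynomial.lead_coeff R = 1" by simp
    have "R \<in> {q. \<forall>i. Polynomial.coeff q i \<in> S}"
      unfolding R_def t_def
    proof (intro SP.sum_closed SP.mult_closed SP.prod_closed SP.power_closed)
      show "[:TConst (l x / h):] \<in> {q. \<forall>i. Polynomial.coeff q i \<in> S}" for x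
        using cS S.zero_closed by (auto simp: coeff_pCons split: nat.split)
      show "[:W i - of_nat (a i) * u, of_nat (a i):] \<in> {q. \<forall>i. Polynomial.coeff q i \<in> S}" if "i \<in> {..n}" for i
        using S(3)[of i] natS S.zero_closed that by (auto simp: coeff_pCons split: nat.split)
      show "[:0, 1:] \<in> {q. \<forall>i. Polynomial.coeff q i \<in> S}"
        using S.zero_closed S.one_closed by (auto simp: coeff_pCons split: nat.split)
    qed
    moreover have "poly R u = 0"
    proof -
      have "poly (t \<alpha>) u = pw \<alpha>" for \<alpha>
        by (simp add: t_def pw_def poly_prod algebra_simps)
      then have "poly R u = (\<Sum>\<alpha>\<in>I'. TConst (1 / h) * (TConst (l \<alpha>) * pw \<alpha>))"
        by (simp add: R_def poly_sum mult_single)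
      also have "\<dots> = TConst (1 / h) * (\<Sum>\<alpha>\<in>I'. TConst (l \<alpha>) * pw \<alpha>)" by (simp only: sum_distrib_left)
      also have "(\<Sum>\<alpha>\<in>I'. TConst (l \<alpha>) * pw \<alpha>) = (\<Sum>\<alpha>\<in>I. TConst (l \<alpha>) * pw \<alpha>)"
        by (rule sum.mono_neutral_left) (use finI in \<open>auto simp: I'_def\<close>)
      finally show ?thesis using rel by simp
    qed
    ultimately show ?thesis unfolding integral_over_def using lead by blast
  qed
  then show ?thesis using a(1) dK by (intro exI[of _ a]) (auto intro: order_trans)
qed

text \<open>Phrased by modules over a fixed base ring \<open>S\<close>, so that successive integral
  extensions compose: the module grows at each step, and its multipliers act as the current
  extension.\<close>

definition noether_shift ::
  "nat \<Rightarrow> (nat \<Rightarrow> 'a::comm_ring_1 mpoly poly) \<Rightarrow> nat \<Rightarrow> (nat \<Rightarrow> 'a mpoly poly) \<Rightarrow> (nat \<Rightarrow> nat \<Rightarrow> nat) \<Rightarrow> bool" where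
  "noether_shift n W k u a \<longleftrightarrow>
    (\<forall>S M. subring_closed S \<longrightarrow> fg_module S M \<longrightarrow> range TConst \<subseteq> multiplier M \<longrightarrow>
       (\<forall>i\<le>n. W i - (\<Sum>s<k. of_nat (a s i) * u s) \<in> multiplier M) \<longrightarrow>
       (\<exists>M'. fg_module S M' \<and> multiplier M \<subseteq> multiplier M' \<and> (\<forall>s<k. u s \<in> multiplier M') \<and>
          (\<forall>i\<le>n. W i \<in> multiplier M')))"

lemma noether_shiftD:
  assumes "noether_shift n W k u a" "subring_closed S" "fg_module S M" "range TConst \<subseteq> multiplier M"
    "\<And>i. i \<le> n \<Longrightarrow> W i - (\<Sum>s<k. of_nat (a s i) * u s) \<in> multiplier M"
  shows "\<exists>M'. fg_module S M' \<and> multiplier M \<subseteq> multiplier M' \<and> (\<forall>s<k. u s \<in> multiplier M') \<and>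
          (\<forall>i\<le>n. W i \<in> multiplier M')"
  using assms unfolding noether_shift_def by blast

text \<open>The \<open>u s\<close> are absorbed one by one. Subtracting integer multiples of them
  from the \<open>W i\<close> does not raise the degree bound \<open>E\<close>, so the same
  \<open>noether_bound\<close> serves at every step.\<close>

lemma noether_chain:
  fixes W :: "nat \<Rightarrow> complex mpoly poly" and u :: "nat \<Rightarrow> complex mpoly poly"
  assumes W: "\<And>i. i \<le> n \<Longrightarrow> W i \<in> tbdeg {1..n} E" and u: "\<And>s. s < k \<Longrightarrow> u s \<in> tbdeg {1..n} E" and E: "E \<ge> 1"
  shows "\<exists>a :: nat \<Rightarrow> nat \<Rightarrow> nat. (\<forall>s i. a s i \<le> noether_bound n E) \<and>
    noether_shift n W k u a"
  using u
proof (induction k)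
  case 0
  show ?case by (intro exI[of _ "\<lambda>_ _. 0"]) (auto simp: noether_shift_def)
next
  case (Suc k)
  have "\<exists>a. (\<forall>s i. a s i \<le> noether_bound n E) \<and> noether_shift n W k u a"
    by (rule Suc.IH) (use Suc.prems in auto)
  then obtain a where a: "\<And>s i. a s i \<le> noether_bound n E" "noether_shift n W k u a" by blast
  define W' where "W' i = W i - (\<Sum>s<k. of_nat (a s i) * u s)" for i
  have nat: "(of_nat c :: complex mpoly poly) \<in> tbdeg {1..n} 0" for c
    by (induction c) (auto intro!: tbdeg_add simp del: One_nat_def)
  have W': "W' i \<in> tbdeg {1..n} E" if "i \<le> n" for i
  proof -
    have "(\<Sum>s<k. of_nat (a s i) * u s) \<in> tbdeg {1..n} (0 + E)"
      by (intro tbdeg_sum tbdeg_mult nat Suc.prems) auto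
    from tbdeg_add[OF W[OF that] tbdeg_uminus[OF this[unfolded add_0]]] show ?thesis by (simp add: W'_def)
  qed
  have "\<exists>b. (\<forall>i. b i \<le> noether_bound n E) \<and>
    (\<forall>S. subring_closed S \<longrightarrow> range TConst \<subseteq> S \<longrightarrow> (\<forall>i\<le>n. W' i - of_nat (b i) * u k \<in> S) \<longrightarrow> integral_over S (u k))"
    by (rule noether_step) (use W' Suc.prems E in auto)
  then obtain b where b: "\<And>i. b i \<le> noether_bound n E"
    "\<And>S. subring_closed S \<Longrightarrow> range TConst \<subseteq> S \<Longrightarrow> (\<And>i. i \<le> n \<Longrightarrow> W' i - of_nat (b i) * u k \<in> S) \<Longrightarrow> integral_over S (u k)"
    by auto
  show ?case unfolding noether_shift_def
  proof (intro exI[of _ "a(k := b)"] conjI allI impI)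
    show "(a(k := b)) s i \<le> noether_bound n E" for s i using a(1) b(1) by simp
    fix S M assume S: "subring_closed S" and M: "fg_module S M" and c: "range TConst \<subseteq> multiplier M"
      and "\<forall>i\<le>n. W i - (\<Sum>s<Suc k. of_nat ((a(k := b)) s i) * u s) \<in> multiplier M"
    then have Wb: "W' i - of_nat (b i) * u k \<in> multiplier M" if "i \<le> n" for i
      using that by (simp add: W'_def algebra_simps)
    \<comment> \<open>The element shifted last is recovered first; adding its multiples back gives
      the \<open>W' i\<close>, to which the induction hypothesis applies.\<close>
    from fg_module_adjoin[OF S M b(2)[OF multiplier_subring(1)[OF S M] c Wb]]
    obtain M1 where M1: "fg_module S M1" "multiplier M \<subseteq> multiplier M1" "u k \<in> multiplier M1" by blast
    interpret M1: subring_closed "multiplier M1" by (rule multiplier_subring[OF S M1(1)])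
    have natS: "of_nat k \<in> multiplier M1" for k
      by (induction k) (auto intro: M1.zero_closed M1.one_closed M1.add_closed)
    have "W' i \<in> multiplier M1" if "i \<le> n" for i
    proof -
      have "W' i - of_nat (b i) * u k + of_nat (b i) * u k \<in> multiplier M1"
        using Wb[OF that] M1 by (intro M1.add_closed M1.mult_closed natS) auto
      then show ?thesis by simp
    qed
    with noether_shiftD[OF a(2) S M1(1)] c M1(2) obtain M' where
      "fg_module S M'" "multiplier M1 \<subseteq> multiplier M'" "\<forall>s<k. u s \<in> multiplier M'" "\<forall>i\<le>n. W i \<in> multiplier M'"
      unfolding W'_def by blast
    then show "\<exists>M'. fg_module S M' \<and> multiplier M \<subseteq> multiplier M' \<and> (\<forall>s<Suc k. u s \<in> multiplier M') \<and>
          (\<forall>i\<le>n. W i \<in> multiplier M')"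
      using M1 by (intro exI[of _ M']) (auto simp: less_Suc_eq)
  qed
qed

lemma fg_module_self:
  assumes "subring_closed S"
  shows "fg_module S S"
proof -
  interpret subring_closed S by fact
  have "S = fspan S 1 (\<lambda>_. 1)" by (auto simp: fspan_def intro!: exI[of _ "\<lambda>_. _"])
  then show ?thesis unfolding fg_module_def using one_closed by blast
qed

lemma fg_module_adjoin_roots:
  assumes S: "subring_closed S" and "finite A" and M: "fg_module S M"
    and "E \<ge> 1" and "\<And>i. i \<in> A \<Longrightarrow> x i ^ E \<in> multiplier M"
  shows "\<exists>M'. fg_module S M' \<and> multiplier M \<subseteq> multiplier M' \<and> (\<forall>i\<in>A. x i \<in> multiplier M')"
  using assms(2,5)
proof (induction A rule: finite_induct)
  case empty
  then show ?case using M by blast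
next
  case (insert i A)
  then obtain M1 where M1: "fg_module S M1" "multiplier M \<subseteq> multiplier M1" "\<And>i. i \<in> A \<Longrightarrow> x i \<in> multiplier M1" by auto
  interpret M1: subring_closed "multiplier M1" by (rule multiplier_subring[OF S M1(1)])
  let ?p = "Polynomial.monom 1 E + [:- (x i ^ E):]"
  have "Polynomial.degree ?p = E"
    using \<open>E \<ge> 1\<close> by (subst degree_add_eq_left) (auto simp: degree_monom_eq)
  moreover have "Polynomial.coeff ?p j \<in> multiplier M1" for j
    using M1(2) insert.prems[of i]
    by (auto simp: coeff_pCons intro!: M1.add_closed M1.uminus_closed M1.zero_closed M1.one_closed split: nat.split)
  ultimately have "integral_over (multiplier M1) (x i)"
    unfolding integral_over_def using \<open>E \<ge> 1\<close>
    by (intro exI[of _ ?p]) (auto simp: poly_monom coeff_pCons split: nat.split)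
  from fg_module_adjoin[OF S M1(1) this] M1 show ?case by blast
qed

abbreviation tz :: "'a::comm_ring_1 mpoly poly" where
  "tz \<equiv> [:0, 1:]"

text \<open>
  Since \<open>1\<close> lies in the ideal of the \<open>f s\<close>, the variable \<open>z\<close> lies in the algebra generated by the
  \<open>x i\<close> and the \<open>z * f s\<close>.
\<close>

lemma z_integral:
  fixes f :: "nat \<Rightarrow> complex mpoly"
  assumes f: "\<And>s. s < k \<Longrightarrow> f s \<in> bdeg {1..n} D" and one: "1 \<in> idl {..<k} f"
  shows "\<exists>a :: nat \<Rightarrow> nat \<Rightarrow> nat. (\<forall>s i. a s i \<le> noether_bound n (D + 1)) \<and>
    (\<forall>S. subring_closed S \<longrightarrow> range TConst \<subseteq> S \<longrightarrow>
       (\<forall>i\<le>n. (if i = 0 then 0 else [:V i ^ (D + 1):]) - (\<Sum>s<k. of_nat (a s i) * (tz * [:f s:])) \<in> S) \<longrightarrow>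
       integral_over S tz)"
proof -
  \<comment> \<open>There are \<open>n + 1\<close> elements, as many as variables including
    \<open>z\<close>; the additional element \<open>W 0 = 0\<close> provides the combination that
    becomes \<open>g\<close>.\<close>
  define W :: "nat \<Rightarrow> complex mpoly poly" where "W i = (if i = 0 then 0 else [:V i ^ (D + 1):])" for i
  have W: "W i \<in> tbdeg {1..n} (D + 1)" if "i \<le> n" for i
    using bdeg_power[of "V i" "{1..n}" 1 "D + 1"] that by (auto simp: W_def intro!: tbdeg_const)
  have u: "tz * [:f s:] \<in> tbdeg {1..n} (D + 1)" if "s < k" for s
  proof -
    have "tz \<in> tbdeg {1..n} 1"
      by (auto simp: tbdeg_def coeff_pCons split: nat.splits)
    from tbdeg_mult[OF this tbdeg_const[OF f[OF that]]] show ?thesis by (simp add: add.commute)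
  qed
  have "\<exists>a. (\<forall>s i. a s i \<le> noether_bound n (D + 1)) \<and> noether_shift n W k (\<lambda>s. tz * [:f s:]) a"
    by (rule noether_chain) (use W u in auto)
  then obtain a where a: "\<And>s i. a s i \<le> noether_bound n (D + 1)"
    "noether_shift n W k (\<lambda>s. tz * [:f s:]) a" by blast
  have "integral_over S tz" if S: "subring_closed S" "range TConst \<subseteq> S"
    "\<And>i. i \<le> n \<Longrightarrow> W i - (\<Sum>s<k. of_nat (a s i) * (tz * [:f s:])) \<in> S" for S
  proof -
    have SM: "S \<subseteq> multiplier S" by (rule multiplier_subring(2)[OF S(1) fg_module_self[OF S(1)]])
    obtain M where M: "fg_module S M" "multiplier S \<subseteq> multiplier M" "\<And>s. s < k \<Longrightarrow> tz * [:f s:] \<in> multiplier M"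
       "\<And>i. i \<le> n \<Longrightarrow> W i \<in> multiplier M"
      using noether_shiftD[OF a(2) S(1) fg_module_self[OF S(1)]] S(2,3) SM by blast
    have "[:V i:] ^ (D + 1) \<in> multiplier M" if "i \<in> {1..n}" for i
    proof -
      have "[:P:] ^ e = [:P ^ e:]" for P :: "complex mpoly" and e
        by (induction e) (auto simp: one_pCons)
      then have "[:V i:] ^ (D + 1) = W i"
        using that by (simp only: W_def) auto
      then show ?thesis using M(4)[of i] that by simp
    qed
    then have "\<exists>M'. fg_module S M' \<and> multiplier M \<subseteq> multiplier M' \<and> (\<forall>i\<in>{1..n}. [:V i:] \<in> multiplier M')"
      by (intro fg_module_adjoin_roots[OF S(1) _ M(1), where E = "D + 1"]) auto
    then obtain M' where
      M': "fg_module S M'" "multiplier M \<subseteq> multiplier M'" "\<And>i. i \<in> {1..n} \<Longrightarrow> [:V i:] \<in> multiplier M'" by auto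
    interpret M': subring_closed "multiplier M'" by (rule multiplier_subring[OF S(1) M'(1)])
    obtain q where q: "1 = (\<Sum>s<k. q s * f s)" using one by (auto simp: idl_def)
    \<comment> \<open>The cofactors may involve any variables; \<open>h\<close> discards those
      outside \<open>{1..n}\<close> and fixes the \<open>f s\<close>.\<close>
    define h where "h = ev Const (\<lambda>i. if i \<in> {1..n} then V i else (0 :: complex mpoly))"
    interpret h: comm_ring_hom h unfolding h_def by (rule ev_hom[OF Const_hom])
    have "h (f s) = f s" if "s < k" for s
    proof -
      have "h (f s) = ev Const V (f s)"
        unfolding h_def
      proof (rule ev_cong)
        fix m i assume "m \<in> keys (f s)" "i \<in> keys m"
        then have "i \<in> {1..n}" using f[OF that] unfolding bdeg_def by blast
        then show "(if i \<in> {1..n} then V i else 0 :: complex mpoly) = V i" by simp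
      qed simp
      then show ?thesis by (simp add: ev_Const_V)
    qed
    then have "1 = (\<Sum>s<k. h (q s) * f s)"
      using arg_cong[OF q, of h] by (simp add: h.hom_sum h.hom_mult)
    \<comment> \<open>Multiplying the relation for \<open>1\<close> by \<open>z\<close> expresses
      \<open>z\<close> through elements that are already multipliers.\<close>
    then have "tz = [:\<Sum>s<k. h (q s) * f s:] * tz" by simp
    also have "\<dots> = (\<Sum>s<k. [:h (q s):] * (tz * [:f s:]))"
      by (simp add: poly_eq_iff coeff_sum coeff_pCons mult.commute split: nat.split)
    also have "\<dots> \<in> multiplier M'"
    proof (rule M'.sum_closed, rule M'.mult_closed)
      show "tz * [:f s:] \<in> multiplier M'" if "s \<in> {..<k}" for s using that M(3) M'(2) by auto
      interpret c: comm_ring_hom "\<lambda>P. [:P :: complex mpoly:]" by unfold_locales (auto simp: one_pCons)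
      have "[:h (q s):] = ev (\<lambda>c. [:Const c:]) (\<lambda>i. [:if i \<in> {1..n} then V i else 0:]) (q s)" for s
        unfolding h_def by (rule ev_hom_comp) (rule c.comm_ring_hom_axioms)
      moreover have "ev (\<lambda>c. [:Const c:]) (\<lambda>i. [:if i \<in> {1..n} then V i else 0:]) (q s) \<in> multiplier M'" for s
        by (rule M'.ev_closed) (use S(2) SM M(2) M'(2,3) M'.zero_closed in auto)
      ultimately show "[:h (q s):] \<in> multiplier M'" for s by simp
    qed
    finally show ?thesis by (rule integral_of_multiplier[OF S(1) M'(1)])
  qed
  then show ?thesis using a(1) unfolding W_def by blast
qed

section \<open>The deformed polynomial ring\<close>

text \<open>
  The image of \<open>sig\<close> is the ring generated by \<open>z\<close> and the \<open>Y i\<close>, over which the monomials in \<open>Box n D\<close>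
  turn out to be a basis; the indices outside \<open>{1..n}\<close> carry the undeformed variables.
\<close>

definition Y :: "nat \<Rightarrow> nat \<Rightarrow> (nat \<Rightarrow> 'a::comm_ring_1 mpoly) \<Rightarrow> nat \<Rightarrow> 'a mpoly poly" where
  "Y n D f i = (if i \<in> {1..n} then [:V i ^ (D + 1), f i:] else [:V i:])"

definition phi :: "nat \<Rightarrow> nat \<Rightarrow> (nat \<Rightarrow> 'a::comm_ring_1 mpoly) \<Rightarrow> 'a mpoly \<Rightarrow> 'a mpoly poly" where
  "phi n D f = ev TConst (Y n D f)"

definition sig :: "nat \<Rightarrow> nat \<Rightarrow> (nat \<Rightarrow> 'a::comm_ring_1 mpoly) \<Rightarrow> 'a mpoly poly \<Rightarrow> 'a mpoly poly" where
  "sig n D f q = poly (map_poly (phi n D f) q) tz"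

definition Box :: "nat \<Rightarrow> nat \<Rightarrow> (nat \<Rightarrow>\<^sub>0 nat) set" where
  "Box n D = {b. keys b \<subseteq> {1..n} \<and> (\<forall>i. lookup b i \<le> D)}"

abbreviation xm :: "(nat \<Rightarrow>\<^sub>0 nat) \<Rightarrow> 'a::comm_ring_1 mpoly poly" where
  "xm m \<equiv> [:Poly_Mapping.single m 1:]"

lemma xm_add: "xm (a + b) = xm a * xm b"
  by (subst add.commute) (simp add: mult_single)

lemma xm_0: "xm 0 = 1"
  by (simp add: one_pCons)

lemma phi_hom: "comm_ring_hom (phi n D f)"
  unfolding phi_def by (rule ev_hom[OF TConst_hom])

lemma sig_hom: "comm_ring_hom (sig n D f)"
proof -
  interpret p: comm_ring_hom "phi n D f" by (rule phi_hom)
  interpret P: map_poly_comm_ring_hom "phi n D f" ..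
  show ?thesis
    by unfold_locales (auto simp: sig_def P.hom_mult P.hom_add)
qed

lemma sig_const: "sig n D f [:P:] = phi n D f P"
proof -
  interpret p: comm_ring_hom "phi n D f" by (rule phi_hom)
  have "map_poly (phi n D f) [:P:] = [:phi n D f P:]" by (simp add: poly_eq_iff coeff_map_poly coeff_pCons split: nat.split)
  then show ?thesis by (simp add: sig_def)
qed

lemma sig_tz: "sig n D f tz = tz"
proof -
  interpret p: comm_ring_hom "phi n D f" by (rule phi_hom)
  show ?thesis by (simp add: sig_def)
qed

lemma phi_V: "phi n D f (V i) = Y n D f i"
  unfolding phi_def by (rule ev_V[OF TConst_hom])

lemma phi_Const: "phi n D f (Const c) = TConst c"
  unfolding phi_def by (rule ev_Const[OF TConst_hom])

lemma sig_altdef: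
  assumes "Polynomial.degree q \<le> K"
  shows "sig n D f q = (\<Sum>j\<le>K. phi n D f (Polynomial.coeff q j) * tz ^ j)"
proof -
  interpret p: comm_ring_hom "phi n D f" by (rule phi_hom)
  have "sig n D f q = (\<Sum>j\<le>Polynomial.degree (map_poly (phi n D f) q). Polynomial.coeff (map_poly (phi n D f) q) j * tz ^ j)"
    unfolding sig_def by (rule poly_altdef)
  also have "\<dots> = (\<Sum>j\<le>K. Polynomial.coeff (map_poly (phi n D f) q) j * tz ^ j)"
  proof (rule sum.mono_neutral_left)
    show "{..Polynomial.degree (map_poly (phi n D f) q)} \<subseteq> {..K}"
      using assms degree_map_poly_le[of "phi n D f" q] by auto
    show "\<forall>i\<in>{..K} - {..Polynomial.degree (map_poly (phi n D f) q)}. Polynomial.coeff (map_poly (phi n D f) q) i * tz ^ i = 0"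
      by (intro ballI, subst Polynomial.coeff_eq_0) auto
  qed simp
  finally show ?thesis by (simp add: coeff_map_poly)
qed

lemma Box_subset: "Box n D \<subseteq> {m. keys m \<subseteq> {1..n} \<and> mdeg m \<le> n * D}"
proof
  fix b assume b: "b \<in> Box n D"
  then have "mdeg b = (\<Sum>i\<in>{1..n}. lookup b i)" by (intro mdeg_superset) (auto simp: Box_def)
  also have "\<dots> \<le> n * D"
    using sum_bounded_above[of "{1..n}" "lookup b" D] b by (auto simp: Box_def)
  finally show "b \<in> {m. keys m \<subseteq> {1..n} \<and> mdeg m \<le> n * D}" using b by (auto simp: Box_def)
qed

lemma finite_Box: "finite (Box n D)"
  by (rule finite_subset[OF Box_subset]) (auto intro: finite_monomials)

lemma card_Box: "card (Box n D) \<le> (D + 1) ^ n"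
proof -
  have "inj_on (\<lambda>m. restrict (lookup m) {1..n}) (Box n D)"
    using monomials_inj Box_subset by (rule inj_on_subset)
  moreover have "(\<lambda>m. restrict (lookup m) {1..n}) ` Box n D \<subseteq> PiE {1..n} (\<lambda>_. {..D})"
    by (auto simp: Box_def)
  ultimately have "card (Box n D) \<le> card (PiE {1..n} (\<lambda>_. {..D}))"
    by (intro card_inj_on_le finite_PiE) auto
  then show ?thesis by (simp add: card_PiE)
qed

lemma zero_in_Box [simp]: "0 \<in> Box n D"
  by (simp add: Box_def)

text \<open>Existence of normal forms: replace \<open>V i ^ (D + 1)\<close> by \<open>Y i - z * f i\<close> as long as possible.\<close>

locale deformation = seminorm \<nu> for \<nu> :: "'a::comm_ring_1 \<Rightarrow> real" +
  fixes n D :: nat and f :: "nat \<Rightarrow> 'a mpoly" and H :: real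
  assumes f_deg: "\<And>i. i \<in> {1..n} \<Longrightarrow> f i \<in> bdeg UNIV D"
    and f_norm: "\<And>i. i \<in> {1..n} \<Longrightarrow> l1 \<nu> (f i) \<le> H" and H_nonneg: "0 \<le> H"
begin

abbreviation \<sigma> where "\<sigma> \<equiv> sig n D f"

definition normal_form :: "'a mpoly poly \<Rightarrow> real \<Rightarrow> bool" where
  "normal_form t r \<longleftrightarrow> (\<exists>c. t = (\<Sum>b\<in>Box n D. \<sigma> (c b) * xm b) \<and> (\<Sum>b\<in>Box n D. pl1 (l1 \<nu>) (c b)) \<le> r)"

sublocale L: seminorm "l1 \<nu> :: 'a mpoly \<Rightarrow> real" by (rule seminorm_l1)

sublocale S: seminorm "pl1 (l1 \<nu> :: 'a mpoly \<Rightarrow> real)" by (rule L.seminorm_pl1)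

sublocale sig: comm_ring_hom "sig n D f" by (rule sig_hom)

lemma normal_form_mono: "normal_form t r \<Longrightarrow> r \<le> r' \<Longrightarrow> normal_form t r'"
proof -
  assume "normal_form t r" "r \<le> r'"
  then obtain c where "t = (\<Sum>b\<in>Box n D. \<sigma> (c b) * xm b)" "(\<Sum>b\<in>Box n D. pl1 (l1 \<nu>) (c b)) \<le> r'"
    unfolding normal_form_def by fastforce
  then show ?thesis unfolding normal_form_def by blast
qed

lemma normal_form_add: "normal_form s r \<Longrightarrow> normal_form t r' \<Longrightarrow> normal_form (s + t) (r + r')"
proof -
  assume "normal_form s r" "normal_form t r'"
  then obtain c d where c: "s = (\<Sum>b\<in>Box n D. \<sigma> (c b) * xm b)" "(\<Sum>b\<in>Box n D. pl1 (l1 \<nu>) (c b)) \<le> r"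
    and d: "t = (\<Sum>b\<in>Box n D. \<sigma> (d b) * xm b)" "(\<Sum>b\<in>Box n D. pl1 (l1 \<nu>) (d b)) \<le> r'"
    unfolding normal_form_def by blast
  have "s + t = (\<Sum>b\<in>Box n D. \<sigma> (c b + d b) * xm b)"
    unfolding c d sig.hom_add distrib_right sum.distrib ..
  moreover have "(\<Sum>b\<in>Box n D. pl1 (l1 \<nu>) (c b + d b)) \<le> r + r'"
    by (rule order_trans[OF sum_mono[OF S.nu_add]]) (use c d in \<open>simp add: sum.distrib\<close>)
  ultimately show ?thesis unfolding normal_form_def by (intro exI[of _ "\<lambda>b. c b + d b"]) auto
qed

lemma normal_form_scale: "normal_form t r \<Longrightarrow> normal_form (\<sigma> q * t) (pl1 (l1 \<nu>) q * r)"
proof -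
  assume "normal_form t r"
  then obtain c where c: "t = (\<Sum>b\<in>Box n D. \<sigma> (c b) * xm b)" "(\<Sum>b\<in>Box n D. pl1 (l1 \<nu>) (c b)) \<le> r"
    unfolding normal_form_def by blast
  have "\<sigma> q * t = (\<Sum>b\<in>Box n D. \<sigma> (q * c b) * xm b)"
    unfolding c sig.hom_mult sum_distrib_left mult.assoc ..
  moreover have "(\<Sum>b\<in>Box n D. pl1 (l1 \<nu>) (q * c b)) \<le> pl1 (l1 \<nu>) q * r"
    by (rule order_trans[OF sum_mono[OF S.nu_mult]]) (use c in \<open>auto simp flip: sum_distrib_left intro: mult_left_mono\<close>)
  ultimately show ?thesis unfolding normal_form_def by (intro exI[of _ "\<lambda>b. q * c b"]) auto
qed

lemma normal_form_0: "normal_form 0 0"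
  unfolding normal_form_def by (intro exI[of _ "\<lambda>_. 0"]) auto

lemma normal_form_sum: "(\<And>a. a \<in> A \<Longrightarrow> normal_form (t a) (r a)) \<Longrightarrow> normal_form (sum t A) (sum r A)"
  by (induction A rule: infinite_finite_induct) (auto intro: normal_form_0 normal_form_add)

lemma normal_form_const:
  assumes "P \<in> bdeg UNIV L" "\<And>m. m \<in> keys P \<Longrightarrow> normal_form (xm m) r"
  shows "normal_form [:P:] (l1 \<nu> P * r)"
proof -
  have c: "TConst c = \<sigma> [:Const c:]" for c by (simp add: sig_const phi_Const)
  have "[:P:] = (\<Sum>m\<in>keys P. \<sigma> [:Const (lookup P m):] * xm m)"
    by (subst (1) sum_singles[of P], unfold c[symmetric]) (simp add: mult_single poly_eq_iff coeff_sum coeff_pCons split: nat.split)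
  moreover have "normal_form (\<sigma> [:Const (lookup P m):] * xm m) (\<nu> (lookup P m) * r)" if "m \<in> keys P" for m
    using normal_form_scale[OF assms(2)[OF that], of "[:Const (lookup P m):]"] by simp
  ultimately show ?thesis
    using normal_form_sum[of "keys P"] by (simp add: l1_def sum_distrib_right)
qed

text \<open>Rewriting \<open>V i ^ (D + 1)\<close> lowers the degree, as \<open>f i\<close> has
  degree at most \<open>D\<close>, and costs at most a factor \<open>1 + H\<close> in norm; so the
  degree bounds the number of factors.\<close>

lemma normal_form_monomial: "normal_form (xm m) ((1 + H) ^ mdeg m)"
proof (induction "mdeg m" arbitrary: m rule: less_induct)
  case less
  show ?case
  proof (cases "m \<in> Box n D")
    case True
    have "xm m = (\<Sum>b\<in>Box n D. \<sigma> (if b = m then 1 else 0) * xm b)"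
    proof -
      have "(\<Sum>b\<in>Box n D. \<sigma> (if b = m then 1 else 0) * xm b) = (\<Sum>b\<in>Box n D. if b = m then xm m else 0)"
        by (intro sum.cong) auto
      then show ?thesis using True finite_Box by simp
    qed
    moreover have "(\<Sum>b\<in>Box n D. pl1 (l1 \<nu>) (if b = m then 1 else (0 :: 'a mpoly poly))) \<le> 1"
      using True finite_Box S.nu_1 by (simp add: if_distrib[of "pl1 _"] cong: if_cong)
    ultimately have "normal_form (xm m) 1" unfolding normal_form_def by (intro exI[of _ "\<lambda>b. if b = m then 1 else 0"]) auto
    then show ?thesis by (rule normal_form_mono) (use H_nonneg in auto)
  next
    case False
    have split: "\<exists>m'. m = m' + Poly_Mapping.single i k" if "k \<le> lookup m i" for i k
      by (intro exI[of _ "m - Poly_Mapping.single i k"] poly_mapping_eqI)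
        (use that in \<open>auto simp: lookup_add lookup_minus lookup_single when_def\<close>)
    have "\<exists>i. i \<notin> {1..n} \<and> 1 \<le> lookup m i \<or> i \<in> {1..n} \<and> D + 1 \<le> lookup m i"
    proof (rule ccontr)
      assume no: "\<not> ?thesis"
      then have out: "\<not> 1 \<le> lookup m i" if "i \<notin> {1..n}" for i using that by blast
      have inn: "\<not> D + 1 \<le> lookup m i" if "i \<in> {1..n}" for i using no that by blast
      have "lookup m i \<le> D" for i using out[of i] inn[of i] by linarith
      moreover have "keys m \<subseteq> {1..n}"
      proof
        fix i assume "i \<in> keys m"
        then have "1 \<le> lookup m i" by (simp add: in_keys_iff)
        then show "i \<in> {1..n}" using out by blast
      qed
      ultimately show False using False by (auto simp: Box_def)
    qed
    then obtain i where "i \<notin> {1..n} \<and> 1 \<le> lookup m i \<or> i \<in> {1..n} \<and> D + 1 \<le> lookup m i" by blast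
    then show ?thesis
    proof (elim disjE conjE)
      \<comment> \<open>An undeformed variable lies in the image of \<open>\<sigma>\<close> and
        moves into the coefficients.\<close>
      assume i: "i \<notin> {1..n}" "1 \<le> lookup m i"
      obtain m' where m': "m = m' + Poly_Mapping.single i 1" using split i by blast
      have "\<sigma> [:V i:] = xm (Poly_Mapping.single i 1)"
        using i(1) unfolding sig_const phi_V by (auto simp: Y_def V_def)
      then have "xm m = \<sigma> [:V i:] * xm m'" unfolding m' xm_add by (simp only: mult.commute)
      moreover have "normal_form (\<sigma> [:V i:] * xm m') (pl1 (l1 \<nu>) [:V i:] * (1 + H) ^ mdeg m')"
        by (intro normal_form_scale less) (simp add: m' mdeg_add)
      moreover have "pl1 (l1 \<nu>) [:V i :: 'a mpoly:] * (1 + H) ^ mdeg m' \<le> 1 * (1 + H) ^ mdeg m'"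
        using H_nonneg nu_1 by (intro mult_right_mono) (auto simp: V_def)
      moreover have "\<dots> \<le> (1 + H) ^ mdeg m"
        using H_nonneg by (simp add: m' mdeg_add)
      ultimately show ?thesis by (metis normal_form_mono order_trans)
    next
      assume i: "i \<in> {1..n}" "D + 1 \<le> lookup m i"
      obtain m' where m': "m = m' + Poly_Mapping.single i (D + 1)" using split i by blast
      have deg: "mdeg m' + D < mdeg m" by (simp add: m' mdeg_add)
      \<comment> \<open>Both \<open>m'\<close> and the monomials of \<open>f i\<close> times
        \<open>m'\<close> have smaller degree than \<open>m\<close>, so one bound serves them
        all.\<close>
      define h where "h = (1 + H) ^ (mdeg m - 1)"
      have le_h: "normal_form (xm k) h" if "mdeg k < mdeg m" for k
        unfolding h_def by (rule normal_form_mono[OF less[OF that]]) (use that H_nonneg in \<open>auto intro: power_increasing\<close>)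
      have Vp: "V i ^ k = (Poly_Mapping.single (Poly_Mapping.single i k) 1 :: 'a mpoly)" for k
        using mval_V[of "Poly_Mapping.single i k", where 'a = 'a] by simp
      have "\<sigma> [:V i:] = xm (Poly_Mapping.single i (D + 1)) + tz * [:f i:]"
        using i(1) unfolding sig_const phi_V by (simp only: Y_def if_True Vp) simp
      then have "xm m = \<sigma> [:V i:] * xm m' - tz * [:f i:] * xm m'"
        unfolding m' xm_add by (simp only: distrib_right add_diff_cancel_right' mult.commute[of "xm m'"])
      also have "\<dots> = \<sigma> [:V i:] * xm m' + \<sigma> (- tz) * [:f i * Poly_Mapping.single m' 1:]"
        unfolding sig.hom_uminus sig_tz by simp
      finally have eq: "xm m = \<sigma> [:V i:] * xm m' + \<sigma> (- tz) * [:f i * Poly_Mapping.single m' 1:]" .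
      have "normal_form [:f i * Poly_Mapping.single m' 1:] (l1 \<nu> (f i * Poly_Mapping.single m' 1) * h)"
      proof (rule normal_form_const)
        have "f i * Poly_Mapping.single m' 1 \<in> bdeg UNIV (D + mdeg m')"
          by (rule bdeg_mult[OF f_deg[OF i(1)]]) (auto simp: bdeg_def)
        then show b: "f i * Poly_Mapping.single m' 1 \<in> bdeg UNIV (mdeg m - 1)"
          by (rule bdeg_mono) (use deg in auto)
        show "normal_form (xm k) h" if "k \<in> keys (f i * Poly_Mapping.single m' 1)" for k
          using b that deg by (intro le_h) (fastforce simp: bdeg_def)
      qed
      then have "normal_form (\<sigma> (- tz) * [:f i * Poly_Mapping.single m' 1:])
          (pl1 (l1 \<nu>) (- tz :: 'a mpoly poly) * (l1 \<nu> (f i * Poly_Mapping.single m' 1) * h))" by (rule normal_form_scale)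
      moreover have "normal_form (\<sigma> [:V i:] * xm m') (pl1 (l1 \<nu>) [:V i:] * h)"
        by (intro normal_form_scale le_h) (use deg in simp)
      ultimately have nf: "normal_form (xm m) (pl1 (l1 \<nu>) [:V i:] * h +
          pl1 (l1 \<nu>) (- tz :: 'a mpoly poly) * (l1 \<nu> (f i * Poly_Mapping.single m' 1) * h))"
        unfolding eq by (rule normal_form_add[rotated])
      have h0: "h \<ge> 0" using H_nonneg by (simp add: h_def)
      have 1: "pl1 (l1 \<nu>) [:V i :: 'a mpoly:] * h \<le> 1 * h"
        using h0 nu_1 by (intro mult_right_mono) (auto simp: V_def)
      have "l1 \<nu> (f i * Poly_Mapping.single m' 1) \<le> l1 \<nu> (f i) * l1 \<nu> (Poly_Mapping.single m' 1)" by (rule L.nu_mult)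
      also have "\<dots> \<le> H * 1" using f_norm[OF i(1)] nu_1 H_nonneg by (intro mult_mono) auto
      finally have 2: "l1 \<nu> (f i * Poly_Mapping.single m' 1) * h \<le> H * h" using h0 by (intro mult_right_mono) auto
      have tz1: "pl1 (l1 \<nu>) (- tz :: 'a mpoly poly) \<le> 1"
        using L.nu_1 by (simp add: S.nu_uminus del: minus_pCons)
      have "pl1 (l1 \<nu>) (- tz :: 'a mpoly poly) * (l1 \<nu> (f i * Poly_Mapping.single m' 1) * h)
          \<le> 1 * (l1 \<nu> (f i * Poly_Mapping.single m' 1) * h)"
        by (rule mult_right_mono[OF tz1]) (use h0 in simp)
      then have 3: "pl1 (l1 \<nu>) (- tz :: 'a mpoly poly) * (l1 \<nu> (f i * Poly_Mapping.single m' 1) * h) \<le> 1 * (H * h)"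
        using 2 by simp
      obtain k where "mdeg m = Suc k" using deg by (cases "mdeg m") auto
      then have "1 * h + 1 * (H * h) = (1 + H) ^ mdeg m"
        by (simp add: h_def distrib_right)
      then show ?thesis using add_mono[OF 1 3] by (intro normal_form_mono[OF nf]) simp
    qed
  qed
qed

lemma normal_form_poly:
  assumes "P \<in> bdeg UNIV L"
  shows "normal_form [:P:] (l1 \<nu> P * (1 + H) ^ L)"
proof (rule normal_form_const[OF assms])
  fix m assume "m \<in> keys P"
  then have "mdeg m \<le> L" using assms by (auto simp: bdeg_def)
  then show "normal_form (xm m) ((1 + H) ^ L)"
    by (intro normal_form_mono[OF normal_form_monomial] power_increasing) (use H_nonneg in auto)
qed

lemma ex_normal_form: "\<exists>r. normal_form t r"
proof -
  have "\<exists>r. normal_form [:P:] r" for P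
  proof -
    obtain d where "P \<in> bdeg {..<d} d" using ex_bdeg by blast
    then have "P \<in> bdeg UNIV d" by (rule bdeg_mono) auto
    then show ?thesis using normal_form_poly by blast
  qed
  then obtain r where r: "\<And>P. normal_form [:P:] (r P)" by metis
  have "t = (\<Sum>j\<le>Polynomial.degree t. \<sigma> (tz ^ j) * [:Polynomial.coeff t j:])"
    unfolding sig.hom_power sig_tz
    using poly_as_sum_of_monoms[of t] by (simp add: monom_altdef mult.commute)
  moreover have "normal_form (\<Sum>j\<le>Polynomial.degree t. \<sigma> (tz ^ j) * [:Polynomial.coeff t j:])
    (\<Sum>j\<le>Polynomial.degree t. pl1 (l1 \<nu>) (tz ^ j :: 'a mpoly poly) * r (Polynomial.coeff t j))"
    by (intro normal_form_sum normal_form_scale r)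
  ultimately show ?thesis by metis
qed

end

text \<open>Uniqueness of normal forms: compare the parts of top degree in the \<open>V i\<close>.\<close>

definition xle :: "nat \<Rightarrow> 'a::comm_ring_1 mpoly poly set" where
  "xle d = {t. \<forall>j. \<forall>m\<in>keys (Polynomial.coeff t j). mdeg m \<le> d}"

definition xlt :: "nat \<Rightarrow> 'a::comm_ring_1 mpoly poly set" where
  "xlt d = {t. \<forall>j. \<forall>m\<in>keys (Polynomial.coeff t j). mdeg m < d}"

lemma keys_coeff_mult:
  fixes s t :: "'a::comm_ring_1 mpoly poly"
  assumes "m \<in> keys (Polynomial.coeff (s * t) j)"
  shows "\<exists>i a b. m = a + b \<and> a \<in> keys (Polynomial.coeff s i) \<and> b \<in> keys (Polynomial.coeff t (j - i))"
proof -
  obtain i where "m \<in> keys (Polynomial.coeff s i * Polynomial.coeff t (j - i))"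
    using assms keys_sum[of "\<lambda>i. Polynomial.coeff s i * Polynomial.coeff t (j - i)" "{..j}"]
    by (auto simp: coeff_mult)
  then show ?thesis using keys_mult by blast
qed

lemma xlt_mult: "s \<in> xle c \<Longrightarrow> t \<in> xlt d \<Longrightarrow> s * t \<in> xlt (c + d)"
  unfolding xle_def xlt_def by (fastforce dest!: keys_coeff_mult simp: mdeg_add intro: add_le_less_mono)

lemma xlt_xle: "t \<in> xlt d \<Longrightarrow> t \<in> xle d"
  by (fastforce simp: xle_def xlt_def)

lemma xlt_add: "s \<in> xlt d \<Longrightarrow> t \<in> xlt d \<Longrightarrow> s + t \<in> xlt d"
proof -
  assume st: "s \<in> xlt d" "t \<in> xlt d"
  have "keys (Polynomial.coeff (s + t) j) \<subseteq> keys (Polynomial.coeff s j) \<union> keys (Polynomial.coeff t j)" for j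
    by (simp add: Poly_Mapping.keys_add)
  with st show ?thesis by (fastforce simp: xlt_def)
qed

lemma xm_xle: "xm m \<in> xle (mdeg m)"
  by (auto simp: xle_def coeff_pCons split: nat.splits if_splits)

text \<open>The degree counts the \<open>V i\<close> only: \<open>z\<close> has weight zero here, in
  contrast to \<open>tbdeg\<close>. Thus the term \<open>z * f i\<close> of \<open>Y i\<close> is of
  lower order.\<close>

definition leads :: "'a::comm_ring_1 mpoly poly \<Rightarrow> (nat \<Rightarrow>\<^sub>0 nat) \<Rightarrow> bool" where
  "leads t \<mu> \<longleftrightarrow> t - xm \<mu> \<in> xlt (mdeg \<mu>)"

lemma leads_mult: "leads s \<mu> \<Longrightarrow> leads t \<mu>' \<Longrightarrow> leads (s * t) (\<mu> + \<mu>')"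
proof -
  assume s: "leads s \<mu>" and t: "leads t \<mu>'"
  have "s * t - xm (\<mu> + \<mu>') = xm \<mu> * (t - xm \<mu>') + (xm \<mu>' * (s - xm \<mu>) + (s - xm \<mu>) * (t - xm \<mu>'))"
    unfolding xm_add by (simp only: algebra_simps)
  moreover have "xm \<mu> * (t - xm \<mu>') \<in> xlt (mdeg \<mu> + mdeg \<mu>')"
    using t by (intro xlt_mult xm_xle) (simp add: leads_def)
  moreover have "xm \<mu>' * (s - xm \<mu>) \<in> xlt (mdeg \<mu>' + mdeg \<mu>)"
    using s by (intro xlt_mult xm_xle) (simp add: leads_def)
  moreover have "(s - xm \<mu>) * (t - xm \<mu>') \<in> xlt (mdeg \<mu> + mdeg \<mu>')"
    using s t by (intro xlt_mult xlt_xle) (auto simp: leads_def)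
  ultimately show ?thesis
    unfolding leads_def mdeg_add by (simp only: add.commute[of "mdeg \<mu>'"]) (intro xlt_add)
qed

lemma leads_xm: "leads (xm m) m"
  by (simp add: leads_def xlt_def)

lemma leads_1: "leads 1 0"
  using leads_xm[of 0] by (simp only: xm_0)

lemma leads_power: "leads t (Poly_Mapping.single i e) \<Longrightarrow> leads (t ^ k) (Poly_Mapping.single i (e * k))"
proof (induction k)
  case (Suc k)
  then show ?case using leads_mult[of t "Poly_Mapping.single i e" "t ^ k" "Poly_Mapping.single i (e * k)"]
    by (simp flip: single_add)
qed (simp add: leads_1)

lemma leads_prod: "(\<And>a. a \<in> A \<Longrightarrow> leads (t a) (\<mu> a)) \<Longrightarrow> leads (prod t A) (sum \<mu> A)"
  by (induction A rule: infinite_finite_induct) (auto intro: leads_1 leads_mult)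

text \<open>The exponent of the leading monomial of the product of powers of the \<open>Y i\<close>
  given by \<open>\<alpha>\<close>.\<close>

definition spread :: "nat \<Rightarrow> nat \<Rightarrow> (nat \<Rightarrow>\<^sub>0 nat) \<Rightarrow> (nat \<Rightarrow>\<^sub>0 nat)" where
  "spread n D \<alpha> = (\<Sum>i\<in>keys \<alpha>. Poly_Mapping.single i ((if i \<in> {1..n} then D + 1 else 1) * lookup \<alpha> i))"

lemma lookup_spread: "lookup (spread n D \<alpha>) i = (if i \<in> {1..n} then D + 1 else 1) * lookup \<alpha> i"
proof -
  have "lookup (spread n D \<alpha>) i = (\<Sum>k\<in>keys \<alpha>. if k = i then (if i \<in> {1..n} then D + 1 else 1) * lookup \<alpha> i else 0)"
    unfolding spread_def lookup_sum by (intro sum.cong) (auto simp: lookup_single when_def)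
  also have "\<dots> = (if i \<in> {1..n} then D + 1 else 1) * lookup \<alpha> i"
    by (simp add: in_keys_iff)
  finally show ?thesis .
qed

text \<open>Division with remainder by \<open>D + 1\<close> in each coordinate of
  \<open>{1..n}\<close>: the elements of the box are the remainders, and they vanish in all other
  coordinates.\<close>

lemma spread_inj:
  assumes "spread n D \<alpha> + b = spread n D \<beta> + c" "b \<in> Box n D" "c \<in> Box n D"
  shows "\<alpha> = \<beta> \<and> b = c"
proof -
  have "lookup \<alpha> i = lookup \<beta> i \<and> lookup b i = lookup c i" for i
  proof -
    have eq: "lookup (spread n D \<alpha>) i + lookup b i = lookup (spread n D \<beta>) i + lookup c i"
      using assms(1) by (metis lookup_add)
    show ?thesis
    proof (cases "i \<in> {1..n}")
      case True
      have "lookup b i < D + 1" "lookup c i < D + 1" using assms(2,3) by (auto simp: Box_def less_Suc_eq_le)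
      moreover have "(D + 1) * lookup \<alpha> i + lookup b i = (D + 1) * lookup \<beta> i + lookup c i"
        using eq True by (simp only: lookup_spread if_True)
      ultimately show ?thesis
        by (metis add.commute add_diff_cancel_left' div_mult_self2 div_less mod_less mod_mult_self2 add_0 not_less0 zero_less_Suc Suc_eq_plus1 nat.distinct(1))
    next
      case False
      have "i \<notin> keys b" "i \<notin> keys c" using assms(2,3) False by (auto simp: Box_def)
      then show ?thesis using eq False by (auto simp: lookup_spread in_keys_iff split: if_splits)
    qed
  qed
  then show ?thesis by (auto intro!: poly_mapping_eqI)
qed

lemma leads_Y:
  fixes f :: "nat \<Rightarrow> 'a::comm_ring_1 mpoly"
  assumes "\<And>i. i \<in> {1..n} \<Longrightarrow> f i \<in> bdeg UNIV D"
  shows "leads (Y n D f i) (Poly_Mapping.single i (if i \<in> {1..n} then D + 1 else 1))"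
proof (cases "i \<in> {1..n}")
  case True
  have Vp: "V i ^ (D + 1) = (Poly_Mapping.single (Poly_Mapping.single i (D + 1)) 1 :: 'a mpoly)"
    using mval_V[of "Poly_Mapping.single i (D + 1)", where 'a = 'a] by simp
  have "Y n D f i = [:Poly_Mapping.single (Poly_Mapping.single i (D + 1)) 1, f i:]"
    using True unfolding Y_def Vp by simp
  then have "Y n D f i - xm (Poly_Mapping.single i (D + 1)) = [:0, f i:]" by simp
  moreover have "[:0, f i:] \<in> xlt (D + 1)"
    using assms[OF True] by (auto simp: xlt_def bdeg_def coeff_pCons less_Suc_eq_le split: nat.split)
  ultimately show ?thesis using True by (simp add: leads_def)
next
  case False
  show ?thesis unfolding Y_def V_def if_not_P[OF False] by (rule leads_xm)
qed

lemma leads_mval_Y: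
  assumes "\<And>i. i \<in> {1..n} \<Longrightarrow> f i \<in> bdeg UNIV D"
  shows "leads (mval (Y n D f) \<alpha>) (spread n D \<alpha>)"
  unfolding mval_def spread_def by (intro leads_prod leads_power leads_Y assms)

lemma lookup_Const_mult: "lookup (Const a * P) m = a * lookup P m" for a :: "'a::comm_ring_1"
  by (simp add: Poly_Mapping.map.rep_eq when_def flip: mult_map_scale_conv_mult)

lemma coeff_tz_power_mult: "Polynomial.coeff (t * tz ^ j) k = (if j \<le> k then Polynomial.coeff t (k - j) else 0)"
  for t :: "'a::comm_ring_1 mpoly poly"
proof (induction j arbitrary: k)
  case (Suc j)
  have "t * tz ^ Suc j = pCons 0 (t * tz ^ j)" by (simp add: mult.left_commute)
  then show ?case using Suc by (auto simp: coeff_pCons split: nat.split)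
qed simp

theorem normal_form_unique:
  fixes f :: "nat \<Rightarrow> 'a::comm_ring_1 mpoly"
  assumes f: "\<And>i. i \<in> {1..n} \<Longrightarrow> f i \<in> bdeg UNIV D"
    and zero: "(\<Sum>b\<in>Box n D. sig n D f (c b) * xm b) = 0"
  shows "\<forall>b\<in>Box n D. c b = 0"
proof (rule ccontr)
  assume nz: "\<not> ?thesis"
  define K where "K = (\<Sum>b\<in>Box n D. Polynomial.degree (c b))"
  have K: "Polynomial.degree (c b) \<le> K" if "b \<in> Box n D" for b
    unfolding K_def using that finite_Box by (intro member_le_sum) auto
  \<comment> \<open>A triple \<open>(b, j, \<alpha>)\<close> names one term of the expansion: basis
    monomial \<open>b\<close>, power \<open>j\<close> of \<open>z\<close>, and powers
    \<open>\<alpha>\<close> of the \<open>Y i\<close>.\<close>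
  define T where "T = (SIGMA b:Box n D. SIGMA j:{..K}. keys (Polynomial.coeff (c b) j))"
  define deg where "deg = (\<lambda>(b, j :: nat, \<alpha>). mdeg (spread n D \<alpha> + b))"
  have finT: "finite T" unfolding T_def by (intro finite_SigmaI finite_Box) auto
  have "T \<noteq> {}"
  proof -
    obtain b where b: "b \<in> Box n D" "c b \<noteq> 0" using nz by blast
    then have "Polynomial.lead_coeff (c b) \<noteq> 0" by simp
    then obtain \<alpha> where "\<alpha> \<in> keys (Polynomial.lead_coeff (c b))" by (metis ex_in_conv keys_eq_empty)
    then have "(b, Polynomial.degree (c b), \<alpha>) \<in> T" using b K by (auto simp: T_def)
    then show ?thesis by auto
  qed
  then have "Max (deg ` T) \<in> deg ` T" using finT by (intro Max_in) auto
  then obtain b0 j0 \<alpha>0 where t0: "(b0, j0, \<alpha>0) \<in> T" "deg (b0, j0, \<alpha>0) = Max (deg ` T)" by auto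
  have max: "deg x \<le> deg (b0, j0, \<alpha>0)" if "x \<in> T" for x
    unfolding t0(2) using finT that by simp
  define m0 where "m0 = spread n D \<alpha>0 + b0"
  define co where "co = (\<lambda>(b, j, \<alpha>). lookup (Polynomial.coeff (c b) j) \<alpha>)"
  define el where "el = (\<lambda>(b, j, \<alpha>). mval (Y n D f) \<alpha> * xm b * tz ^ j)"
  have "(\<Sum>b\<in>Box n D. sig n D f (c b) * xm b) = (\<Sum>x\<in>T. TConst (co x) * el x)"
  proof -
    have "sig n D f (c b) * xm b = (\<Sum>j\<le>K. \<Sum>\<alpha>\<in>keys (Polynomial.coeff (c b) j). TConst (co (b, j, \<alpha>)) * el (b, j, \<alpha>))"
      if "b \<in> Box n D" for b
      unfolding sig_altdef[OF K[OF that]] sum_distrib_right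
    proof (rule sum.cong[OF refl])
      fix j
      have "phi n D f (Polynomial.coeff (c b) j) * tz ^ j * xm b
        = (\<Sum>\<alpha>\<in>keys (Polynomial.coeff (c b) j). TConst (lookup (Polynomial.coeff (c b) j) \<alpha>) * mval (Y n D f) \<alpha>) * (tz ^ j * xm b)"
        by (simp only: phi_def ev_def mult.assoc)
      also have "\<dots> = (\<Sum>\<alpha>\<in>keys (Polynomial.coeff (c b) j). TConst (co (b, j, \<alpha>)) * el (b, j, \<alpha>))"
        unfolding sum_distrib_right co_def el_def prod.case by (intro sum.cong refl) (simp only: ac_simps)
      finally show "phi n D f (Polynomial.coeff (c b) j) * tz ^ j * xm b
        = (\<Sum>\<alpha>\<in>keys (Polynomial.coeff (c b) j). TConst (co (b, j, \<alpha>)) * el (b, j, \<alpha>))" .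
    qed
    then show ?thesis
      unfolding T_def by (simp add: sum.Sigma finite_Box case_prod_unfold)
  qed
  then have "0 = lookup (Polynomial.coeff (\<Sum>x\<in>T. TConst (co x) * el x) j0) m0" using zero by simp
  also have "\<dots> = (\<Sum>x\<in>T. co x * lookup (Polynomial.coeff (el x) j0) m0)"
    by (simp add: coeff_sum lookup_sum lookup_Const_mult)
  \<comment> \<open>A term of degree at most that of \<open>m0\<close> can contain \<open>m0\<close>
    only as its leading monomial; by \<open>spread_inj\<close> this monomial and the power of
    \<open>z\<close> determine the triple.\<close>
  also have "\<dots> = (\<Sum>x\<in>T. if x = (b0, j0, \<alpha>0) then co x else 0)"
  proof (rule sum.cong[OF refl])
    fix x assume x: "x \<in> T"
    obtain b j \<alpha> where [simp]: "x = (b, j, \<alpha>)" by (cases x)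
    have b: "b \<in> Box n D" "b0 \<in> Box n D" using x t0 by (auto simp: T_def)
    define \<mu> where "\<mu> = spread n D \<alpha> + b"
    have le: "mdeg \<mu> \<le> mdeg m0" using max[OF x] by (simp add: deg_def \<mu>_def m0_def)
    have "leads (mval (Y n D f) \<alpha> * xm b) \<mu>"
      unfolding \<mu>_def by (intro leads_mult leads_mval_Y f leads_xm)
    then have low: "mval (Y n D f) \<alpha> * xm b - xm \<mu> \<in> xlt (mdeg \<mu>)" by (simp add: leads_def)
    have "lookup (Polynomial.coeff (mval (Y n D f) \<alpha> * xm b - xm \<mu>) k) m0 = 0" for k
    proof -
      have "m0 \<notin> keys (Polynomial.coeff (mval (Y n D f) \<alpha> * xm b - xm \<mu>) k)"
        using low le unfolding xlt_def by fastforce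
      then show ?thesis by (simp only: in_keys_iff not_not)
    qed
    then have main: "lookup (Polynomial.coeff (mval (Y n D f) \<alpha> * xm b) k) m0 = lookup (Polynomial.coeff (xm \<mu>) k) m0" for k
      by (simp add: lookup_minus)
    have "lookup (Polynomial.coeff (el x) j0) m0 = (if j \<le> j0 then lookup (Polynomial.coeff (xm \<mu> :: 'a mpoly poly) (j0 - j)) m0 else 0)"
      by (simp add: el_def coeff_tz_power_mult main del: mult_pCons_right)
    also have "\<dots> = (if j = j0 \<and> \<mu> = m0 then 1 else 0)"
      by (auto simp: coeff_pCons lookup_single split: nat.split)
    also have "j = j0 \<and> \<mu> = m0 \<longleftrightarrow> x = (b0, j0, \<alpha>0)"
      using spread_inj[OF _ b, of \<alpha> \<alpha>0] by (auto simp: \<mu>_def m0_def)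
    finally show "co x * lookup (Polynomial.coeff (el x) j0) m0 = (if x = (b0, j0, \<alpha>0) then co x else 0)" by simp
  qed
  also have "\<dots> = co (b0, j0, \<alpha>0)" using t0(1) finT by simp
  also have "\<dots> \<noteq> 0" using t0(1) by (auto simp: T_def co_def in_keys_iff)
  finally show False by simp
qed

text \<open>In a monomial order compatible with addition the product of the largest monomials
  survives over a domain. Its exponent must be \<open>0\<close>, which is also the least
  monomial.\<close>

lemma mpoly_unit_Const:
  fixes P Q :: "'a::idom mpoly"
  assumes PQ: "P * Q = 1"
  shows "\<exists>c. P = Const c"
proof -
  have "P \<noteq> 0" "Q \<noteq> 0" using PQ by auto
  then have ne: "keys P \<noteq> {}" "keys Q \<noteq> {}" by simp_all
  define a b where "a = Max (keys P)" and "b = Max (keys Q)"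
  have ab: "a \<in> keys P" "b \<in> keys Q" using ne by (auto simp: a_def b_def)
  have le: "m \<le> a" if "m \<in> keys P" for m using that by (simp add: a_def)
  have le': "m \<le> b" if "m \<in> keys Q" for m using that by (simp add: b_def)
  have eq: "m + m' = a + b \<longleftrightarrow> m = a \<and> m' = b" if "m \<in> keys P" "m' \<in> keys Q" for m m'
  proof
    assume e: "m + m' = a + b"
    have "\<not> m < a" using add_less_le_mono[of m a m' b] le'[OF that(2)] e by auto
    then have "m = a" using le[OF that(1)] by simp
    then show "m = a \<and> m' = b" using e by simp
  qed simp
  have "lookup (P * Q) (a + b) = (\<Sum>m\<in>keys P. \<Sum>m'\<in>keys Q. if m = a \<and> m' = b then lookup P m * lookup Q m' else 0)"
    by (subst mult_singles, unfold lookup_sum, intro sum.cong refl) (auto simp: lookup_single when_def eq)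
  also have "\<dots> = (\<Sum>m\<in>keys P. if m = a then (\<Sum>m'\<in>keys Q. if m' = b then lookup P a * lookup Q b else 0) else 0)"
    by (intro sum.cong refl) auto
  also have "\<dots> = lookup P a * lookup Q b" using ab by simp
  also have "\<dots> \<noteq> 0" using ab by (simp add: in_keys_iff)
  finally have "a + b = 0" unfolding PQ by (auto simp: lookup_one when_def split: if_splits)
  then have "a = 0" by (metis add_eq_0_iff_both_eq_0 lookup_add lookup_zero poly_mapping_eqI)
  have "m = 0" if "m \<in> keys P" for m
  proof (rule ccontr)
    assume "m \<noteq> 0"
    then have "m < 0" using le[OF that] \<open>a = 0\<close> by simp
    then show False by (auto simp: less_poly_mapping.rep_eq less_fun_def)
  qed
  then have "keys P \<subseteq> {0}" by blast
  then have "P = Const (lookup P 0)"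
    by (intro poly_mapping_eqI) (auto simp: lookup_single when_def in_keys_iff)
  then show ?thesis by blast
qed

section \<open>Passage from integer to complex coefficients\<close>

definition cmap :: "int mpoly \<Rightarrow> complex mpoly" where
  "cmap = ev (\<lambda>c. Const (of_int c)) V"

lemma of_int_Const_hom: "comm_ring_hom (\<lambda>c. Const (of_int c :: complex))"
  by unfold_locales (auto simp: single_add mult_single simp del: single_of_int)

lemma cmap_hom: "comm_ring_hom cmap"
  unfolding cmap_def by (rule ev_hom[OF of_int_Const_hom])

lemma lookup_cmap: "lookup (cmap P) m = of_int (lookup P m)"
proof -
  have "lookup (cmap P) m = (\<Sum>k\<in>keys P. if k = m then of_int (lookup P k) else 0)"
    unfolding cmap_def ev_def lookup_sum
    by (intro sum.cong refl) (auto simp: lookup_Const_mult mval_V lookup_single when_def simp del: single_of_int)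
  also have "\<dots> = of_int (lookup P m)" by (simp add: in_keys_iff)
  finally show ?thesis .
qed

lemma inj_cmap: "inj cmap"
proof (rule injI)
  fix P Q assume "cmap P = cmap Q"
  then have "lookup (cmap P) m = lookup (cmap Q) m" for m by simp
  then show "P = Q" by (auto intro!: poly_mapping_eqI simp: lookup_cmap)
qed

lemma keys_cmap: "keys (cmap P) = keys P"
  by (auto simp: in_keys_iff lookup_cmap)

lemma cmap_bdeg: "P \<in> bdeg I d \<Longrightarrow> cmap P \<in> bdeg I d"
  by (simp add: bdeg_def keys_cmap)

lemma cmap_V: "cmap (V i) = V i"
  unfolding cmap_def by (rule ev_V[OF of_int_Const_hom])

lemma cmap_Const: "cmap (Const c) = Const (of_int c)"
  unfolding cmap_def by (rule ev_Const[OF of_int_Const_hom])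

lemma cmap_single: "cmap (Poly_Mapping.single m 1) = Poly_Mapping.single m 1"
  by (rule poly_mapping_eqI) (auto simp: lookup_cmap lookup_single when_def)

lemma evc_cmap: "evc w (cmap P) = ev of_int w P"
  unfolding cmap_def by (subst ev_hom_comp[OF ev_hom[OF id_hom]]) (simp add: ev_Const[OF id_hom] ev_V[OF id_hom] del: single_of_int)

lemma map_poly_hom: "comm_ring_hom h \<Longrightarrow> comm_ring_hom (map_poly h)"
proof -
  assume "comm_ring_hom h"
  then interpret h: comm_ring_hom h .
  interpret H: map_poly_comm_ring_hom h ..
  show ?thesis by (rule H.comm_ring_hom_axioms)
qed

text \<open>The polynomials on which the two maps agree modulo \<open>J\<close> form a subring, so
  constants and variables suffice.\<close>

lemma homs_congruent:
  fixes h1 h2 :: "'a::comm_ring_1 mpoly \<Rightarrow> 'b::comm_ring_1"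
  assumes h1: "comm_ring_hom h1" and h2: "comm_ring_hom h2" and J: "ideal_set J"
    and c: "\<And>c. h1 (Const c) - h2 (Const c) \<in> J" and v: "\<And>i. h1 (V i) - h2 (V i) \<in> J"
  shows "h1 P - h2 P \<in> J"
proof -
  interpret h1: comm_ring_hom h1 by fact
  interpret h2: comm_ring_hom h2 by fact
  interpret J: ideal_set J by fact
  define S where "S = {P. h1 P - h2 P \<in> J}"
  interpret S: subring_closed S
  proof
    show "0 \<in> S" "1 \<in> S" by (auto simp: S_def J.zero)
    fix a assume a: "a \<in> S"
    then show "- a \<in> S" using J.uminus[of "h1 a - h2 a"] by (simp add: S_def h1.hom_uminus h2.hom_uminus)
    fix b assume b: "b \<in> S"
    show "a + b \<in> S" using a b J.add[of "h1 a - h2 a" "h1 b - h2 b"]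
      by (simp add: S_def h1.hom_add h2.hom_add algebra_simps)
    have "h1 b * (h1 a - h2 a) + h2 a * (h1 b - h2 b) \<in> J"
      using a b by (intro J.add J.mult) (auto simp: S_def)
    then show "a * b \<in> S" by (simp add: S_def h1.hom_mult h2.hom_mult algebra_simps)
  qed
  have "ev Const V P \<in> S" by (rule S.ev_closed) (auto simp: S_def c v)
  then show ?thesis by (simp add: ev_Const_V S_def)
qed

text \<open>This allows a multiplication matrix over the integers to be read as one over the complex
  numbers, for the perturbations \<open>cmap (f i)\<close>.\<close>

lemma map_cmap_sig:
  "map_poly cmap (sig n D f q) = sig n D (\<lambda>i. cmap (f i)) (map_poly cmap q)"
proof -
  interpret c: comm_ring_hom cmap by (rule cmap_hom)
  interpret C: comm_ring_hom "map_poly cmap" by (rule map_poly_hom[OF cmap_hom])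
  have pc1: "map_poly cmap [:a:] = [:cmap a:]" for a
    by (simp add: poly_eq_iff coeff_map_poly coeff_pCons split: nat.split)
  have pc2: "map_poly cmap [:a, b:] = [:cmap a, cmap b:]" for a b
    by (simp add: poly_eq_iff coeff_map_poly coeff_pCons split: nat.split)
  have Y: "map_poly cmap (Y n D f i) = Y n D (\<lambda>i. cmap (f i)) i" for i
    unfolding Y_def by (simp only: if_distrib[of "map_poly cmap"] pc1 pc2 c.hom_power cmap_V)
  have tz: "map_poly cmap tz = tz" by (simp only: pc2 c.hom_zero c.hom_one)
  have phi: "map_poly cmap (phi n D f P) = phi n D (\<lambda>i. cmap (f i)) (cmap P)" for P
  proof -
    have "map_poly cmap (phi n D f P) = ev (\<lambda>c. map_poly cmap (TConst c)) (\<lambda>i. map_poly cmap (Y n D f i)) P"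
      unfolding phi_def by (rule ev_hom_comp) (rule C.comm_ring_hom_axioms)
    also have "\<dots> = ev (\<lambda>c. phi n D (\<lambda>i. cmap (f i)) (cmap (Const c))) (\<lambda>i. phi n D (\<lambda>i. cmap (f i)) (cmap (V i))) P"
      by (simp only: Y cmap_Const cmap_V phi_V phi_Const pc1)
    also have "\<dots> = phi n D (\<lambda>i. cmap (f i)) (ev (\<lambda>c. cmap (Const c)) (\<lambda>i. cmap (V i)) P)"
      by (rule ev_hom_comp[symmetric]) (rule phi_hom)
    also have "ev (\<lambda>c. cmap (Const c)) (\<lambda>i. cmap (V i)) P = cmap P"
      by (rule hom_eq_ev[symmetric]) (rule cmap_hom)
    finally show ?thesis .
  qed
  let ?K = "Polynomial.degree q"
  have "map_poly cmap (sig n D f q) = (\<Sum>j\<le>?K. phi n D (\<lambda>i. cmap (f i)) (cmap (Polynomial.coeff q j)) * tz ^ j)"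
    by (subst sig_altdef[of q ?K]) (simp_all add: C.hom_sum C.hom_mult C.hom_power phi tz)
  also have "\<dots> = sig n D (\<lambda>i. cmap (f i)) (map_poly cmap q)"
    by (subst sig_altdef[of "map_poly cmap q" ?K]) (auto simp: coeff_map_poly degree_map_poly_le)
  finally show ?thesis .
qed

section \<open>Multiplication matrices and their determinants\<close>

definition mult_matrix ::
  "nat \<Rightarrow> nat \<Rightarrow> (nat \<Rightarrow> 'a::comm_ring_1 mpoly) \<Rightarrow> nat \<Rightarrow> (nat \<Rightarrow> (nat \<Rightarrow>\<^sub>0 nat)) \<Rightarrow> 'a mpoly poly mat \<Rightarrow> 'a mpoly poly \<Rightarrow> bool" where
  "mult_matrix n D f N \<beta> M t \<longleftrightarrow> M \<in> carrier_mat N N \<and>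
     (\<forall>i<N. t * xm (\<beta> i) = (\<Sum>j<N. sig n D f (M $$ (i, j)) * xm (\<beta> j)))"

text \<open>Row \<open>i\<close> holds the coordinates of a multiple of
  \<open>xm (\<beta> i)\<close>, read through \<open>sig\<close>; this convention explains the order
  of the factors.\<close>

lemma mult_matrix_mult:
  assumes s: "mult_matrix n D f N \<beta> M' s" and t: "mult_matrix n D f N \<beta> M t"
  shows "mult_matrix n D f N \<beta> (M' * M) (t * s)"
proof -
  interpret sig: comm_ring_hom "sig n D f" by (rule sig_hom)
  have M: "M \<in> carrier_mat N N" "M' \<in> carrier_mat N N" using s t by (auto simp: mult_matrix_def)
  have "t * s * xm (\<beta> i) = (\<Sum>k<N. sig n D f ((M' * M) $$ (i, k)) * xm (\<beta> k))" if i: "i < N" for i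
  proof -
    have "t * s * xm (\<beta> i) = t * (s * xm (\<beta> i))" by (simp only: mult.assoc)
    also have "\<dots> = t * (\<Sum>j<N. sig n D f (M' $$ (i, j)) * xm (\<beta> j))"
      using s i by (simp only: mult_matrix_def)
    also have "\<dots> = (\<Sum>j<N. sig n D f (M' $$ (i, j)) * (t * xm (\<beta> j)))"
      unfolding sum_distrib_left by (intro sum.cong refl) (simp only: ac_simps)
    also have "\<dots> = (\<Sum>j<N. sig n D f (M' $$ (i, j)) * (\<Sum>k<N. sig n D f (M $$ (j, k)) * xm (\<beta> k)))"
      using t by (intro sum.cong refl) (simp only: mult_matrix_def lessThan_iff)
    also have "\<dots> = (\<Sum>j<N. \<Sum>k<N. sig n D f (M' $$ (i, j) * M $$ (j, k)) * xm (\<beta> k))"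
      unfolding sum_distrib_left sig.hom_mult by (intro sum.cong refl) (simp only: ac_simps)
    also have "\<dots> = (\<Sum>k<N. \<Sum>j<N. sig n D f (M' $$ (i, j) * M $$ (j, k)) * xm (\<beta> k))" by (rule sum.swap)
    also have "\<dots> = (\<Sum>k<N. sig n D f ((M' * M) $$ (i, k)) * xm (\<beta> k))"
    proof (rule sum.cong[OF refl])
      fix k assume "k \<in> {..<N}"
      then have "(M' * M) $$ (i, k) = (\<Sum>j<N. M' $$ (i, j) * M $$ (j, k))"
        using M i by (simp add: scalar_prod_def lessThan_atLeast0)
      then show "(\<Sum>j<N. sig n D f (M' $$ (i, j) * M $$ (j, k)) * xm (\<beta> k)) = sig n D f ((M' * M) $$ (i, k)) * xm (\<beta> k)"
        by (simp only: sig.hom_sum sum_distrib_right)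
    qed
    finally show ?thesis .
  qed
  then show ?thesis using M by (simp add: mult_matrix_def)
qed

lemma mult_matrix_scalar: "mult_matrix n D f N \<beta> (q \<cdot>\<^sub>m 1\<^sub>m N) (sig n D f q)"
proof -
  interpret sig: comm_ring_hom "sig n D f" by (rule sig_hom)
  have "(\<Sum>j<N. sig n D f ((q \<cdot>\<^sub>m 1\<^sub>m N) $$ (i, j)) * xm (\<beta> j)) = (\<Sum>j<N. if j = i then sig n D f q * xm (\<beta> i) else 0)"
    if "i < N" for i
    using that by (intro sum.cong refl) auto
  then show ?thesis by (simp add: mult_matrix_def)
qed

lemma mult_matrix_unique:
  assumes f: "\<And>i. i \<in> {1..n} \<Longrightarrow> f i \<in> bdeg UNIV D" and \<beta>: "bij_betw \<beta> {..<N} (Box n D)"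
    and M: "mult_matrix n D f N \<beta> M t" and M': "mult_matrix n D f N \<beta> M' t"
  shows "M = M'"
proof (rule eq_matI)
  interpret sig: comm_ring_hom "sig n D f" by (rule sig_hom)
  have c: "M \<in> carrier_mat N N" "M' \<in> carrier_mat N N" using M M' by (auto simp: mult_matrix_def)
  then show "dim_row M = dim_row M'" "dim_col M = dim_col M'" by auto
  fix i j assume "i < dim_row M'" "j < dim_col M'"
  then have ij: "i < N" "j < N" using c by auto
  define \<gamma> where "\<gamma> = the_inv_into {..<N} \<beta>"
  have g: "\<gamma> (\<beta> k) = k" if "k < N" for k
    using \<beta> that unfolding \<gamma>_def bij_betw_def by (simp add: the_inv_into_f_f)
  have "(\<Sum>b\<in>Box n D. sig n D f (M $$ (i, \<gamma> b) - M' $$ (i, \<gamma> b)) * xm b)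
      = (\<Sum>k<N. sig n D f (M $$ (i, \<gamma> (\<beta> k)) - M' $$ (i, \<gamma> (\<beta> k))) * xm (\<beta> k))"
    by (rule sum.reindex_bij_betw[OF \<beta>, symmetric])
  also have "\<dots> = (\<Sum>k<N. sig n D f (M $$ (i, k)) * xm (\<beta> k) - sig n D f (M' $$ (i, k)) * xm (\<beta> k))"
    by (intro sum.cong refl) (simp only: g lessThan_iff sig.hom_minus left_diff_distrib)
  also have "\<dots> = (\<Sum>k<N. sig n D f (M $$ (i, k)) * xm (\<beta> k)) - (\<Sum>k<N. sig n D f (M' $$ (i, k)) * xm (\<beta> k))"
    by (rule sum_subtractf)
  also have "(\<Sum>k<N. sig n D f (M $$ (i, k)) * xm (\<beta> k)) = t * xm (\<beta> i)"
    using M ij(1) by (simp only: mult_matrix_def)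
  also have "(\<Sum>k<N. sig n D f (M' $$ (i, k)) * xm (\<beta> k)) = t * xm (\<beta> i)"
    using M' ij(1) by (simp only: mult_matrix_def)
  finally have "(\<Sum>b\<in>Box n D. sig n D f (M $$ (i, \<gamma> b) - M' $$ (i, \<gamma> b)) * xm b) = 0" by simp
  from normal_form_unique[OF f this] have "M $$ (i, \<gamma> (\<beta> j)) - M' $$ (i, \<gamma> (\<beta> j)) = 0"
    using \<beta> ij(2) by (auto simp: bij_betw_def)
  then show "M $$ (i, j) = M' $$ (i, j)" using g[OF ij(2)] by simp
qed

lemma (in deformation) ex_mult_matrix:
  assumes \<beta>: "bij_betw \<beta> {..<N} (Box n D)" and t: "\<And>i. i < N \<Longrightarrow> normal_form (t * xm (\<beta> i)) r"
  shows "\<exists>M. mult_matrix n D f N \<beta> M t \<and> (\<forall>i<N. \<forall>j<N. pl1 (l1 \<nu>) (M $$ (i, j)) \<le> r)"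
proof -
  have "\<forall>i\<in>{..<N}. \<exists>c. t * xm (\<beta> i) = (\<Sum>b\<in>Box n D. \<sigma> (c b) * xm b) \<and> (\<Sum>b\<in>Box n D. pl1 (l1 \<nu>) (c b)) \<le> r"
    using t by (simp only: normal_form_def lessThan_iff) blast
  then obtain c where c: "\<And>i. i < N \<Longrightarrow> t * xm (\<beta> i) = (\<Sum>b\<in>Box n D. \<sigma> (c i b) * xm b)"
      "\<And>i. i < N \<Longrightarrow> (\<Sum>b\<in>Box n D. pl1 (l1 \<nu>) (c i b)) \<le> r"
    unfolding bchoice_iff by (auto simp del: mult_pCons_right)
  define M where "M = mat N N (\<lambda>(i, j). c i (\<beta> j))"
  have "t * xm (\<beta> i) = (\<Sum>j<N. \<sigma> (M $$ (i, j)) * xm (\<beta> j))" if "i < N" for i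
    unfolding c(1)[OF that] using that
    by (subst sum.reindex_bij_betw[OF \<beta>, symmetric], intro sum.cong refl) (simp add: M_def)
  moreover have "pl1 (l1 \<nu>) (M $$ (i, j)) \<le> r" if "i < N" "j < N" for i j
  proof -
    have "pl1 (l1 \<nu>) (c i (\<beta> j)) \<le> (\<Sum>b\<in>Box n D. pl1 (l1 \<nu>) (c i b))"
      by (rule member_le_sum) (use \<beta> that finite_Box in \<open>auto simp: bij_betw_def\<close>)
    then show ?thesis using c(2)[of i] that by (simp add: M_def)
  qed
  ultimately show ?thesis by (intro exI[of _ M]) (auto simp: mult_matrix_def M_def)
qed

text \<open>The Leibniz formula, with the number of permutations estimated by
  \<open>N ^ N\<close>.\<close>

lemma (in seminorm) nu_det:
  assumes A: "A \<in> carrier_mat N N" and r: "\<And>i j. i < N \<Longrightarrow> j < N \<Longrightarrow> \<nu> (A $$ (i, j)) \<le> r"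
  shows "\<nu> (det A) \<le> (real N * r) ^ N"
proof -
  have "\<nu> (signof p * (\<Prod>i = 0..<N. A $$ (i, p i))) \<le> r ^ N" if p: "p permutes {0..<N}" for p
  proof -
    have "\<nu> (\<Prod>i = 0..<N. A $$ (i, p i)) \<le> (\<Prod>i = 0..<N. \<nu> (A $$ (i, p i)))" by (rule nu_prod)
    also have "\<dots> \<le> (\<Prod>i = 0..<N. r)"
      using p by (intro prod_mono) (auto intro!: r simp: permutes_in_image)
    finally have "\<nu> (\<Prod>i = 0..<N. A $$ (i, p i)) \<le> r ^ N" by simp
    then show ?thesis by (cases p rule: sign_cases) simp_all
  qed
  then have "\<nu> (det A) \<le> (\<Sum>p | p permutes {0..<N}. r ^ N)"
    unfolding det_def'[OF A] by (intro order_trans[OF nu_sum] sum_mono) simp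
  also have "\<dots> = fact N * r ^ N" by (simp add: card_permutations)
  also have "\<dots> \<le> real N ^ N * r ^ N"
  proof (cases "N = 0")
    case False
    then have "0 \<le> r" using r[of 0 0] nu_nonneg[of "A $$ (0, 0)"] by linarith
    then show ?thesis using fact_le_power[of N, where 'a = real] by (intro mult_right_mono) auto
  qed simp
  finally show ?thesis by (simp add: power_mult_distrib)
qed

text \<open>Cramer's rule: the row of the adjugate that belongs to the basis element
  \<open>xm 0 = 1\<close> writes the determinant as a combination of the
  \<open>t * xm (\<beta> i)\<close>.\<close>

lemma sig_det_multiple:
  assumes \<beta>: "bij_betw \<beta> {..<N} (Box n D)" and M: "mult_matrix n D f N \<beta> M t"
  shows "\<exists>s. sig n D f (det M) = t * s"
proof -
  interpret sig: comm_ring_hom "sig n D f" by (rule sig_hom)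
  have carr: "M \<in> carrier_mat N N" using M by (auto simp: mult_matrix_def)
  note adj = adj_mat[OF carr]
  have "0 \<in> \<beta> ` {..<N}" using \<beta> by (simp add: bij_betw_def)
  then obtain k where k: "k < N" "\<beta> k = 0" by auto
  have "(\<Sum>i<N. sig n D f (adj_mat M $$ (k, i)) * (t * xm (\<beta> i)))
      = (\<Sum>i<N. sig n D f (adj_mat M $$ (k, i)) * (\<Sum>j<N. sig n D f (M $$ (i, j)) * xm (\<beta> j)))"
    using M by (intro sum.cong refl) (simp only: mult_matrix_def lessThan_iff)
  also have "\<dots> = (\<Sum>i<N. \<Sum>j<N. sig n D f (adj_mat M $$ (k, i) * M $$ (i, j)) * xm (\<beta> j))"
    unfolding sum_distrib_left sig.hom_mult by (intro sum.cong refl) (simp only: ac_simps)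
  also have "\<dots> = (\<Sum>j<N. \<Sum>i<N. sig n D f (adj_mat M $$ (k, i) * M $$ (i, j)) * xm (\<beta> j))" by (rule sum.swap)
  also have "\<dots> = (\<Sum>j<N. if j = k then sig n D f (det M) * xm (\<beta> k) else 0)"
  proof (rule sum.cong[OF refl])
    fix j assume j: "j \<in> {..<N}"
    then have "(\<Sum>i<N. adj_mat M $$ (k, i) * M $$ (i, j)) = (adj_mat M * M) $$ (k, j)"
      using adj(1) carr k by (simp add: scalar_prod_def lessThan_atLeast0)
    also have "\<dots> = (if j = k then det M else 0)" using j k by (simp add: adj(3))
    finally show "(\<Sum>i<N. sig n D f (adj_mat M $$ (k, i) * M $$ (i, j)) * xm (\<beta> j)) = (if j = k then sig n D f (det M) * xm (\<beta> k) else 0)"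
      by (simp only: sum_distrib_right[symmetric] sig.hom_sum[symmetric]) auto
  qed
  also have "\<dots> = sig n D f (det M) * xm (\<beta> k)" using k by simp
  also have "xm (\<beta> k) = 1" using k by (simp only: xm_0)
  finally have "sig n D f (det M) = (\<Sum>i<N. sig n D f (adj_mat M $$ (k, i)) * (t * xm (\<beta> i)))" by (simp only: mult_1_right)
  also have "\<dots> = t * (\<Sum>i<N. sig n D f (adj_mat M $$ (k, i)) * xm (\<beta> i))"
    unfolding sum_distrib_left by (intro sum.cong refl) (simp only: ac_simps)
  finally show ?thesis by blast
qed

text \<open>Compare the coefficients of \<open>z ^ degree G\<close>: modulo the \<open>f i\<close>, the element \<open>sig n D f [:P:]\<close> is free of \<open>z\<close>.\<close>

lemma lead_coeff_in_ideal:
  fixes f :: "nat \<Rightarrow> 'a::comm_ring_1 mpoly"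
  assumes J: "ideal_set J" and f: "\<And>i. f i \<in> J" and g: "g \<in> J"
    and eq: "sig n D f G = [:g:] * s" and lead: "Polynomial.lead_coeff G = Const B"
  shows "Const B \<in> J"
proof -
  interpret J: ideal_set J by fact
  define S where "S = {t :: 'a mpoly poly. \<forall>j>0. Polynomial.coeff t j \<in> J}"
  interpret S: subring_closed S
  proof
    fix a b assume ab: "a \<in> S" "b \<in> S"
    show "a + b \<in> S" using ab by (auto simp: S_def J.add)
    have "Polynomial.coeff (a * b) j \<in> J" if "j > 0" for j
      unfolding coeff_mult
    proof (rule J.sum)
      fix i assume "i \<in> {..j}"
      show "Polynomial.coeff a i * Polynomial.coeff b (j - i) \<in> J"
      proof (cases "i = 0")
        case True
        then show ?thesis using ab that by (auto simp: S_def intro: J.mult)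
      next
        case False
        then have "Polynomial.coeff b (j - i) * Polynomial.coeff a i \<in> J" using ab by (auto simp: S_def intro: J.mult)
        then show ?thesis by (simp only: mult.commute)
      qed
    qed
    then show "a * b \<in> S" by (simp add: S_def)
  qed (auto simp: S_def J.zero J.uminus)
  have phi: "phi n D f P \<in> S" for P
    unfolding phi_def
  proof (rule S.ev_closed)
    show "TConst c \<in> S" for c by (auto simp: S_def J.zero coeff_pCons split: nat.split)
    show "Y n D f i \<in> S" for i by (auto simp: S_def Y_def J.zero f coeff_pCons split: nat.split)
  qed
  let ?d = "Polynomial.degree G"
  have "Polynomial.coeff (sig n D f G) ?d = (\<Sum>j\<le>?d. Polynomial.coeff (phi n D f (Polynomial.coeff G j)) (?d - j))"
    unfolding sig_altdef[OF order_refl] coeff_sum by (intro sum.cong refl) (auto simp: coeff_tz_power_mult)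
  also have "\<dots> = (\<Sum>j<?d. Polynomial.coeff (phi n D f (Polynomial.coeff G j)) (?d - j)) + Const B"
    unfolding lessThan_Suc_atMost[symmetric] using lead by (simp add: phi_Const)
  finally have "Const B = Polynomial.coeff (sig n D f G) ?d - (\<Sum>j<?d. Polynomial.coeff (phi n D f (Polynomial.coeff G j)) (?d - j))"
    by simp
  also have "\<dots> \<in> J"
  proof (intro J.diff J.sum)
    show "Polynomial.coeff (sig n D f G) ?d \<in> J"
      unfolding eq using J.mult[OF g, of "Polynomial.coeff s ?d"] by (simp add: mult.commute)
    show "Polynomial.coeff (phi n D f (Polynomial.coeff G j)) (?d - j) \<in> J" if "j \<in> {..<?d}" for j
      using phi[of "Polynomial.coeff G j"] that by (auto simp: S_def)
  qed
  finally show ?thesis .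
qed

lemma ideal_set_multiples: "ideal_set {t * s | s. True}" for t :: "'a::comm_ring_1"
proof
  show "0 \<in> {t * s | s. True}" by (auto intro!: exI[of _ 0])
  show "a + b \<in> {t * s | s. True}" if "a \<in> {t * s | s. True}" "b \<in> {t * s | s. True}" for a b
    using that by (auto simp flip: distrib_left)
  show "a * b \<in> {t * s | s. True}" if b: "b \<in> {t * s | s. True}" for a b
  proof -
    obtain s where "b = t * s" using b by blast
    then have "a * b = t * (a * s)" by (simp only: ac_simps)
    then show ?thesis by blast
  qed
qed

lemma subring_closed_range:
  fixes h :: "'a::comm_ring_1 \<Rightarrow> 'b::comm_ring_1"
  assumes "comm_ring_hom h"
  shows "subring_closed (range h)"
proof -
  interpret comm_ring_hom h by fact
  show ?thesis
  proof
    show "0 \<in> range h" by (rule range_eqI[where x = 0]) simp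
    show "1 \<in> range h" by (rule range_eqI[where x = 1]) simp
    fix a b assume "a \<in> range h" "b \<in> range h"
    then obtain x y where xy: "a = h x" "b = h y" by blast
    show "a + b \<in> range h" by (rule range_eqI[where x = "x + y"]) (simp add: xy hom_add)
    show "a * b \<in> range h" by (rule range_eqI[where x = "x * y"]) (simp add: xy hom_mult)
  next
    fix a assume "a \<in> range h"
    then obtain x where "a = h x" by blast
    then show "- a \<in> range h" by (intro range_eqI[where x = "- x"]) (simp add: hom_uminus)
  qed
qed

text \<open>
  An equation for \<open>z\<close> over the algebra generated by \<open>z * g\<close> and the \<open>Y i\<close> yields, on setting \<open>z * g\<close> to zero,
  a monic polynomial in \<open>z\<close> over the algebra of the \<open>Y i\<close> which is a multiple of \<open>g\<close>.
\<close>

lemma ex_monic_multiple: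
  fixes f :: "nat \<Rightarrow> complex mpoly"
  assumes integral: "\<And>S. subring_closed S \<Longrightarrow> range TConst \<subseteq> S \<Longrightarrow> tz * [:g:] \<in> S \<Longrightarrow>
      (\<And>i. i \<in> {1..n} \<Longrightarrow> Y n D f i \<in> S) \<Longrightarrow> integral_over S tz"
  shows "\<exists>q0 s. Polynomial.lead_coeff q0 = 1 \<and> sig n D f q0 = [:g:] * s"
proof -
  \<comment> \<open>Index \<open>0\<close> lies outside \<open>{1..n}\<close> and serves as a name
    for \<open>z * g\<close>; \<open>rd\<close> sets it to zero.\<close>
  define W where "W i = (if i = 0 then tz * [:g:] else Y n D f i)" for i :: nat
  define \<phi>' where "\<phi>' = ev TConst W"
  define rd where "rd = ev Const (\<lambda>i. if i = 0 then 0 else V i :: complex mpoly)"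
  interpret \<phi>': comm_ring_hom \<phi>' unfolding \<phi>'_def by (rule ev_hom[OF TConst_hom])
  interpret rd: comm_ring_hom rd unfolding rd_def by (rule ev_hom[OF Const_hom])
  interpret p: comm_ring_hom "phi n D f" by (rule phi_hom)
  interpret sig: comm_ring_hom "sig n D f" by (rule sig_hom)
  have S: "subring_closed (range \<phi>')"
    by (rule subring_closed_range) (rule \<phi>'.comm_ring_hom_axioms)
  have V: "\<phi>' (V i) = W i" and C: "\<phi>' (Const c) = TConst c" for i c
    unfolding \<phi>'_def by (rule ev_V[OF TConst_hom], rule ev_Const[OF TConst_hom])
  have "integral_over (range \<phi>') tz"
  proof (rule integral[OF S])
    show "range TConst \<subseteq> range \<phi>'"
      by (rule image_subsetI, subst C[symmetric], rule rangeI)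
    have W: "W i \<in> range \<phi>'" for i
      by (subst V[symmetric], rule rangeI)
    show "tz * [:g:] \<in> range \<phi>'" using W[of 0] by (simp only: W_def simp_thms if_True)
    show "Y n D f i \<in> range \<phi>'" if "i \<in> {1..n}" for i using W[of i] that by (simp add: W_def split: if_splits)
  qed
  then obtain p where p: "Polynomial.lead_coeff p = 1" "\<And>j. Polynomial.coeff p j \<in> range \<phi>'" "poly p tz = 0"
    by (auto simp: integral_over_def)
  define q where "q j = inv_into UNIV \<phi>' (Polynomial.coeff p j)" for j
  have q: "Polynomial.coeff p j = \<phi>' (q j)" for j
    unfolding q_def by (rule sym, rule f_inv_into_f, rule p(2))
  define d where "d = Polynomial.degree p"
  \<comment> \<open>The top coefficient is set to \<open>1\<close> outright, because
    \<open>q d\<close> is merely some preimage of \<open>1\<close> under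
    \<open>\<phi>'\<close>.\<close>
  define q0 where "q0 = Polynomial.monom 1 d + (\<Sum>j<d. Polynomial.monom (rd (q j)) j)"
  let ?J = "{[:g:] * s | s. True}"
  have J: "ideal_set ?J" by (rule ideal_set_multiples)
  interpret J: ideal_set ?J by (rule J)
  have congr: "\<phi>' P - phi n D f (rd P) \<in> ?J" for P
  proof (rule homs_congruent[where ?h1.0 = \<phi>' and ?h2.0 = "\<lambda>P. phi n D f (rd P)", OF \<phi>'.comm_ring_hom_axioms _ J])
    show "comm_ring_hom (\<lambda>P. phi n D f (rd P))"
      by unfold_locales (auto simp: rd.hom_add rd.hom_mult p.hom_add p.hom_mult)
    have "rd (Const c) = Const c" for c unfolding rd_def by (rule ev_Const[OF Const_hom])
    then show "\<phi>' (Const c) - phi n D f (rd (Const c)) \<in> ?J" for c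
      using J.zero by (simp only: C phi_Const diff_self)
    have rdV: "rd (V i) = (if i = 0 then 0 else V i)" for i unfolding rd_def by (rule ev_V[OF Const_hom])
    show "\<phi>' (V i) - phi n D f (rd (V i)) \<in> ?J" for i
    proof (cases "i = 0")
      case True
      have "\<phi>' (V i) = [:g:] * tz" using True by (simp add: V W_def)
      moreover have "phi n D f (rd (V i)) = 0" using True by (simp add: rdV)
      ultimately show ?thesis by (simp only: diff_zero) blast
    next
      case False
      have "phi n D f (rd (V i)) = \<phi>' (V i)" using False by (simp add: rdV V W_def phi_V)
      then show ?thesis by (simp only: diff_self J.zero)
    qed
  qed
  have "Polynomial.coeff q0 d = 1"
    by (simp add: q0_def coeff_sum)
  moreover have "Polynomial.degree q0 \<le> d"
    unfolding q0_def by (intro degree_add_le degree_sum_le) (auto intro: order_trans[OF degree_monom_le])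
  ultimately have "Polynomial.lead_coeff q0 = 1"
    using le_degree[of q0 d] by auto
  have "0 = (\<Sum>j\<le>d. Polynomial.coeff p j * tz ^ j)" using p(3) by (simp add: poly_altdef d_def)
  also have "\<dots> = (\<Sum>j<d. \<phi>' (q j) * tz ^ j) + tz ^ d"
    unfolding lessThan_Suc_atMost[symmetric] using p(1) by (simp add: d_def q)
  finally have z: "(\<Sum>j<d. \<phi>' (q j) * tz ^ j) + tz ^ d = 0" by simp
  have "sig n D f (Polynomial.monom P j) = phi n D f P * tz ^ j" for P j
  proof -
    have "Polynomial.monom P j = [:P:] * tz ^ j" by (simp add: monom_altdef)
    then show ?thesis by (simp only: sig.hom_mult sig.hom_power sig_const sig_tz)
  qed
  then have "sig n D f q0 = tz ^ d + (\<Sum>j<d. phi n D f (rd (q j)) * tz ^ j)"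
    by (simp add: q0_def sig.hom_add sig.hom_sum)
  also have "\<dots> = - (\<Sum>j<d. tz ^ j * (\<phi>' (q j) - phi n D f (rd (q j))))"
  proof -
    have "(\<Sum>j<d. tz ^ j * (\<phi>' (q j) - phi n D f (rd (q j))))
        = (\<Sum>j<d. \<phi>' (q j) * tz ^ j) - (\<Sum>j<d. phi n D f (rd (q j)) * tz ^ j)"
      unfolding sum_subtractf[symmetric] by (intro sum.cong refl) (simp only: right_diff_distrib mult.commute)
    moreover have "tz ^ d = - (\<Sum>j<d. \<phi>' (q j) * tz ^ j)"
      using z by (simp only: eq_neg_iff_add_eq_0 add.commute)
    ultimately show ?thesis by (simp only: minus_diff_eq uminus_add_conv_diff)
  qed
  also have "\<dots> \<in> ?J" by (intro J.uminus J.sum J.mult congr)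
  finally show ?thesis using \<open>Polynomial.lead_coeff q0 = 1\<close> by blast
qed

section \<open>An arithmetic Nullstellensatz\<close>

text \<open>
  The bound of a determinant of size \<open>(D + 1) ^ n\<close>. Its entries come from the normal forms of the products
  \<open>g * xm b\<close>, where \<open>H1\<close> bounds the norms of \<open>g\<close> and of the perturbations in the \<open>Y i\<close>.
\<close>

definition null_bound :: "nat \<Rightarrow> nat \<Rightarrow> nat \<Rightarrow> real \<Rightarrow> real" where
  "null_bound n k D H =
     (let H1 = real k * real (noether_bound n (D + 1)) * H + 1
      in (real ((D + 1) ^ n) * (H1 * (1 + H1) ^ (D + n * D))) ^ ((D + 1) ^ n))"

text \<open>What enters the bound is integral: the matrix of multiplication by \<open>g\<close> and
  its determinant \<open>G\<close>. The complex numbers provide the shifts \<open>a\<close>, and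
  they show that the leading coefficient of \<open>G\<close> in \<open>z\<close> is a nonzero
  constant, by a divisibility whose cofactor is never estimated.\<close>

theorem arithmetic_nullstellensatz:
  fixes f :: "nat \<Rightarrow> int mpoly"
  assumes f: "\<And>s. s < k \<Longrightarrow> f s \<in> bdeg {1..n} D" and H: "\<And>s. s < k \<Longrightarrow> l1 iabs (f s) \<le> H" "0 \<le> H"
    and no_zero: "\<And>w :: nat \<Rightarrow> complex. \<exists>s<k. ev of_int w (f s) \<noteq> 0"
  shows "\<exists>B. B \<noteq> 0 \<and> Const B \<in> idl {..<k} f \<and> iabs B \<le> null_bound n k D H"
proof -
  interpret int: seminorm iabs by (rule seminorm_int)
  interpret intL: seminorm "l1 iabs :: int mpoly \<Rightarrow> real" by (rule int.seminorm_l1)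
  interpret intS: seminorm "pl1 (l1 iabs :: int mpoly \<Rightarrow> real)" by (rule intL.seminorm_pl1)
  interpret cm: comm_ring_hom cmap by (rule cmap_hom)
  interpret CM: comm_ring_hom "map_poly cmap" by (rule map_poly_hom[OF cmap_hom])
  define K where "K = noether_bound n (D + 1)"
  define H1 where "H1 = real k * real K * H + 1"
  have H1: "H1 \<ge> 1" using H(2) by (simp add: H1_def)
  have "1 \<in> idl {..<k} (\<lambda>s. cmap (f s))"
  proof (rule weak_nullstellensatz)
    fix w :: "nat \<Rightarrow> complex"
    show "\<exists>s\<in>{..<k}. evc w (cmap (f s)) \<noteq> 0" using no_zero[of w] by (auto simp: evc_cmap)
  qed simp
  from z_integral[where f = "\<lambda>s. cmap (f s)", OF cmap_bdeg[OF f] this]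
  obtain a where a: "\<And>s i. a s i \<le> K" and integral: "\<And>S. subring_closed S \<Longrightarrow> range TConst \<subseteq> S \<Longrightarrow>
     (\<And>i. i \<le> n \<Longrightarrow> (if i = 0 then 0 else [:V i ^ (D + 1):]) - (\<Sum>s<k. of_nat (a s i) * (tz * [:cmap (f s):])) \<in> S) \<Longrightarrow>
     integral_over S tz"
    unfolding K_def by blast
  \<comment> \<open>With this sign the shifted elements of \<open>z_integral\<close> become
    \<open>Y i\<close> for positive \<open>i\<close> and \<open>z * g\<close> for
    \<open>i = 0\<close>.\<close>
  define ft where "ft i = - (\<Sum>s<k. of_nat (a s i) * f s)" for i
  define g where "g = ft 0"
  define ftc where "ftc i = cmap (ft i)" for i
  have ft_deg: "ft i \<in> bdeg {1..n} D" for i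
  proof -
    have "of_nat c \<in> (bdeg {1..n} 0 :: int mpoly set)" for c
      using bdeg_Const[of "of_nat c :: int"] by (simp only: single_of_nat)
    then have "of_nat (a s i) * f s \<in> bdeg {1..n} (0 + D)" if "s < k" for s
      using f[OF that] by (rule bdeg_mult)
    then show ?thesis unfolding ft_def by (intro bdeg_uminus bdeg_sum) simp
  qed
  have ft_norm: "l1 iabs (ft i) \<le> H1" for i
  proof -
    have "l1 iabs (of_nat (a s i) * f s) \<le> real K * H" if "s < k" for s
    proof -
      have "l1 iabs (of_nat (a s i) :: int mpoly) = l1 iabs (Const (of_nat (a s i) :: int) :: int mpoly)"
        by (simp only: single_of_nat)
      also have "\<dots> \<le> real K" using a[of s i] by (simp only: int.l1_single)
      finally show ?thesis
        using H(1)[OF that] by (intro order_trans[OF intL.nu_mult] mult_mono) auto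
    qed
    then have "l1 iabs (ft i) \<le> (\<Sum>s<k. real K * H)"
      unfolding ft_def intL.nu_uminus by (intro order_trans[OF intL.nu_sum] sum_mono) simp
    then show ?thesis by (simp add: H1_def)
  qed
  have ft_degU: "ft i \<in> bdeg UNIV D" for i using ft_deg[of i] by (rule bdeg_mono) auto
  interpret Z: deformation iabs n D ft H1
    by unfold_locales (use ft_degU ft_norm H1 in auto)
  define N where "N = card (Box n D)"
  obtain \<beta> where \<beta>: "bij_betw \<beta> {..<N} (Box n D)"
    using ex_bij_betw_nat_finite[OF finite_Box, of n D] by (auto simp: N_def lessThan_atLeast0)
  have "Box n D \<noteq> {}" using zero_in_Box by blast
  then have N0: "N > 0" using finite_Box[of n D] by (simp add: N_def card_gt_0_iff)
  have NN: "N \<le> (D + 1) ^ n" unfolding N_def by (rule card_Box)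
  \<comment> \<open>A product of \<open>g\<close> with a basis monomial has degree at most
    \<open>D + n * D\<close> and norm at most \<open>H1\<close>; each degree costs a factor
    \<open>1 + H1\<close> in the normal form.\<close>
  define r where "r = H1 * (1 + H1) ^ (D + n * D)"
  have r1: "r \<ge> 1" unfolding r_def using H1 by (intro mult_ge1_I one_le_power) auto
  have "Z.normal_form ([:g:] * xm (\<beta> i)) r" if "i < N" for i
  proof -
    have "\<beta> i \<in> Box n D" using \<beta> that by (auto simp: bij_betw_def)
    then have "Poly_Mapping.single (\<beta> i) 1 \<in> bdeg UNIV (n * D)"
      using Box_subset[of n D] by (auto simp: bdeg_def)
    then have P: "g * Poly_Mapping.single (\<beta> i) 1 \<in> bdeg UNIV (D + n * D)"
      unfolding g_def by (intro bdeg_mult ft_degU)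
    have "l1 iabs (g * Poly_Mapping.single (\<beta> i) 1) \<le> H1 * 1"
      unfolding g_def using ft_norm[of 0] H1 by (intro order_trans[OF intL.nu_mult] mult_mono) (auto simp: int.l1_single)
    then have "l1 iabs (g * Poly_Mapping.single (\<beta> i) 1) * (1 + H1) ^ (D + n * D) \<le> r"
      unfolding r_def using H1 by (intro mult_right_mono) auto
    from Z.normal_form_mono[OF Z.normal_form_poly[OF P] this] show ?thesis by (simp add: mult.commute)
  qed
  from Z.ex_mult_matrix[OF \<beta> this] obtain M where M: "mult_matrix n D ft N \<beta> M [:g:]"
    and Mr: "\<And>i j. i < N \<Longrightarrow> j < N \<Longrightarrow> pl1 (l1 iabs) (M $$ (i, j)) \<le> r" by blast
  have Mc: "M \<in> carrier_mat N N" using M by (simp add: mult_matrix_def)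
  define G where "G = det M"
  have "pl1 (l1 iabs) G \<le> (real N * r) ^ N"
    unfolding G_def by (rule intS.nu_det[OF Mc Mr])
  also have "\<dots> \<le> (real ((D + 1) ^ n) * r) ^ N"
    using NN r1 by (intro power_mono mult_right_mono) (auto simp flip: of_nat_power of_nat_Suc simp del: of_nat_Suc)
  also have "\<dots> \<le> (real ((D + 1) ^ n) * r) ^ ((D + 1) ^ n)"
    using NN N0 r1 by (intro power_increasing mult_ge1_I) auto
  also have "\<dots> = null_bound n k D H"
    by (simp add: null_bound_def r_def H1_def K_def Let_def)
  finally have bound: "pl1 (l1 iabs) G \<le> null_bound n k D H" .

  define gc where "gc = cmap g"
  have natc: "cmap (of_nat c) = of_nat c" for c by (rule cm.hom_of_nat)
  have ftc: "ftc i = - (\<Sum>s<k. of_nat (a s i) * cmap (f s))" for i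
    by (simp add: ftc_def ft_def cm.hom_uminus cm.hom_sum cm.hom_mult natc)
  have ftc_degU: "ftc i \<in> bdeg UNIV D" for i unfolding ftc_def by (rule cmap_bdeg[OF ft_degU])
  have "\<exists>Q s. Polynomial.lead_coeff Q = 1 \<and> sig n D ftc Q = [:gc:] * s"
  proof (rule ex_monic_multiple)
    fix S assume S: "subring_closed S" "range TConst \<subseteq> S" "tz * [:gc:] \<in> S" "\<And>i. i \<in> {1..n} \<Longrightarrow> Y n D ftc i \<in> S"
    have sum: "(\<Sum>s<k. of_nat (a s i) * (tz * [:cmap (f s):])) = [:0, - ftc i:]" for i
    proof -
      have "(\<Sum>s<k. of_nat (a s i) * (tz * [:cmap (f s):])) = (\<Sum>s<k. [:0, of_nat (a s i) * cmap (f s):])"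
        by (intro sum.cong refl) (simp add: of_nat_poly mult.commute)
      also have "\<dots> = [:0, \<Sum>s<k. of_nat (a s i) * cmap (f s):]"
        by (induction k) auto
      finally show ?thesis by (simp add: ftc)
    qed
    show "integral_over S tz"
    proof (rule integral[OF S(1,2)])
      fix i assume i: "i \<le> n"
      show "(if i = 0 then 0 else [:V i ^ (D + 1):]) - (\<Sum>s<k. of_nat (a s i) * (tz * [:cmap (f s):])) \<in> S"
      proof (cases "i = 0")
        case True
        then show ?thesis using S(3) unfolding sum by (simp add: gc_def g_def ftc_def)
      next
        case False
        then show ?thesis using S(4)[of i] i unfolding sum by (simp add: Y_def)
      qed
    qed
  qed
  then obtain Q s where Q: "Polynomial.lead_coeff Q = 1" "sig n D ftc Q = [:gc:] * s" by blast
  \<comment> \<open>Over the complex numbers only the existence of a matrix for \<open>s\<close> is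
    wanted, so any bound on the perturbations will do.\<close>
  define Hc where "Hc = (\<Sum>i\<in>{1..n}. l1 cmod (ftc i))"
  interpret cn: seminorm cmod by (rule seminorm_complex)
  interpret C: deformation cmod n D ftc Hc
  proof unfold_locales
    show "l1 cmod (ftc i) \<le> Hc" if "i \<in> {1..n}" for i
      unfolding Hc_def using that by (intro member_le_sum) (auto simp: cn.l1_nonneg)
    show "0 \<le> Hc" unfolding Hc_def by (intro sum_nonneg) (auto simp: cn.l1_nonneg)
  qed (rule ftc_degU)
  have "\<exists>R. \<forall>i<N. C.normal_form (s * xm (\<beta> i)) R"
  proof -
    have "\<forall>i. \<exists>R. C.normal_form (s * xm (\<beta> i)) R" using C.ex_normal_form by blast
    then obtain R where R: "\<And>i. C.normal_form (s * xm (\<beta> i)) (R i)" by metis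
    show ?thesis
    proof (intro exI allI impI)
      fix i assume "i < N"
      show "C.normal_form (s * xm (\<beta> i)) (\<Sum>i<N. \<bar>R i\<bar>)"
        by (rule C.normal_form_mono[OF R], rule order_trans[OF abs_ge_self], rule member_le_sum)
          (use \<open>i < N\<close> in auto)
    qed
  qed
  then obtain R where "\<And>i. i < N \<Longrightarrow> C.normal_form (s * xm (\<beta> i)) R" by blast
  from C.ex_mult_matrix[OF \<beta> this] obtain Ms where Ms: "mult_matrix n D ftc N \<beta> Ms s" by blast
  have Mgc: "mult_matrix n D ftc N \<beta> (map_mat (map_poly cmap) M) [:gc:]"
    unfolding mult_matrix_def
  proof (intro conjI allI impI)
    show "map_mat (map_poly cmap) M \<in> carrier_mat N N" using Mc by simp
    have pc1: "map_poly cmap [:P:] = [:cmap P:]" for P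
      by (simp add: poly_eq_iff coeff_map_poly coeff_pCons split: nat.split)
    have xm: "map_poly cmap (xm m) = xm m" for m by (simp only: pc1 cmap_single)
    fix i assume i: "i < N"
    have "[:gc:] * xm (\<beta> i) = map_poly cmap ([:g:] * xm (\<beta> i))"
      by (simp only: CM.hom_mult pc1 xm gc_def cmap_single)
    also have "[:g:] * xm (\<beta> i) = (\<Sum>j<N. sig n D ft (M $$ (i, j)) * xm (\<beta> j))"
      using M i by (simp only: mult_matrix_def)
    also have "map_poly cmap \<dots> = (\<Sum>j<N. sig n D ftc (map_poly cmap (M $$ (i, j))) * xm (\<beta> j))"
      by (simp only: CM.hom_sum CM.hom_mult xm map_cmap_sig ftc_def[abs_def])
    also have "\<dots> = (\<Sum>j<N. sig n D ftc (map_mat (map_poly cmap) M $$ (i, j)) * xm (\<beta> j))"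
      using Mc i by (intro sum.cong refl) simp
    finally show "[:gc:] * xm (\<beta> i) = (\<Sum>j<N. sig n D ftc (map_mat (map_poly cmap) M $$ (i, j)) * xm (\<beta> j))" .
  qed
  \<comment> \<open>Both sides describe multiplication by \<open>gc * s\<close>, the image of the
    monic \<open>Q\<close>; uniqueness of normal forms makes them equal.\<close>
  have "Ms * map_mat (map_poly cmap) M = Q \<cdot>\<^sub>m 1\<^sub>m N"
    by (rule mult_matrix_unique[OF ftc_degU \<beta> mult_matrix_mult[OF Ms Mgc]])
      (use mult_matrix_scalar[of n D ftc N \<beta> Q] in \<open>simp only: Q(2)\<close>)
  then have "det Ms * det (map_mat (map_poly cmap) M) = det (Q \<cdot>\<^sub>m 1\<^sub>m N)"
    using det_mult[of Ms N "map_mat (map_poly cmap) M"] Ms Mgc by (simp add: mult_matrix_def)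
  also have "\<dots> = Q ^ N" by simp
  finally have "det Ms * map_poly cmap G = Q ^ N" by (simp add: G_def CM.hom_det)
  \<comment> \<open>Since \<open>Q ^ N\<close> is monic, the leading coefficients of the two
    determinants are inverse to each other.\<close>
  then have "Polynomial.lead_coeff (det Ms) * Polynomial.lead_coeff (map_poly cmap G) = 1"
    using Q(1) by (metis lead_coeff_mult lead_coeff_power power_one)
  then have "Polynomial.lead_coeff (map_poly cmap G) * Polynomial.lead_coeff (det Ms) = 1" by (simp add: mult.commute)
  from mpoly_unit_Const[OF this] obtain b where b: "Polynomial.lead_coeff (map_poly cmap G) = Const b" by blast
  have "b \<noteq> 0" using b \<open>Polynomial.lead_coeff (det Ms) * _ = 1\<close> by auto
  have "cmap P = 0 \<longleftrightarrow> P = 0" for P using injD[OF inj_cmap, of P 0] by (auto simp: cm.hom_zero)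
  then have "Polynomial.degree (map_poly cmap G) = Polynomial.degree G"
    by (intro degree_map_poly) simp
  then have lead: "cmap (Polynomial.lead_coeff G) = Const b" using b by (simp add: coeff_map_poly)
  define B where "B = lookup (Polynomial.lead_coeff G) 0"
  have LB: "Polynomial.lead_coeff G = Const B"
  proof (rule poly_mapping_eqI)
    fix m
    have "of_int (lookup (Polynomial.lead_coeff G) m) = lookup (Const b) m"
      using arg_cong[OF lead, of "\<lambda>P. lookup P m"] by (simp only: lookup_cmap)
    then show "lookup (Polynomial.lead_coeff G) m = lookup (Const B) m"
      by (auto simp: B_def lookup_single when_def)
  qed
  have "B \<noteq> 0"
  proof
    assume "B = 0"
    then have "lookup (Const b :: complex mpoly) 0 = 0"
      using arg_cong[OF lead, of "\<lambda>P. lookup P 0"] by (simp only: lookup_cmap B_def of_int_0)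
    then show False using \<open>b \<noteq> 0\<close> by simp
  qed
  moreover have "Const B \<in> idl {..<k} f"
  proof -
    obtain t where t: "sig n D ft G = [:g:] * t" using sig_det_multiple[OF \<beta> M] by (auto simp: G_def)
    interpret I: ideal_set "idl {..<k} f" by (rule ideal_set_idl)
    have "ft i \<in> idl {..<k} f" for i
      unfolding ft_def by (intro I.uminus I.sum I.mult idl_base) auto
    then show ?thesis
      by (intro lead_coeff_in_ideal[OF I.ideal_set_axioms _ _ t LB]) (auto simp: g_def)
  qed
  moreover have "iabs B \<le> null_bound n k D H"
  proof -
    have "iabs B = l1 iabs (Polynomial.lead_coeff G)" unfolding LB by (simp only: int.l1_single)
    also have "\<dots> \<le> pl1 (l1 iabs) G" by (rule intL.coeff_le_pl1)
    finally show ?thesis using bound by simp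
  qed
  ultimately show ?thesis by blast
qed

section \<open>Iterates of triangular systems\<close>

text \<open>Evaluation laws for rings given by a carrier, such as the closure of a prime field; the
  counterpart of \<open>ev\<close>, whose target is a type-class ring.\<close>

locale int_eval = R: cring R for R (structure) +
  fixes \<phi> :: "int \<Rightarrow> 'a" and w :: "nat \<Rightarrow> 'a"
  assumes phi_closed [simp]: "\<phi> c \<in> carrier R"
    and phi_add: "\<phi> (a + b) = \<phi> a \<oplus> \<phi> b" and phi_mult: "\<phi> (a * b) = \<phi> a \<otimes> \<phi> b"
    and phi_0: "\<phi> 0 = \<zero>" and phi_1: "\<phi> 1 = \<one>"
    and w_closed [simp]: "w i \<in> carrier R"
begin

definition mv :: "(nat \<Rightarrow>\<^sub>0 nat) \<Rightarrow> 'a" where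
  "mv m = (\<Otimes>i\<in>keys m. w i [^] lookup m i)"

definition E :: "int mpoly \<Rightarrow> 'a" where
  "E P = mpoly_eval R \<phi> P w"

lemma mv_superset:
  assumes "finite A" "keys m \<subseteq> A"
  shows "mv m = (\<Otimes>i\<in>A. w i [^] lookup m i)"
  unfolding mv_def by (rule R.finprod_mono_neutral_cong_left) (use assms in \<open>auto simp: in_keys_iff\<close>)

lemma mv_closed [simp]: "mv m \<in> carrier R"
  unfolding mv_def by (intro R.finprod_closed) auto

lemma mv_add: "mv (a + b) = mv a \<otimes> mv b"
proof -
  let ?A = "keys a \<union> keys b"
  have "mv (a + b) = (\<Otimes>i\<in>?A. w i [^] lookup a i \<otimes> w i [^] lookup b i)"
    by (subst mv_superset[where A = ?A]) (auto simp: keys_add_nat lookup_add R.nat_pow_mult intro!: R.finprod_cong')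
  also have "\<dots> = (\<Otimes>i\<in>?A. w i [^] lookup a i) \<otimes> (\<Otimes>i\<in>?A. w i [^] lookup b i)"
    by (rule R.finprod_multf) auto
  also have "\<dots> = mv a \<otimes> mv b"
    by (subst (1 2) mv_superset[where A = ?A]) auto
  finally show ?thesis .
qed

lemma E_superset:
  assumes "finite A" "keys P \<subseteq> A"
  shows "E P = (\<Oplus>m\<in>A. \<phi> (lookup P m) \<otimes> mv m)"
  unfolding E_def mpoly_eval_def mv_def[symmetric]
  by (rule R.add.finprod_mono_neutral_cong_left) (use assms in \<open>auto simp: in_keys_iff phi_0\<close>)

lemma E_closed [simp]: "E P \<in> carrier R"
  by (subst E_superset[OF finite_keys order_refl]) (intro R.finsum_closed, auto)

lemma E_add: "E (P + Q) = E P \<oplus> E Q"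
proof -
  let ?A = "keys P \<union> keys Q"
  have "E (P + Q) = (\<Oplus>m\<in>?A. \<phi> (lookup P m) \<otimes> mv m \<oplus> \<phi> (lookup Q m) \<otimes> mv m)"
    by (subst E_superset[where A = ?A])
      (use Poly_Mapping.keys_add[of P Q] in \<open>auto simp: lookup_add phi_add R.l_distr intro!: R.finsum_cong'\<close>)
  also have "\<dots> = (\<Oplus>m\<in>?A. \<phi> (lookup P m) \<otimes> mv m) \<oplus> (\<Oplus>m\<in>?A. \<phi> (lookup Q m) \<otimes> mv m)"
    by (rule R.finsum_addf) auto
  also have "\<dots> = E P \<oplus> E Q"
    by (subst (1 2) E_superset[where A = ?A]) auto
  finally show ?thesis .
qed

lemma E_0: "E 0 = \<zero>"
  by (subst E_superset[of "{}"]) auto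

lemma E_single: "E (Poly_Mapping.single m c) = \<phi> c \<otimes> mv m"
  by (subst E_superset[of "{m}"]) auto

lemma E_Const: "E (Const c) = \<phi> c"
  by (simp add: E_single mv_def)

lemma E_1: "E 1 = \<one>"
  using E_Const[of 1] by (simp add: phi_1)

lemma E_V: "E (V i) = w i"
  by (simp add: V_def E_single mv_def phi_1)

lemma E_sum: "E (sum f A) = (\<Oplus>a\<in>A. E (f a))"
proof (induction A rule: infinite_finite_induct)
  case (infinite A)
  then show ?case by (simp add: E_0 R.finsum_infinite)
qed (auto simp: E_0 E_add)

lemma E_mult: "E (P * Q) = E P \<otimes> E Q"
proof -
  have "E (P * Q) = (\<Oplus>m\<in>keys P. \<Oplus>m'\<in>keys Q. (\<phi> (lookup P m) \<otimes> mv m) \<otimes> (\<phi> (lookup Q m') \<otimes> mv m'))"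
    unfolding mult_singles[of P Q] E_sum E_single phi_mult mv_add
    by (intro R.finsum_cong' refl) (auto simp: R.m_ac)
  also have "\<dots> = (\<Oplus>m\<in>keys P. (\<phi> (lookup P m) \<otimes> mv m) \<otimes> E Q)"
    by (intro R.finsum_cong' refl, simp, subst E_superset[OF finite_keys order_refl, of Q], subst R.finsum_rdistr) auto
  also have "\<dots> = E P \<otimes> E Q"
    by (subst E_superset[OF finite_keys order_refl, of P], subst R.finsum_ldistr) auto
  finally show ?thesis .
qed

lemma E_power: "E (P ^ k) = E P [^] k"
  by (induction k) (auto simp: E_1 E_mult R.m_comm)

lemma E_prod: "E (prod f A) = (\<Otimes>a\<in>A. E (f a))"
proof (induction A rule: infinite_finite_induct)
  case (infinite A)
  then show ?case by (simp add: E_1 R.finprod_infinite)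
qed (auto simp: E_1 E_mult)

lemma E_uminus: "E (- P) = \<ominus> E P"
proof -
  have "E P \<oplus> E (- P) = \<zero>" using E_add[of P "- P"] by (simp add: E_0)
  then show ?thesis using R.minus_equality[of "E (- P)" "E P"] by (simp add: R.a_comm)
qed

lemma E_diff: "E (P - Q) = E P \<ominus> E Q"
  using E_add[of P "- Q"] by (simp add: E_uminus R.minus_eq)

lemma E_subst: "E (ev Const v P) = mpoly_eval R \<phi> P (\<lambda>i. E (v i))"
  unfolding ev_def mval_def mpoly_eval_def
  by (simp add: E_sum E_mult E_Const E_prod E_power)

end

lemma mpoly_eval_cong:
  assumes R: "cring R" and \<phi>: "\<And>c. \<phi> c \<in> carrier R"
    and vw: "\<And>m i. m \<in> keys P \<Longrightarrow> i \<in> keys m \<Longrightarrow> v i = w i"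
    and w: "\<And>m i. m \<in> keys P \<Longrightarrow> i \<in> keys m \<Longrightarrow> w i \<in> carrier R"
  shows "mpoly_eval R \<phi> P v = mpoly_eval R \<phi> P w"
proof -
  interpret R: cring R by fact
  have "(\<Otimes>\<^bsub>R\<^esub>i\<in>keys m. v i [^]\<^bsub>R\<^esub> lookup m i) = (\<Otimes>\<^bsub>R\<^esub>i\<in>keys m. w i [^]\<^bsub>R\<^esub> lookup m i)"
    if "m \<in> keys P" for m
    by (rule R.finprod_cong') (use vw[OF that] w[OF that] in auto)
  moreover have "(\<Otimes>\<^bsub>R\<^esub>i\<in>keys m. w i [^]\<^bsub>R\<^esub> lookup m i) \<in> carrier R" if "m \<in> keys P" for m
    by (rule R.finprod_closed) (use w[OF that] in auto)
  ultimately show ?thesis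
    unfolding mpoly_eval_def by (intro R.finsum_cong') (auto simp: \<phi>)
qed

lemma mpoly_eval_complex:
  "mpoly_eval (ring_of_type_algebra :: complex ring) of_int P w = ev of_int w P"
proof -
  let ?R = "ring_of_type_algebra :: complex ring"
  interpret R: cring ?R by (rule cring_from_type_algebra)
  have pow: "x [^]\<^bsub>?R\<^esub> (k :: nat) = x ^ k" for x k
    by (induction k) (auto simp: ring_of_type_algebra_def nat_pow_def)
  have prod: "finprod ?R g A = prod g A" for g :: "nat \<Rightarrow> complex" and A
  proof (induction A rule: infinite_finite_induct)
    case (insert x A)
    then have "finprod ?R g (insert x A) = g x \<otimes>\<^bsub>?R\<^esub> finprod ?R g A"
      by (intro R.finprod_insert) (auto simp: ring_of_type_algebra_def)
    then show ?case using insert by (simp add: ring_of_type_algebra_def)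
  qed (auto simp: R.finprod_infinite, auto simp: ring_of_type_algebra_def)
  have sum: "finsum ?R g A = sum g A" for g :: "(nat \<Rightarrow>\<^sub>0 nat) \<Rightarrow> complex" and A
  proof (induction A rule: infinite_finite_induct)
    case (insert x A)
    then have "finsum ?R g (insert x A) = g x \<oplus>\<^bsub>?R\<^esub> finsum ?R g A"
      by (intro R.finsum_insert) (auto simp: ring_of_type_algebra_def)
    then show ?case using insert by (simp add: ring_of_type_algebra_def)
  qed (auto simp: R.finsum_infinite, auto simp: ring_of_type_algebra_def)
  have mult: "x \<otimes>\<^bsub>?R\<^esub> y = x * y" for x y by (simp add: ring_of_type_algebra_def)
  show ?thesis unfolding mpoly_eval_def ev_def mval_def pow prod sum mult ..
qed

section \<open>Iterates as polynomials, with their degrees and norms\<close>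

primrec iter :: "(nat \<Rightarrow> int mpoly) \<Rightarrow> nat \<Rightarrow> nat \<Rightarrow> int mpoly" where
  "iter F 0 = V"
| "iter F (Suc m) = (\<lambda>i. ev Const (iter F m) (F i))"

text \<open>Substituting the previous iterates into \<open>V i * G i + H i\<close> multiplies the
  coefficient of \<open>V i\<close> by \<open>G i\<close> along the orbit. This coefficient is the
  \<open>A i\<close> of the overview, and \<open>iter_const\<close> is the
  \<open>B i\<close>.\<close>

primrec iter_lin :: "(nat \<Rightarrow> int mpoly) \<Rightarrow> (nat \<Rightarrow> int mpoly) \<Rightarrow> nat \<Rightarrow> nat \<Rightarrow> int mpoly" where
  "iter_lin F G 0 i = 1"
| "iter_lin F G (Suc m) i = iter_lin F G m i * ev Const (iter F m) (G i)"

primrec iter_const ::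
    "(nat \<Rightarrow> int mpoly) \<Rightarrow> (nat \<Rightarrow> int mpoly) \<Rightarrow> (nat \<Rightarrow> int mpoly) \<Rightarrow> nat \<Rightarrow> nat \<Rightarrow> int mpoly" where
  "iter_const F G H 0 i = 0"
| "iter_const F G H (Suc m) i =
     iter_const F G H m i * ev Const (iter F m) (G i) + ev Const (iter F m) (H i)"

text \<open>For at most \<open>e\<close> variables after \<open>V i\<close>: up to \<open>K\<close>
  factors, each a polynomial of degree \<open>d\<close> in iterates of later variables, and one more
  degree for \<open>V i\<close> itself. For fixed \<open>d\<close> this is of order
  \<open>K ^ e\<close>.\<close>

primrec deg_bound :: "nat \<Rightarrow> nat \<Rightarrow> nat \<Rightarrow> nat" where
  "deg_bound d K 0 = 1"
| "deg_bound d K (Suc e) = 1 + K * (d * deg_bound d K e)"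

text \<open>A substitution costs a factor \<open>h\<close> and a power \<open>d\<close> of the
  previous bound; the factor \<open>2\<close> absorbs the number of summands. The logarithm is of
  order \<open>K ^ (e + 1)\<close>.\<close>

primrec norm_bound :: "nat \<Rightarrow> real \<Rightarrow> nat \<Rightarrow> nat \<Rightarrow> real" where
  "norm_bound d h K 0 = (2 * h) ^ K"
| "norm_bound d h K (Suc e) = (2 * (h * norm_bound d h K e ^ d)) ^ K"

interpretation int_norm: seminorm iabs
  by (rule seminorm_int)

interpretation int_norm_l1: seminorm "l1 iabs :: int mpoly \<Rightarrow> real"
  by (rule int_norm.seminorm_l1)

lemma norm_bound_ge1: "1 \<le> h \<Longrightarrow> 1 \<le> norm_bound d h K e"
proof (induction e)
  case (Suc e)
  have "1 * 1 \<le> h * norm_bound d h K e ^ d"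
    by (intro mult_mono one_le_power Suc) (use Suc.prems in auto)
  then have "1 \<le> 2 * (h * norm_bound d h K e ^ d)" by simp
  then show ?case unfolding norm_bound.simps by (rule one_le_power)
next
  case 0
  then show ?case unfolding norm_bound.simps by (intro one_le_power) simp
qed

text \<open>The last component has the same shape as the others, \<open>G n\<close> and
  \<open>H n\<close> being constants since \<open>{n<..n}\<close> is empty. One degree bound and one
  norm bound cover all components.\<close>

locale triangular =
  fixes n d :: nat and h :: real and F G H :: "nat \<Rightarrow> int mpoly"
  assumes F: "\<And>i. i \<in> {1..n} \<Longrightarrow> F i = V i * G i + H i"
    and G_deg: "\<And>i. i \<in> {1..n} \<Longrightarrow> G i \<in> bdeg {i<..n} d" and H_deg: "\<And>i. i \<in> {1..n} \<Longrightarrow> H i \<in> bdeg {i<..n} d"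
    and G_norm: "\<And>i. i \<in> {1..n} \<Longrightarrow> l1 iabs (G i) \<le> h" and H_norm: "\<And>i. i \<in> {1..n} \<Longrightarrow> l1 iabs (H i) \<le> h"
    and h: "1 \<le> h"
begin

lemma subst_hom: "comm_ring_hom (ev Const v :: int mpoly \<Rightarrow> int mpoly)"
  by (rule ev_hom[OF Const_hom])

lemma iter_eq:
  assumes "i \<in> {1..n}"
  shows "iter F m i = V i * iter_lin F G m i + iter_const F G H m i"
proof (induction m)
  case (Suc m)
  interpret s: comm_ring_hom "ev Const (iter F m) :: int mpoly \<Rightarrow> int mpoly" by (rule subst_hom)
  show ?case
    by (simp add: F[OF assms] s.hom_add s.hom_mult ev_V[OF Const_hom] Suc algebra_simps)
qed simp

lemma F_vars: "i \<in> {1..n} \<Longrightarrow> F i \<in> bdeg {1..n} (1 + d)"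
  unfolding F
  by (intro bdeg_add bdeg_mult bdeg_mono[OF G_deg] bdeg_mono[OF H_deg]) auto

lemma subst_norm:
  assumes P: "P \<in> bdeg I d" and v: "\<And>j. j \<in> I \<Longrightarrow> l1 iabs (v j) \<le> B" and B: "1 \<le> B"
  shows "l1 iabs (ev Const v P) \<le> l1 iabs P * B ^ d"
  using int_norm_l1.l1_ev[where \<phi> = "Const :: int \<Rightarrow> int mpoly", OF P v B] by (simp add: int_norm.l1_single)

lemma iter_step:
  assumes i: "i \<in> {1..n}" and B: "1 \<le> B"
    and deg: "\<And>j m. j \<in> {i<..n} \<Longrightarrow> m \<le> K \<Longrightarrow> iter F m j \<in> bdeg {i<..n} \<delta>"
    and norm: "\<And>j m. j \<in> {i<..n} \<Longrightarrow> m \<le> K \<Longrightarrow> l1 iabs (iter F m j) \<le> B"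
    and m: "m \<le> K"
  shows "iter_lin F G m i \<in> bdeg {i<..n} (m * (d * \<delta>)) \<and> iter_const F G H m i \<in> bdeg {i<..n} (m * (d * \<delta>)) \<and>
     l1 iabs (iter_lin F G m i) \<le> (h * B ^ d) ^ m \<and> l1 iabs (iter_const F G H m i) \<le> real m * (h * B ^ d) ^ m"
  using m
proof (induction m)
  case 0
  show ?case using int_norm_l1.nu_1 by simp
next
  case (Suc m)
  then have m: "m \<le> K" by simp
  let ?q = "h * B ^ d"
  have "1 * 1 \<le> ?q" using h B by (intro mult_mono one_le_power) auto
  then have q: "1 \<le> ?q" by simp
  have sG: "ev Const (iter F m) (G i) \<in> bdeg {i<..n} (d * \<delta>)" "ev Const (iter F m) (H i) \<in> bdeg {i<..n} (d * \<delta>)"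
    by (rule bdeg_ev[OF G_deg[OF i]], simp, rule deg, simp, rule m)
      (rule bdeg_ev[OF H_deg[OF i]], simp, rule deg, simp, rule m)
  have nG: "l1 iabs (ev Const (iter F m) (G i)) \<le> ?q"
    by (rule order_trans[OF subst_norm[OF G_deg[OF i] norm B]]) (use m G_norm[OF i] B in \<open>auto intro: mult_right_mono\<close>)
  have nH: "l1 iabs (ev Const (iter F m) (H i)) \<le> ?q"
    by (rule order_trans[OF subst_norm[OF H_deg[OF i] norm B]]) (use m H_norm[OF i] B in \<open>auto intro: mult_right_mono\<close>)
  note IH = Suc.IH[OF m]
  have "iter_lin F G (Suc m) i \<in> bdeg {i<..n} (m * (d * \<delta>) + d * \<delta>)"
    using IH sG by (simp add: bdeg_mult)
  moreover have "iter_const F G H (Suc m) i \<in> bdeg {i<..n} (m * (d * \<delta>) + d * \<delta>)"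
    using IH sG by (auto intro!: bdeg_add bdeg_mult elim: bdeg_mono)
  moreover have "l1 iabs (iter_lin F G (Suc m) i) \<le> ?q ^ m * ?q"
    using IH nG q by (auto intro!: order_trans[OF int_norm_l1.nu_mult] mult_mono)
  moreover have "l1 iabs (iter_const F G H (Suc m) i) \<le> (real m * ?q ^ m) * ?q + ?q"
    using IH nG nH q
    by (auto intro!: order_trans[OF int_norm_l1.nu_add] add_mono order_trans[OF int_norm_l1.nu_mult] mult_mono)
  moreover have "(real m * ?q ^ m) * ?q + ?q \<le> real (Suc m) * ?q ^ Suc m"
  proof -
    have "?q ^ 1 \<le> ?q ^ Suc m" using q by (intro power_increasing) auto
    then show ?thesis by (simp add: algebra_simps)
  qed
  ultimately show ?case by (auto simp: algebra_simps)
qed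

lemma iter_step':
  assumes i: "i \<in> {1..n}" and B: "1 \<le> B"
    and deg: "\<And>j m. j \<in> {i<..n} \<Longrightarrow> m \<le> K \<Longrightarrow> iter F m j \<in> bdeg {i<..n} \<delta>"
    and norm: "\<And>j m. j \<in> {i<..n} \<Longrightarrow> m \<le> K \<Longrightarrow> l1 iabs (iter F m j) \<le> B"
    and m: "m \<le> K"
  shows "iter_lin F G m i \<in> bdeg {i<..n} (1 + K * (d * \<delta>)) \<and> iter F m i \<in> bdeg {i..n} (1 + K * (d * \<delta>)) \<and>
     l1 iabs (iter_lin F G m i) \<le> (2 * (h * B ^ d)) ^ K \<and> l1 iabs (iter F m i) \<le> (2 * (h * B ^ d)) ^ K"
proof -
  let ?q = "h * B ^ d"
  have "1 * 1 \<le> ?q" using h B by (intro mult_mono one_le_power) auto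
  then have q: "1 \<le> ?q" by simp
  have "iter_lin F G m i \<in> bdeg {i<..n} (m * (d * \<delta>)) \<and> iter_const F G H m i \<in> bdeg {i<..n} (m * (d * \<delta>)) \<and>
     l1 iabs (iter_lin F G m i) \<le> (h * B ^ d) ^ m \<and> l1 iabs (iter_const F G H m i) \<le> real m * (h * B ^ d) ^ m"
    by (rule iter_step[OF i B]) (use deg norm m in auto)
  then have s: "iter_lin F G m i \<in> bdeg {i<..n} (m * (d * \<delta>))" "iter_const F G H m i \<in> bdeg {i<..n} (m * (d * \<delta>))"
     "l1 iabs (iter_lin F G m i) \<le> ?q ^ m" "l1 iabs (iter_const F G H m i) \<le> real m * ?q ^ m" by auto
  have md: "m * (d * \<delta>) \<le> K * (d * \<delta>)" using m by (rule mult_le_mono1)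
  have "V i * iter_lin F G m i \<in> bdeg {i..n} (1 + m * (d * \<delta>))"
    using i by (intro bdeg_mult bdeg_mono[OF s(1)]) auto
  then have d2: "iter F m i \<in> bdeg {i..n} (1 + K * (d * \<delta>))"
    unfolding iter_eq[OF i]
  proof (intro bdeg_add)
    show "iter_const F G H m i \<in> bdeg {i..n} (1 + K * (d * \<delta>))"
      by (rule bdeg_mono[OF s(2)], force, rule order_trans[OF md], rule le_add2)
  qed (erule bdeg_mono, rule order_refl, rule add_left_mono[OF md])
  have "l1 iabs (iter F m i) \<le> 1 * ?q ^ m + real m * ?q ^ m"
    unfolding iter_eq[OF i] using s(3,4)
    by (intro order_trans[OF int_norm_l1.nu_add] add_mono order_trans[OF int_norm_l1.nu_mult] mult_mono)
      (auto simp: V_def int_norm.l1_single)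
  also have "\<dots> = real (m + 1) * ?q ^ m" by (simp add: algebra_simps)
  \<comment> \<open>The estimate \<open>m + 1 \<le> 2 ^ m\<close> is the origin of the factor
    \<open>2\<close> in \<open>norm_bound\<close>.\<close>
  also have "\<dots> \<le> 2 ^ m * ?q ^ m"
  proof (rule mult_right_mono)
    have "m + 1 \<le> 2 ^ m" by (simp add: Suc_leI)
    then show "real (m + 1) \<le> 2 ^ m" by (metis of_nat_le_iff of_nat_numeral of_nat_power)
  qed (use q in simp)
  also have "\<dots> = (2 * ?q) ^ m" by (simp only: power_mult_distrib)
  also have "\<dots> \<le> (2 * ?q) ^ K" using q m by (intro power_increasing) auto
  finally have n2: "l1 iabs (iter F m i) \<le> (2 * ?q) ^ K" .
  have "?q ^ m \<le> (2 * ?q) ^ m" using q by (intro power_mono) auto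
  also have "\<dots> \<le> (2 * ?q) ^ K" using q m by (intro power_increasing) auto
  finally have n1: "l1 iabs (iter_lin F G m i) \<le> (2 * ?q) ^ K" using s(3) by simp
  have d1: "iter_lin F G m i \<in> bdeg {i<..n} (1 + K * (d * \<delta>))"
    by (rule bdeg_mono[OF s(1) order_refl], rule order_trans[OF md], rule le_add2)
  show ?thesis using d1 d2 n1 n2 by simp
qed

text \<open>Induction from the last variable backwards: \<open>e\<close> bounds the number of
  variables after \<open>V i\<close>, and only iterates of these enter \<open>iter_lin\<close> and
  \<open>iter_const\<close>.\<close>

lemma iter_bounds:
  assumes "i \<in> {1..n}" "n - i \<le> e" "m \<le> K"
  shows "iter_lin F G m i \<in> bdeg {i<..n} (deg_bound d K e) \<and> iter F m i \<in> bdeg {i..n} (deg_bound d K e) \<and>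
     l1 iabs (iter_lin F G m i) \<le> norm_bound d h K e \<and> l1 iabs (iter F m i) \<le> norm_bound d h K e"
  using assms
proof (induction e arbitrary: i m)
  case 0
  then have "{i<..n} = {}" by auto
  then show ?case using iter_step'[of i 1 K 0 m] 0 by simp
next
  case (Suc e)
  have IH: "iter F m j \<in> bdeg {i<..n} (deg_bound d K e) \<and> l1 iabs (iter F m j) \<le> norm_bound d h K e"
    if "j \<in> {i<..n}" "m \<le> K" for j m
  proof -
    have "j \<in> {1..n}" "n - j \<le> e" using that Suc.prems by auto
    from Suc.IH[OF this that(2)] have "iter F m j \<in> bdeg {j..n} (deg_bound d K e)" "l1 iabs (iter F m j) \<le> norm_bound d h K e" by auto
    then show ?thesis using that by (auto elim!: bdeg_mono)
  qed
  show ?case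
    using iter_step'[OF Suc.prems(1) norm_bound_ge1[OF h], of K "deg_bound d K e" d K e m] IH Suc.prems by simp
qed

lemma const_vars:
  assumes "i \<in> {1..n}"
  shows "\<exists>e. iter_const F G H m i \<in> bdeg {i<..n} e"
proof -
  have "iter F m' j \<in> bdeg {i<..n} (deg_bound d m n)" "l1 iabs (iter F m' j) \<le> norm_bound d h m n" if "j \<in> {i<..n}" "m' \<le> m" for m' j
    using iter_bounds[of j n m' m] that assms by (auto elim!: bdeg_mono)
  from iter_step[OF assms norm_bound_ge1[OF h] this order_refl] show ?thesis by blast
qed

end

text \<open>Points are undefined outside \<open>{1..n}\<close>, while \<open>int_eval\<close> wants
  values in the carrier at every index.\<close>

definition ext0 :: "('a, 'b) ring_scheme \<Rightarrow> nat \<Rightarrow> (nat \<Rightarrow> 'a) \<Rightarrow> nat \<Rightarrow> 'a" where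
  "ext0 R n w i = (if i \<in> {1..n} then w i else \<zero>\<^bsub>R\<^esub>)"

text \<open>Iterating the map agrees with evaluating the iterated polynomials, so periodicity
  becomes \<open>n\<close> polynomial equations, uniformly for the complex numbers and the closure
  of a prime field.\<close>

lemma (in triangular) periodic_iff:
  assumes R0: "cring R" and R: "\<And>v. (\<And>i. v i \<in> carrier R) \<Longrightarrow> int_eval R \<phi> v"
  shows "w \<in> periodic_points R \<phi> n F k \<longleftrightarrow>
    w \<in> {1..n} \<rightarrow>\<^sub>E carrier R \<and> (\<forall>i\<in>{1..n}. mpoly_eval R \<phi> (iter F k i - V i) (ext0 R n w) = \<zero>\<^bsub>R\<^esub>)"
proof (cases "w \<in> {1..n} \<rightarrow>\<^sub>E carrier R")
  case True
  interpret R: cring R by fact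
  have w0: "ext0 R n w i \<in> carrier R" for i using True by (auto simp: ext0_def)
  interpret I: int_eval R \<phi> "ext0 R n w" by (rule R[OF w0])
  have map: "(system_map R \<phi> n F ^^ m) w = (\<lambda>i\<in>{1..n}. I.E (iter F m i))" for m
  proof (induction m)
    case 0
    show ?case
    proof
      fix i
      show "(system_map R \<phi> n F ^^ 0) w i = (\<lambda>i\<in>{1..n}. I.E (iter F 0 i)) i"
        using True by (cases "i \<in> {1..n}") (auto simp: I.E_V ext0_def PiE_def extensional_def)
    qed
  next
    case (Suc m)
    have "mpoly_eval R \<phi> (F i) (\<lambda>i\<in>{1..n}. I.E (iter F m i)) = I.E (iter F (Suc m) i)" if i: "i \<in> {1..n}" for i
    proof -
      have "mpoly_eval R \<phi> (F i) (\<lambda>i\<in>{1..n}. I.E (iter F m i)) = mpoly_eval R \<phi> (F i) (\<lambda>i. I.E (iter F m i))"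
      proof (rule mpoly_eval_cong[OF R0])
        fix m' j assume "m' \<in> keys (F i)" "j \<in> keys m'"
        then have "j \<in> {1..n}" using F_vars[OF i] unfolding bdeg_def by blast
        then show "(\<lambda>i\<in>{1..n}. I.E (iter F m i)) j = I.E (iter F m j)" by simp
      qed auto
      also have "\<dots> = I.E (iter F (Suc m) i)" by (simp add: I.E_subst)
      finally show ?thesis .
    qed
    then have "system_map R \<phi> n F (\<lambda>i\<in>{1..n}. I.E (iter F m i)) = (\<lambda>i\<in>{1..n}. I.E (iter F (Suc m) i))"
      unfolding system_map_def by (rule restrict_ext)
    moreover have "(system_map R \<phi> n F ^^ Suc m) w = system_map R \<phi> n F (\<lambda>i\<in>{1..n}. I.E (iter F m i))"
      by (simp only: funpow.simps o_apply Suc)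
    ultimately show ?case by (simp only:)
  qed
  have "(system_map R \<phi> n F ^^ k) w = w \<longleftrightarrow> (\<forall>i\<in>{1..n}. I.E (iter F k i) = w i)"
    unfolding map using True by (auto simp: fun_eq_iff PiE_def extensional_def)
  also have "\<dots> \<longleftrightarrow> (\<forall>i\<in>{1..n}. I.E (iter F k i - V i) = \<zero>\<^bsub>R\<^esub>)"
  proof (intro ball_cong refl)
    fix i assume i: "i \<in> {1..n}"
    have "w i \<in> carrier R" using True i by auto
    then have "(I.E (iter F k i) \<ominus>\<^bsub>R\<^esub> w i = \<zero>\<^bsub>R\<^esub>) = (I.E (iter F k i) = w i)"
      using R.r_right_minus_eq by simp
    then show "(I.E (iter F k i) = w i) = (I.E (iter F k i - V i) = \<zero>\<^bsub>R\<^esub>)"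
      using i by (simp add: I.E_diff I.E_V ext0_def)
  qed
  finally show ?thesis using True by (simp add: periodic_points_def I.E_def)
qed (auto simp: periodic_points_def)

text \<open>Where all linear coefficients are nonzero, the equations determine the coordinates from the last to the first.\<close>

lemma (in triangular) periodic_unique:
  assumes "domain R" and R: "\<And>v. (\<And>i. v i \<in> carrier R) \<Longrightarrow> int_eval R \<phi> v"
    and w: "w \<in> periodic_points R \<phi> n F k" and v: "v \<in> periodic_points R \<phi> n F k"
    and nz: "\<And>i. i \<in> {1..n} \<Longrightarrow> mpoly_eval R \<phi> (iter_lin F G k i - 1) (ext0 R n w) \<noteq> \<zero>\<^bsub>R\<^esub>"
  shows "v = w"
proof -
  interpret R: domain R by fact
  have wP: "w \<in> {1..n} \<rightarrow>\<^sub>E carrier R" and vP: "v \<in> {1..n} \<rightarrow>\<^sub>E carrier R"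
    using w v by (auto simp: periodic_points_def)
  have w0: "ext0 R n w i \<in> carrier R" and v0: "ext0 R n v i \<in> carrier R" for i
    using wP vP by (auto simp: ext0_def)
  interpret W: int_eval R \<phi> "ext0 R n w" by (rule R[OF w0])
  interpret V: int_eval R \<phi> "ext0 R n v" by (rule R[OF v0])
  have "v i = w i" if "i \<in> {1..n}" for i
    using that
  proof (induction "n - i" arbitrary: i rule: less_induct)
    case less
    have eq: "ext0 R n v j = ext0 R n w j" if "j \<in> {i<..n}" for j
      using that less.prems less.hyps[of j] by (auto simp: ext0_def)
    have cong: "V.E P = W.E P" if "P \<in> bdeg {i<..n} e" for P e
      unfolding V.E_def W.E_def
    proof (rule mpoly_eval_cong[OF R.cring_axioms])
      fix m j assume "m \<in> keys P" "j \<in> keys m"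
      then have "j \<in> {i<..n}" using that unfolding bdeg_def by blast
      then show "ext0 R n v j = ext0 R n w j" by (rule eq)
    qed (auto simp: w0)
    have a: "V.E (iter_lin F G k i - 1) = W.E (iter_lin F G k i - 1)"
      using iter_bounds[of i n k k] less.prems by (intro cong[of _ "deg_bound d k n"] bdeg_diff) auto
    obtain e where "iter_const F G H k i \<in> bdeg {i<..n} e" using const_vars[OF less.prems] by blast
    then have b: "V.E (iter_const F G H k i) = W.E (iter_const F G H k i)" by (rule cong)
    have f: "iter F k i - V i = V i * (iter_lin F G k i - 1) + iter_const F G H k i"
      unfolding iter_eq[OF less.prems] by (simp add: algebra_simps)
    have "W.E (iter F k i - V i) = \<zero>\<^bsub>R\<^esub>" "V.E (iter F k i - V i) = \<zero>\<^bsub>R\<^esub>"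
      using w v periodic_iff[OF R.cring_axioms R] less.prems by (auto simp: W.E_def V.E_def)
    then have "w i \<otimes>\<^bsub>R\<^esub> W.E (iter_lin F G k i - 1) \<oplus>\<^bsub>R\<^esub> W.E (iter_const F G H k i)
        = v i \<otimes>\<^bsub>R\<^esub> W.E (iter_lin F G k i - 1) \<oplus>\<^bsub>R\<^esub> W.E (iter_const F G H k i)"
      using less.prems unfolding f by (simp add: W.E_add W.E_mult W.E_V V.E_add V.E_mult V.E_V a b ext0_def)
    moreover have "w i \<in> carrier R" "v i \<in> carrier R" using wP vP less.prems by auto
    ultimately have "w i \<otimes>\<^bsub>R\<^esub> W.E (iter_lin F G k i - 1) = v i \<otimes>\<^bsub>R\<^esub> W.E (iter_lin F G k i - 1)"
      by (subst (asm) R.add.r_cancel) auto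
    then have "w i = v i"
      using nz[OF less.prems] \<open>w i \<in> carrier R\<close> \<open>v i \<in> carrier R\<close> R.m_rcancel[of "W.E (iter_lin F G k i - 1)" "w i" "v i"]
      unfolding W.E_def[symmetric] by simp
    then show "v i = w i" by (rule sym)
  qed
  then show ?thesis by (intro PiE_ext[OF vP wP]) auto
qed

section \<open>Complex periodic points\<close>

text \<open>If \<open>a j x = 0\<close> with \<open>j\<close> minimal, then the \<open>j\<close>-th coordinate can be varied freely, and nearby values
  extend to solutions because the equations for the smaller coordinates remain solvable.\<close>

lemma finite_zeros_imp_nondegenerate:
  fixes a b :: "nat \<Rightarrow> (nat \<Rightarrow> complex) \<Rightarrow> complex"
  assumes fin: "finite {x \<in> {1..n} \<rightarrow>\<^sub>E UNIV. \<forall>i\<in>{1..n}. x i * a i x + b i x = 0}"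
    and a_dep: "\<And>i x y. i \<in> {1..n} \<Longrightarrow> (\<And>j. j \<in> {i<..n} \<Longrightarrow> x j = y j) \<Longrightarrow> a i x = a i y"
    and b_dep: "\<And>i x y. i \<in> {1..n} \<Longrightarrow> (\<And>j. j \<in> {i<..n} \<Longrightarrow> x j = y j) \<Longrightarrow> b i x = b i y"
    and a_cont: "\<And>i y c. i \<in> {1..n} \<Longrightarrow> (\<And>j. j \<in> {i<..n} \<Longrightarrow> isCont (\<lambda>c. y c j) c) \<Longrightarrow> isCont (\<lambda>c. a i (y c)) (c :: complex)"
    and b_cont: "\<And>i y c. i \<in> {1..n} \<Longrightarrow> (\<And>j. j \<in> {i<..n} \<Longrightarrow> isCont (\<lambda>c. y c j) c) \<Longrightarrow> isCont (\<lambda>c. b i (y c)) (c :: complex)"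
    and x: "x \<in> {1..n} \<rightarrow>\<^sub>E UNIV" "\<And>i. i \<in> {1..n} \<Longrightarrow> x i * a i x + b i x = 0" and i: "i \<in> {1..n}"
  shows "a i x \<noteq> 0"
proof
  assume "a i x = 0"
  define j where "j = (LEAST i. i \<in> {1..n} \<and> a i x = 0)"
  have j: "j \<in> {1..n} \<and> a j x = 0"
    unfolding j_def by (rule LeastI[of _ i]) (use i \<open>a i x = 0\<close> in simp)
  have nz: "a i x \<noteq> 0" if "1 \<le> i" "i < j" for i
    using not_less_Least[of i "\<lambda>i. i \<in> {1..n} \<and> a i x = 0"] that j unfolding j_def[symmetric] by auto
  \<comment> \<open>Downward induction on the index builds a family \<open>y c\<close> through
    \<open>x\<close> whose \<open>j\<close>-th coordinate is \<open>c\<close> and which, for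
    \<open>c\<close> near \<open>x j\<close>, solves the equations from index \<open>j - t\<close>
    on.\<close>
  have "t \<le> j - 1 \<Longrightarrow> \<exists>y. y (x j) = x \<and> (\<forall>c. y c \<in> {1..n} \<rightarrow>\<^sub>E UNIV \<and> y c j = c) \<and>
      (\<forall>i\<in>{j - t..n}. isCont (\<lambda>c. y c i) (x j)) \<and>
      (\<forall>\<^sub>F c in nhds (x j). \<forall>i\<in>{j - t..n}. y c i * a i (y c) + b i (y c) = 0)" for t
  proof (induction t)
    case 0
    \<comment> \<open>Changing coordinate \<open>j\<close> alone affects none of the equations from
      \<open>j\<close> on: later ones do not involve it, and in equation \<open>j\<close> its
      coefficient is zero.\<close>
    let ?y = "\<lambda>c. x(j := c)"
    have y1: "?y c \<in> {1..n} \<rightarrow>\<^sub>E UNIV" for c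
      using x(1) j by (auto simp: PiE_iff extensional_def)
    have y2: "isCont (\<lambda>c. ?y c i) (x j)" for i
      by (cases "i = j") auto
    have y3: "?y c i * a i (?y c) + b i (?y c) = 0" if "i \<in> {j..n}" for c i
    proof -
      have i': "i \<in> {1..n}" using that j by auto
      have "a i (?y c) = a i x" "b i (?y c) = b i x"
        by (rule a_dep[OF i'], use that in simp) (rule b_dep[OF i'], use that in simp)
      moreover have "a i x = 0" if "i = j" using j that by simp
      ultimately show ?thesis using x(2)[OF i'] by (cases "i = j") auto
    qed
    show ?case
      by (intro exI[of _ ?y] conjI allI ballI always_eventually, simp, rule y1, simp, rule y2, rule y3, simp)
  next
    case (Suc t)
    then obtain y where y0: "y (x j) = x" and yP: "\<And>c. y c \<in> {1..n} \<rightarrow>\<^sub>E UNIV" and yj: "\<And>c. y c j = c"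
      and ycont: "\<And>i. i \<in> {j - t..n} \<Longrightarrow> isCont (\<lambda>c. y c i) (x j)"
      and yev: "\<forall>\<^sub>F c in nhds (x j). \<forall>i\<in>{j - t..n}. y c i * a i (y c) + b i (y c) = 0"
      by (force simp: Suc_leD)
    define l where "l = j - Suc t"
    have l: "1 \<le> l" "l < j" "j - t = Suc l" "l \<in> {1..n}" using Suc.prems j unfolding l_def by auto
    \<comment> \<open>Equation \<open>l\<close> is solved for coordinate \<open>l\<close>; its
      coefficient is nonzero at \<open>x\<close> by minimality of \<open>j\<close>, hence nearby by
      continuity.\<close>
    let ?y = "\<lambda>c. (y c)(l := - b l (y c) / a l (y c))"
    have dep: "a i (?y c) = a i (y c)" "b i (?y c) = b i (y c)" if "i \<in> {l..n}" for i c
      by (rule a_dep, use that l in simp, use that in simp) (rule b_dep, use that l in simp, use that in simp)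
    have ac: "isCont (\<lambda>c. a l (y c)) (x j)" by (rule a_cont[OF l(4)]) (use ycont l(3) in auto)
    have bc: "isCont (\<lambda>c. b l (y c)) (x j)" by (rule b_cont[OF l(4)]) (use ycont l(3) in auto)
    have al: "a l (y (x j)) \<noteq> 0" using nz[OF l(1,2)] by (simp add: y0)
    have "b l x = - (x l * a l x)" using x(2)[OF l(4)] by (simp add: add_eq_0_iff)
    then have "- b l x / a l x = x l" using nz[OF l(1,2)] by simp
    then have y1: "?y (x j) = x" by (simp add: y0 fun_eq_iff)
    have y2: "?y c \<in> {1..n} \<rightarrow>\<^sub>E UNIV \<and> ?y c j = c" for c
      using yP yj l by (auto simp: PiE_iff extensional_def)
    have y3: "isCont (\<lambda>c. ?y c i) (x j)" if "i \<in> {l..n}" for i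
    proof (cases "i = l")
      case True
      have "isCont (\<lambda>c. - b l (y c) / a l (y c)) (x j)"
        by (intro continuous_intros ac bc al)
      then show ?thesis using True by simp
    next
      case False
      then show ?thesis using ycont[of i] that l(3) by simp
    qed
    have y4: "\<forall>\<^sub>F c in nhds (x j). \<forall>i\<in>{l..n}. ?y c i * a i (?y c) + b i (?y c) = 0"
    proof -
      have "\<forall>\<^sub>F c in nhds (x j). a l (y c) \<noteq> 0"
        using ac al by (simp add: isCont_def tendsto_imp_eventually_ne eventually_nhds_conv_at)
      then show ?thesis using yev
      proof eventually_elim
        case (elim c)
        show ?case
        proof
          fix i assume i: "i \<in> {l..n}"
          show "?y c i * a i (?y c) + b i (?y c) = 0"
            unfolding dep[OF i] using elim i l(3) by (cases "i = l") auto
        qed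
      qed
    qed
    show ?case
      unfolding l_def[symmetric] using y1 y2 y3 y4 by (intro exI[of _ ?y] conjI allI ballI) blast+
  qed
  from this[of "j - 1"] j obtain y where y: "\<And>c. y c \<in> {1..n} \<rightarrow>\<^sub>E UNIV" "\<And>c. y c j = c"
    and ev: "\<forall>\<^sub>F c in nhds (x j). \<forall>i\<in>{1..n}. y c i * a i (y c) + b i (y c) = 0" by auto
  let ?S = "{x \<in> {1..n} \<rightarrow>\<^sub>E UNIV. \<forall>i\<in>{1..n}. x i * a i x + b i x = 0}"
  obtain U where U: "open U" "x j \<in> U" and sol: "\<And>c. c \<in> U \<Longrightarrow> y c \<in> ?S"
    using ev y(1) unfolding eventually_nhds by auto
  have "U \<subseteq> (\<lambda>x. x j) ` ?S"
  proof
    fix c assume "c \<in> U"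
    then show "c \<in> (\<lambda>x. x j) ` ?S" by (intro image_eqI[of _ _ "y c"] sol) (simp_all add: y(2))
  qed
  then have "finite U" using fin by (meson finite_imageI finite_subset)
  \<comment> \<open>A finite nonempty open set would make a single complex number an open
    set.\<close>
  then have "open (U - (U - {x j}))" by (intro open_Diff[OF U(1)] finite_imp_closed) simp
  moreover have "U - (U - {x j}) = {x j}" using U(2) by blast
  ultimately show False using not_open_singleton[of "x j"] by simp
qed

lemma isCont_ev:
  fixes y :: "complex \<Rightarrow> nat \<Rightarrow> complex"
  assumes "P \<in> bdeg I d" "\<And>i. i \<in> I \<Longrightarrow> isCont (\<lambda>c. y c i) c"
  shows "isCont (\<lambda>c. ev \<phi> (y c) P) c"
proof -
  have "isCont (\<lambda>c. y c i) c" if "m \<in> keys P" "i \<in> keys m" for m i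
    using assms that unfolding bdeg_def by blast
  then show ?thesis unfolding ev_def mval_def by (intro continuous_intros) auto
qed

lemma ev_cong_bdeg:
  assumes "P \<in> bdeg I d" "\<And>i. i \<in> I \<Longrightarrow> v i = w i"
  shows "ev \<phi> v P = ev \<phi> w P"
  by (rule ev_cong) (use assms in \<open>auto simp: bdeg_def\<close>)

lemma int_eval_complex: "int_eval (ring_of_type_algebra :: complex ring) of_int v"
proof -
  interpret R: cring "ring_of_type_algebra :: complex ring" by (rule cring_from_type_algebra)
  show ?thesis by unfold_locales (auto simp: ring_of_type_algebra_def)
qed

lemma of_int_complex_hom: "comm_ring_hom (of_int :: int \<Rightarrow> complex)"
  by unfold_locales auto

context triangular
begin

lemma iter_lin_vars: "i \<in> {1..n} \<Longrightarrow> iter_lin F G k i - 1 \<in> bdeg {i<..n} (deg_bound d k n)"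
  using iter_bounds[of i n k k] by (intro bdeg_diff) auto

lemma iter_vars:
  assumes i: "i \<in> {1..n}"
  shows "iter F k i - V i \<in> bdeg {1..n} (deg_bound d k (n - 1))"
    "iter_lin F G k i - 1 \<in> bdeg {1..n} (deg_bound d k (n - 1))"
proof -
  have "1 \<le> deg_bound d k (n - 1)" by (cases "n - 1") auto
  moreover have "iter_lin F G k i \<in> bdeg {i<..n} (deg_bound d k (n - 1))" "iter F k i \<in> bdeg {i..n} (deg_bound d k (n - 1))"
    using iter_bounds[of i "n - 1" k k] i by auto
  moreover have "{i<..n} \<subseteq> {1..n}" "{i..n} \<subseteq> {1..n}" using i by auto
  ultimately show "iter F k i - V i \<in> bdeg {1..n} (deg_bound d k (n - 1))"
    "iter_lin F G k i - 1 \<in> bdeg {1..n} (deg_bound d k (n - 1))"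
    using i by (auto intro!: bdeg_diff intro: bdeg_mono)
qed

lemma iter_diff_eq:
  "i \<in> {1..n} \<Longrightarrow> iter F k i - V i = V i * (iter_lin F G k i - 1) + iter_const F G H k i"
  by (simp add: iter_eq algebra_simps)

lemma iter_lin_ne_1:
  assumes fin: "finite (complex_periodic_points n F k)"
    and w: "\<And>i. i \<in> {1..n} \<Longrightarrow> ev of_int w (iter F k i - V i) = (0 :: complex)" and j: "j \<in> {1..n}"
  shows "ev of_int w (iter_lin F G k j - 1) \<noteq> (0 :: complex)"
proof -
  let ?R = "ring_of_type_algebra :: complex ring"
  define a :: "nat \<Rightarrow> (nat \<Rightarrow> complex) \<Rightarrow> complex" where "a i x = ev of_int x (iter_lin F G k i - 1)" for i x
  define b :: "nat \<Rightarrow> (nat \<Rightarrow> complex) \<Rightarrow> complex" where "b i x = ev of_int x (iter_const F G H k i)" for i x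
  interpret R: cring ?R by (rule cring_from_type_algebra)
  have eq: "ev of_int x (iter F k i - V i) = x i * a i x + b i x" if "i \<in> {1..n}" for i and x :: "nat \<Rightarrow> complex"
  proof -
    interpret e: comm_ring_hom "ev of_int x :: int mpoly \<Rightarrow> complex" by (rule ev_hom[OF of_int_complex_hom])
    show ?thesis
      unfolding iter_diff_eq[OF that] a_def b_def e.hom_add e.hom_mult ev_V[OF of_int_complex_hom] ..
  qed
  have set: "complex_periodic_points n F k = {x \<in> {1..n} \<rightarrow>\<^sub>E UNIV. \<forall>i\<in>{1..n}. x i * a i x + b i x = 0}" (is "_ = ?S")
  proof (rule Set.set_eqI)
    fix x :: "nat \<Rightarrow> complex"
    have "ev of_int (ext0 ?R n x) (iter F k i - V i) = x i * a i x + b i x" if "i \<in> {1..n}" for i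
      unfolding eq[OF that, symmetric] by (rule ev_cong_bdeg[OF iter_vars(1)[OF that]]) (simp add: ext0_def)
    then show "x \<in> complex_periodic_points n F k \<longleftrightarrow> x \<in> ?S"
      unfolding complex_periodic_points_def periodic_iff[OF R.cring_axioms int_eval_complex] mpoly_eval_complex
      by (simp add: ring_of_type_algebra_def)
  qed
  \<comment> \<open>Periodic points are extensional, whereas \<open>w\<close> is any function; the
    polynomials see only its values on \<open>{1..n}\<close>.\<close>
  have w_cong: "ev of_int (restrict w {1..n}) P = (ev of_int w P :: complex)" if "P \<in> bdeg {1..n} e" for P e
    by (rule ev_cong_bdeg[OF that]) simp
  have "a j (restrict w {1..n}) \<noteq> 0"
  proof (rule finite_zeros_imp_nondegenerate[OF fin[unfolded set]])
    fix i x y assume i: "i \<in> {1..n}" and xy: "\<And>j. j \<in> {i<..n} \<Longrightarrow> x j = (y j :: complex)"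
    show "a i x = a i y"
      unfolding a_def by (rule ev_cong_bdeg[OF iter_lin_vars[OF i] xy])
    obtain e where "iter_const F G H k i \<in> bdeg {i<..n} e" using const_vars[OF i] by blast
    then show "b i x = b i y"
      unfolding b_def by (rule ev_cong_bdeg[OF _ xy])
  next
    fix i and y :: "complex \<Rightarrow> nat \<Rightarrow> complex" and c
    assume i: "i \<in> {1..n}" and y: "\<And>j. j \<in> {i<..n} \<Longrightarrow> isCont (\<lambda>c. y c j) c"
    show "isCont (\<lambda>c. a i (y c)) c"
      unfolding a_def by (rule isCont_ev[OF iter_lin_vars[OF i] y])
    obtain e where "iter_const F G H k i \<in> bdeg {i<..n} e" using const_vars[OF i] by blast
    then show "isCont (\<lambda>c. b i (y c)) c"
      unfolding b_def by (rule isCont_ev[OF _ y])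
  next
    fix i assume i: "i \<in> {1..n}"
    show "restrict w {1..n} i * a i (restrict w {1..n}) + b i (restrict w {1..n}) = 0"
      unfolding eq[OF i, symmetric] w_cong[OF iter_vars(1)[OF i]] by (rule w[OF i])
  qed (use j in auto)
  then show ?thesis unfolding a_def w_cong[OF iter_vars(2)[OF j]] .
qed

end

section \<open>Periodic points modulo a prime\<close>

lemma mpoly_eval_closed:
  assumes "cring R" "\<And>c. \<phi> c \<in> carrier R" "P \<in> bdeg I d" "\<And>i. i \<in> I \<Longrightarrow> w i \<in> carrier R"
  shows "mpoly_eval R \<phi> P w \<in> carrier R"
proof -
  interpret R: cring R by fact
  have "w i \<in> carrier R" if "m \<in> keys P" "i \<in> keys m" for m i
    using assms(3,4) that unfolding bdeg_def by blast
  then show ?thesis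
    unfolding mpoly_eval_def by (intro R.finsum_closed) (auto intro!: R.finprod_closed assms(2))
qed

text \<open>\<open>\<psi>\<close> matters only on the representatives of residues; its composite
  \<open>\<phi>\<close> with reduction is defined on all integers and can be a ring homomorphism as
  \<open>int_eval\<close> requires.\<close>

lemma mpoly_eval_reduce_mod:
  assumes R: "cring R" and \<phi>: "\<And>c. \<phi> c \<in> carrier R" "\<phi> 0 = \<zero>\<^bsub>R\<^esub>" and \<psi>: "\<And>c. \<phi> c = \<psi> (c mod int p)"
    and P: "P \<in> bdeg I d" and w: "\<And>i. i \<in> I \<Longrightarrow> w i \<in> carrier R"
  shows "mpoly_eval R \<psi> (reduce_mod p P) w = mpoly_eval R \<phi> P w"
proof -
  interpret R: cring R by fact
  have lk: "lookup (reduce_mod p P) m = lookup P m mod int p" for m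
    by (simp add: reduce_mod_def Poly_Mapping.map.rep_eq when_def)
  have mv: "(\<Otimes>\<^bsub>R\<^esub>i\<in>keys m. w i [^]\<^bsub>R\<^esub> lookup m i) \<in> carrier R" if "m \<in> keys P" for m
  proof -
    have "w i \<in> carrier R" if "i \<in> keys m" for i
      using P w that \<open>m \<in> keys P\<close> unfolding bdeg_def by blast
    then show ?thesis by (intro R.finprod_closed) auto
  qed
  have sub: "keys (reduce_mod p P) \<subseteq> keys P"
    by (auto simp: in_keys_iff lk)
  have z: "\<phi> (lookup P m) = \<zero>\<^bsub>R\<^esub>" if "m \<notin> keys (reduce_mod p P)" for m
  proof -
    have "lookup P m mod int p = 0 mod int p" using that by (simp add: in_keys_iff lk)
    then have "\<phi> (lookup P m) = \<phi> 0" unfolding \<psi> by (rule arg_cong)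
    then show ?thesis by (simp add: \<phi>)
  qed
  show ?thesis
    unfolding mpoly_eval_def
  proof (rule R.add.finprod_mono_neutral_cong_left)
    show "\<phi> (lookup P m) \<otimes>\<^bsub>R\<^esub> (\<Otimes>\<^bsub>R\<^esub>i\<in>keys m. w i [^]\<^bsub>R\<^esub> lookup m i) = \<zero>\<^bsub>R\<^esub>"
      if "m \<in> keys P - keys (reduce_mod p P)" for m
      using that z mv by (auto intro: R.l_null)
    show "\<psi> (lookup (reduce_mod p P) m) \<otimes>\<^bsub>R\<^esub> (\<Otimes>\<^bsub>R\<^esub>i\<in>keys m. w i [^]\<^bsub>R\<^esub> lookup m i) =
        \<phi> (lookup P m) \<otimes>\<^bsub>R\<^esub> (\<Otimes>\<^bsub>R\<^esub>i\<in>keys m. w i [^]\<^bsub>R\<^esub> lookup m i)"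
      if "m \<in> keys (reduce_mod p P)" for m
      by (simp only: lk \<psi>)
    show "(\<lambda>m. \<phi> (lookup P m) \<otimes>\<^bsub>R\<^esub> (\<Otimes>\<^bsub>R\<^esub>i\<in>keys m. w i [^]\<^bsub>R\<^esub> lookup m i)) \<in> keys P \<rightarrow> carrier R"
      using mv \<phi>(1) by auto
  qed (use sub in auto)
qed

lemma (in triangular) periodic_points_reduce_mod:
  assumes R: "cring R" and \<phi>: "\<And>c. \<phi> c \<in> carrier R" "\<phi> 0 = \<zero>\<^bsub>R\<^esub>" and \<psi>: "\<And>c. \<phi> c = \<psi> (c mod int p)"
  shows "periodic_points R \<psi> n (\<lambda>i. reduce_mod p (F i)) k = periodic_points R \<phi> n F k"
proof -
  have step: "system_map R \<psi> n (\<lambda>i. reduce_mod p (F i)) w = system_map R \<phi> n F w \<and>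
      system_map R \<phi> n F w \<in> {1..n} \<rightarrow>\<^sub>E carrier R" if w: "w \<in> {1..n} \<rightarrow>\<^sub>E carrier R" for w
  proof
    have wc: "w i \<in> carrier R" if "i \<in> {1..n}" for i using w that by (rule PiE_mem)
    show "system_map R \<psi> n (\<lambda>i. reduce_mod p (F i)) w = system_map R \<phi> n F w"
      unfolding system_map_def by (rule restrict_ext, rule mpoly_eval_reduce_mod[OF R, where \<phi> = \<phi> and I = "{1..n}" and d = "1 + d"])
        (use \<phi> \<psi> F_vars wc in auto)
    show "system_map R \<phi> n F w \<in> {1..n} \<rightarrow>\<^sub>E carrier R"
      unfolding system_map_def
      by (intro restrict_PiE_iff[THEN iffD2] ballI, rule mpoly_eval_closed[OF R, where I = "{1..n}" and d = "1 + d"])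
        (use \<phi> F_vars wc in auto)
  qed
  have "(system_map R \<psi> n (\<lambda>i. reduce_mod p (F i)) ^^ k) w = (system_map R \<phi> n F ^^ k) w \<and>
      (system_map R \<phi> n F ^^ k) w \<in> {1..n} \<rightarrow>\<^sub>E carrier R" if w: "w \<in> {1..n} \<rightarrow>\<^sub>E carrier R" for w k
  proof (induction k)
    case 0
    show ?case using w by simp
  next
    case (Suc k)
    show ?case using step[of "(system_map R \<phi> n F ^^ k) w"] Suc by simp
  qed
  then show ?thesis unfolding periodic_points_def by auto
qed

text \<open>Reduction followed by the embedding into the closure is a homomorphism from the
  integers, and injectivity of the embedding turns vanishing into divisibility by
  \<open>p\<close>.\<close>

lemma residue_closure:
  fixes p :: nat
  assumes p: "Factorial_Ring.prime p"
  defines "R \<equiv> field.alg_closure (residue_ring (int p))"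
  defines "\<phi> \<equiv> \<lambda>c. ring.indexed_const (residue_ring (int p)) (c mod int p) :: (int list \<times> nat) multiset \<Rightarrow> int"
  shows "domain R" "\<And>w. (\<And>i. w i \<in> carrier R) \<Longrightarrow> int_eval R \<phi> w" "\<And>c. \<phi> c = \<zero>\<^bsub>R\<^esub> \<Longrightarrow> int p dvd c"
    "\<phi> c \<in> carrier R" "\<phi> 0 = \<zero>\<^bsub>R\<^esub>"
proof -
  interpret K: residues_prime p "residue_ring (int p)"
    by unfold_locales (rule p)
  let ?i = "ring.indexed_const (residue_ring (int p)) :: int \<Rightarrow> (int list \<times> nat) multiset \<Rightarrow> int"
  interpret L: field R
    using K.alg_closureE(1) unfolding R_def algebraic_closure_def by blast
  have hom: "?i \<in> Ring.ring_hom (residue_ring (int p)) R"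
    using K.alg_closureE(2) unfolding R_def .
  have z: "?i 0 = \<zero>\<^bsub>R\<^esub>"
    using ring_hom_zero[OF hom K.ring_axioms L.ring_axioms] by (simp add: K.zero_cong)
  have c: "\<phi> c \<in> carrier R" for c
    unfolding \<phi>_def by (rule ring_hom_closed[OF hom]) (rule K.mod_in_carrier)
  show "domain R" by (rule L.domain_axioms)
  show "int_eval R \<phi> w" if "\<And>i. w i \<in> carrier R" for w
  proof
    show "\<phi> (a + b) = \<phi> a \<oplus>\<^bsub>R\<^esub> \<phi> b" for a b
      unfolding \<phi>_def K.add_cong[symmetric] by (rule ring_hom_add[OF hom]) (rule K.mod_in_carrier)+
    show "\<phi> (a * b) = \<phi> a \<otimes>\<^bsub>R\<^esub> \<phi> b" for a b
      unfolding \<phi>_def K.mult_cong[symmetric] by (rule ring_hom_mult[OF hom]) (rule K.mod_in_carrier)+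
    show "\<phi> 1 = \<one>\<^bsub>R\<^esub>"
      using ring_hom_one[OF hom] unfolding \<phi>_def K.one_cong .
  qed (use that c z in \<open>auto simp: \<phi>_def\<close>)
  show "int p dvd c" if "\<phi> c = \<zero>\<^bsub>R\<^esub>" for c
  proof -
    have "?i (c mod int p) = ?i 0" using that z by (simp add: \<phi>_def)
    then have "c mod int p = 0" by (rule injD[OF K.indexed_const_is_inj])
    then show ?thesis by (rule mod_eq_0_iff_dvd[THEN iffD1])
  qed
  show "\<phi> c \<in> carrier R" by (rule c)
  show "\<phi> 0 = \<zero>\<^bsub>R\<^esub>" using z by (simp add: \<phi>_def)
qed

text \<open>One system for each \<open>j\<close>, because every single \<open>A j\<close> has to
  avoid the value \<open>1\<close> modulo \<open>p\<close>. The indices below \<open>n\<close> are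
  shifted by one to the periodicity equations.\<close>

definition (in triangular) cert :: "nat \<Rightarrow> nat \<Rightarrow> nat \<Rightarrow> int mpoly" where
  "cert k j s = (if s < n then iter F k (s + 1) - V (s + 1) else iter_lin F G k j - 1)"

text \<open>At a periodic point with \<open>A j = 1\<close> all generators of the ideal vanish, so
  evaluating the relation for \<open>B j\<close> there would make \<open>p\<close> divide
  \<open>B j\<close>.\<close>

lemma (in triangular) periodic_points_mod_le_1:
  fixes p :: nat
  assumes p: "Factorial_Ring.prime p"
    and B: "\<And>j. j \<in> {1..n} \<Longrightarrow> Const (B j) \<in> idl {..<n + 1} (cert k j)" "\<And>j. j \<in> {1..n} \<Longrightarrow> \<not> int p dvd B j"
  shows "finite (periodic_points_mod p n F k) \<and> card (periodic_points_mod p n F k) \<le> 1"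
proof -
  define R where "R = field.alg_closure (residue_ring (int p))"
  define \<phi> :: "int \<Rightarrow> (int list \<times> nat) multiset \<Rightarrow> int"
    where "\<phi> c = ring.indexed_const (residue_ring (int p)) (c mod int p)" for c
  note rc = residue_closure[OF p, folded R_def \<phi>_def]
  interpret R: domain R by (rule rc(1))
  have eq: "periodic_points_mod p n F k = periodic_points R \<phi> n F k"
    unfolding periodic_points_mod_def R_def[symmetric]
    by (rule periodic_points_reduce_mod[where \<phi> = \<phi>, OF R.cring_axioms rc(4,5)]) (simp add: \<phi>_def)
  have uniq: "v = w" if w: "w \<in> periodic_points R \<phi> n F k" and v: "v \<in> periodic_points R \<phi> n F k" for v w
  proof (rule periodic_unique[OF R.domain_axioms rc(2) w v])
    fix j assume j: "j \<in> {1..n}"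
    have wc: "ext0 R n w i \<in> carrier R" for i
      using w by (auto simp: periodic_points_def ext0_def)
    interpret I: int_eval R \<phi> "ext0 R n w" by (rule rc(2)[OF wc])
    show "mpoly_eval R \<phi> (iter_lin F G k j - 1) (ext0 R n w) \<noteq> \<zero>\<^bsub>R\<^esub>"
    proof
      assume "mpoly_eval R \<phi> (iter_lin F G k j - 1) (ext0 R n w) = \<zero>\<^bsub>R\<^esub>"
      moreover have "I.E (iter F k i - V i) = \<zero>\<^bsub>R\<^esub>" if "i \<in> {1..n}" for i
        using periodic_iff[where \<phi> = \<phi> and w = w and k = k, OF R.cring_axioms rc(2)] w that by (simp add: I.E_def)
      ultimately have z: "I.E (cert k j s) = \<zero>\<^bsub>R\<^esub>" for s
        by (simp add: cert_def I.E_def)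
      obtain q where "Const (B j) = (\<Sum>s<n + 1. q s * cert k j s)"
        using B(1)[OF j] unfolding idl_def by auto
      then have "\<phi> (B j) = I.E (\<Sum>s<n + 1. q s * cert k j s)"
        by (metis I.E_Const)
      also have "\<dots> = (\<Oplus>\<^bsub>R\<^esub>s\<in>{..<n + 1}. \<zero>\<^bsub>R\<^esub>)"
        unfolding I.E_sum by (rule R.finsum_cong') (auto simp: I.E_mult z)
      also have "\<dots> = \<zero>\<^bsub>R\<^esub>" by (rule R.finsum_zero)
      finally show False using rc(3) B(2)[OF j] by blast
    qed
  qed
  show ?thesis
  proof (cases "periodic_points R \<phi> n F k = {}")
    case False
    then obtain w where "w \<in> periodic_points R \<phi> n F k" by blast
    then have "periodic_points R \<phi> n F k = {w}" using uniq by blast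
    then show ?thesis by (simp add: eq)
  qed (simp add: eq)
qed

section \<open>Dependence on the period\<close>

text \<open>A polynomial bound in the period \<open>k\<close> alone; dimension, degree and height
  are fixed outside, so the constant may depend on them.\<close>

definition growth :: "nat \<Rightarrow> (nat \<Rightarrow> real) \<Rightarrow> bool" where
  "growth e f \<longleftrightarrow> (\<exists>C. \<forall>k\<ge>1. \<bar>f k\<bar> \<le> C * real k ^ e)"

lemma growth_mono:
  assumes "growth e f" "e \<le> e'"
  shows "growth e' f"
proof -
  obtain C where C: "\<And>k. k \<ge> 1 \<Longrightarrow> \<bar>f k\<bar> \<le> C * real k ^ e" using assms(1) unfolding growth_def by blast
  have C0: "0 \<le> C" using C[of 1] by simp
  have "\<bar>f k\<bar> \<le> C * real k ^ e'" if "k \<ge> 1" for k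
  proof -
    have "real k ^ e \<le> real k ^ e'" using that by (intro power_increasing assms(2)) simp
    then have "C * real k ^ e \<le> C * real k ^ e'" using C0 by (rule mult_left_mono)
    then show ?thesis using C[OF that] by simp
  qed
  then show ?thesis unfolding growth_def by blast
qed

lemma growth_const: "growth e (\<lambda>k. c)"
proof (rule growth_mono)
  show "growth 0 (\<lambda>k. c)" unfolding growth_def by auto
qed simp

lemma growth_id: "growth 1 real"
  unfolding growth_def by (intro exI[of _ 1]) simp

lemma growth_add:
  assumes "growth e f" "growth e g"
  shows "growth e (\<lambda>k. f k + g k)"
proof -
  obtain C C' where C: "\<And>k. k \<ge> 1 \<Longrightarrow> \<bar>f k\<bar> \<le> C * real k ^ e" "\<And>k. k \<ge> 1 \<Longrightarrow> \<bar>g k\<bar> \<le> C' * real k ^ e"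
    using assms unfolding growth_def by blast
  have "\<bar>f k + g k\<bar> \<le> (C + C') * real k ^ e" if "k \<ge> 1" for k
    using C[OF that] abs_triangle_ineq[of "f k" "g k"] unfolding distrib_right by linarith
  then show ?thesis unfolding growth_def by blast
qed

lemma growth_mult:
  assumes "growth e f" "growth e' g"
  shows "growth (e + e') (\<lambda>k. f k * g k)"
proof -
  obtain C C' where C: "\<And>k. k \<ge> 1 \<Longrightarrow> \<bar>f k\<bar> \<le> C * real k ^ e" "\<And>k. k \<ge> 1 \<Longrightarrow> \<bar>g k\<bar> \<le> C' * real k ^ e'"
    using assms unfolding growth_def by blast
  have "\<bar>f k * g k\<bar> \<le> (C * C') * real k ^ (e + e')" if "k \<ge> 1" for k
  proof -
    have "\<bar>f k\<bar> * \<bar>g k\<bar> \<le> (C * real k ^ e) * (C' * real k ^ e')"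
      using C(1)[OF that] by (intro mult_mono C that) auto
    then show ?thesis by (simp add: abs_mult power_add mult_ac)
  qed
  then show ?thesis unfolding growth_def by blast
qed

lemma growth_cmult: "growth e f \<Longrightarrow> growth e (\<lambda>k. c * f k)"
  using growth_mult[OF growth_const[of 0 c]] by simp

lemma growth_power: "growth e f \<Longrightarrow> growth (m * e) (\<lambda>k. f k ^ m)"
  by (induction m) (use growth_const growth_mult in \<open>fastforce+\<close>)

lemma growth_le:
  assumes "growth e g" "\<And>k. k \<ge> 1 \<Longrightarrow> \<bar>f k\<bar> \<le> g k"
  shows "growth e f"
proof -
  obtain C where C: "\<And>k. k \<ge> 1 \<Longrightarrow> \<bar>g k\<bar> \<le> C * real k ^ e" using assms(1) unfolding growth_def by blast
  have "\<bar>f k\<bar> \<le> C * real k ^ e" if "k \<ge> 1" for k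
    using C[OF that] assms(2)[OF that] by linarith
  then show ?thesis unfolding growth_def by blast
qed

text \<open>The crude estimate \<open>ln x \<le> x - 1\<close>; it is precise enough for the
  exponent to be reached.\<close>

lemma growth_ln: "growth e f \<Longrightarrow> (\<And>k. k \<ge> 1 \<Longrightarrow> 1 \<le> f k) \<Longrightarrow> growth e (\<lambda>k. ln (f k))"
proof (erule growth_le)
  fix k :: nat assume "\<And>k. k \<ge> 1 \<Longrightarrow> 1 \<le> f k" "k \<ge> 1"
  then have "1 \<le> f k" by blast
  then show "\<bar>ln (f k)\<bar> \<le> f k" using ln_ge_zero[of "f k"] ln_le_minus_one[of "f k"] by simp
qed

lemma growth_deg_bound: "growth e (\<lambda>k. real (deg_bound d k e))"
proof (induction e)
  case 0
  show ?case using growth_const[of 0 1] by simp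
next
  case (Suc e)
  have "growth (1 + e) (\<lambda>k. real k * (real d * real (deg_bound d k e)))"
    by (rule growth_mult[OF growth_id growth_cmult[OF Suc]])
  from growth_add[OF growth_const[of _ 1] this] show ?case by simp
qed

lemma growth_norm_bound:
  assumes h: "1 \<le> h"
  shows "growth (Suc e) (\<lambda>k. ln (norm_bound d h k e))"
proof (induction e)
  case 0
  have "ln (norm_bound d h k 0) = real k * ln (2 * h)" for k
    unfolding norm_bound.simps by (rule ln_realpow)
  then show ?case using growth_mult[OF growth_id growth_const[of 0 "ln (2 * h)"]] by simp
next
  case (Suc e)
  have "ln (norm_bound d h k (Suc e)) = real k * (ln (2 * h) + real d * ln (norm_bound d h k e))" for k
  proof -
    have N: "0 < norm_bound d h k e" using norm_bound_ge1[OF h, of d k e] by linarith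
    have "ln (norm_bound d h k (Suc e)) = real k * ln (2 * (h * norm_bound d h k e ^ d))"
      unfolding norm_bound.simps by (rule ln_realpow)
    also have "2 * (h * norm_bound d h k e ^ d) = (2 * h) * norm_bound d h k e ^ d" by simp
    also have "ln \<dots> = ln (2 * h) + real d * ln (norm_bound d h k e)"
      using h N by (subst ln_mult) (simp_all add: ln_realpow)
    finally show ?thesis .
  qed
  moreover have "growth (1 + Suc e) (\<lambda>k. real k * (ln (2 * h) + real d * ln (norm_bound d h k e)))"
    by (rule growth_mult[OF growth_id growth_add[OF growth_const growth_cmult[OF Suc]]])
  ultimately show ?case by simp
qed

lemma growth_null_bound:
  assumes n: "1 \<le> n" and N: "1 \<le> N"
    and D: "growth (n - 1) (\<lambda>k. real (D k))" and H: "growth n (\<lambda>k. ln (H k))" "\<And>k. 1 \<le> H k"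
  shows "growth (2 * n * n - 1) (\<lambda>k. ln (null_bound n N (D k) (H k)))"
    and "1 \<le> null_bound n N (D k) (H k)"
proof -
  define M where "M k = noether_bound n (D k + 1)" for k
  define H1 where "H1 k = real N * real (M k) * H k + 1" for k
  have M1: "1 \<le> real (M k)" for k unfolding M_def noether_bound_def by simp
  have p1: "1 * 1 * 1 \<le> real N * real (M k) * H k" for k
    by (intro mult_mono mult_nonneg_nonneg M1 H(2)) (use N in auto)
  have H1: "1 \<le> H1 k" for k unfolding H1_def using p1[of k] by linarith
  have D1: "growth (n - 1) (\<lambda>k. real (D k + 1))"
    using growth_add[OF D growth_const[of _ 1]] by (simp only: of_nat_add of_nat_1)
  have "growth ((n + 1) * (n - 1)) (\<lambda>k. (real n + 2) * (((real n + 3) * (real (D k) + 1)) ^ (n + 1) + 1))"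
    by (intro growth_cmult growth_add growth_power growth_const D)
  then have M: "growth ((n + 1) * (n - 1)) (\<lambda>k. real (M k))"
    by (simp only: M_def noether_bound_def of_nat_mult of_nat_add of_nat_power of_nat_1 of_nat_numeral)
  \<comment> \<open>The growth rates for the shifts and for \<open>H\<close> are brought under the
    common exponent \<open>n * n\<close>.\<close>
  have nn: "(n + 1) * (n - 1) \<le> n * n" "n \<le> n * n" using n by (cases n; simp)+
  have lnM: "growth (n * n) (\<lambda>k. ln (real (M k)))"
    by (rule growth_mono[OF growth_ln[OF M M1] nn(1)])
  have "growth (n * n) (\<lambda>k. ln 2 + (ln (real N) + ln (real (M k)) + ln (H k)))"
    by (intro growth_add growth_const lnM growth_mono[OF H(1) nn(2)])
  then have lnH1: "growth (n * n) (\<lambda>k. ln (H1 k))"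
  proof (rule growth_le)
    fix k
    have pos: "0 < real N" "0 < real (M k)" "0 < H k" using N M1[of k] H(2)[of k] by auto
    have "ln (H1 k) \<le> ln (2 * (real N * real (M k) * H k))"
      by (rule ln_mono) (use p1[of k] in \<open>unfold H1_def, linarith+\<close>)
    also have "\<dots> = ln 2 + (ln (real N) + ln (real (M k)) + ln (H k))"
      using pos by (simp add: ln_mult)
    finally show "\<bar>ln (H1 k)\<bar> \<le> ln 2 + (ln (real N) + ln (real (M k)) + ln (H k))"
      using H1[of k] by simp
  qed
  have "growth (n * n) (\<lambda>k. ln 2 + ln (H1 k))"
    by (intro growth_add growth_const lnH1)
  then have lnH2: "growth (n * n) (\<lambda>k. ln (1 + H1 k))"
  proof (rule growth_le)
    fix k
    have "ln (1 + H1 k) \<le> ln (2 * H1 k)" using H1[of k] by (subst ln_le_cancel_iff) auto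
    also have "\<dots> = ln 2 + ln (H1 k)" using H1[of k] by (subst ln_mult) auto
    finally show "\<bar>ln (1 + H1 k)\<bar> \<le> ln 2 + ln (H1 k)" using H1[of k] by simp
  qed
  have nb: "null_bound n N (D k) (H k) = (real (D k + 1) ^ n * (H1 k * (1 + H1 k) ^ (D k + n * D k))) ^ ((D k + 1) ^ n)" for k
    unfolding null_bound_def Let_def H1_def M_def by (simp only: of_nat_power)
  have ge1: "1 * (1 * 1) \<le> real (D k + 1) ^ n * (H1 k * (1 + H1 k) ^ (D k + n * D k))" for k
    using H1[of k] by (intro mult_mono one_le_power mult_nonneg_nonneg zero_le_power) auto
  show "1 \<le> null_bound n N (D k) (H k)"
    unfolding nb by (rule one_le_power) (use ge1 in simp)
  have eq: "ln (null_bound n N (D k) (H k)) =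
      real (D k + 1) ^ n * (real n * ln (real (D k + 1)) + (ln (H1 k) + (1 + real n) * (real (D k) * ln (1 + H1 k))))" for k
  proof -
    have pos: "0 < real (D k + 1)" "0 < H1 k" "0 < 1 + H1 k" using H1[of k] by auto
    have "ln (null_bound n N (D k) (H k)) = real ((D k + 1) ^ n) * ln (real (D k + 1) ^ n * (H1 k * (1 + H1 k) ^ (D k + n * D k)))"
      unfolding nb by (rule ln_realpow)
    also have "ln (real (D k + 1) ^ n * (H1 k * (1 + H1 k) ^ (D k + n * D k)))
        = ln (real (D k + 1) ^ n) + ln (H1 k * (1 + H1 k) ^ (D k + n * D k))"
      using pos by (intro ln_mult_pos) auto
    also have "ln (H1 k * (1 + H1 k) ^ (D k + n * D k)) = ln (H1 k) + ln ((1 + H1 k) ^ (D k + n * D k))"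
      using pos by (intro ln_mult_pos) auto
    also have "ln ((1 + H1 k) ^ (D k + n * D k)) = real (D k + n * D k) * ln (1 + H1 k)"
      by (rule ln_realpow)
    also have "ln (real (D k + 1) ^ n) = real n * ln (real (D k + 1))"
      by (rule ln_realpow)
    finally show ?thesis by (simp add: algebra_simps)
  qed
  have e: "n - 1 \<le> (n - 1) + n * n" "n * n \<le> (n - 1) + n * n" by auto
  have "growth (n - 1) (\<lambda>k. ln (real (D k + 1)))"
    by (rule growth_ln[OF D1]) simp
  \<comment> \<open>The three contributions: the size of the determinant gives
    \<open>n * (n - 1)\<close>, the degree of its entries \<open>n - 1\<close>, and the logarithm of
    \<open>1 + H1\<close> gives \<open>n * n\<close>.\<close>
  then have "growth (n * (n - 1) + ((n - 1) + n * n)) (\<lambda>k. ln (null_bound n N (D k) (H k)))"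
    unfolding eq
    by (intro growth_mult growth_power D1 growth_add growth_cmult growth_mono[OF lnH1 e(2)] growth_mult[OF D lnH2] growth_mono[OF _ e(1)])
  moreover have "n * (n - 1) + ((n - 1) + n * n) = 2 * n * n - 1"
    using n by (cases n) (simp_all add: algebra_simps)
  ultimately show "growth (2 * n * n - 1) (\<lambda>k. ln (null_bound n N (D k) (H k)))" by simp
qed

text \<open>The \<open>n + 1\<close> members of \<open>cert\<close> arise from \<open>iter\<close>
  or \<open>iter_lin\<close> by subtracting a variable or \<open>1\<close>, whence the added
  \<open>1\<close> in the norm; \<open>n - 1\<close> is the largest number of variables after some
  \<open>V i\<close>.\<close>

definition cert_bound :: "nat \<Rightarrow> nat \<Rightarrow> real \<Rightarrow> nat \<Rightarrow> real" where
  "cert_bound n d h k = null_bound n (n + 1) (deg_bound d k (n - 1)) (norm_bound d h k (n - 1) + 1)"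

lemma growth_cert_bound:
  assumes n: "1 \<le> n" and h: "1 \<le> h"
  shows "growth (n * (3 * n - 1)) (\<lambda>k. real n * ln (cert_bound n d h k))" "1 \<le> cert_bound n d h k"
proof -
  have ge: "1 \<le> norm_bound d h k (n - 1)" for k by (rule norm_bound_ge1[OF h])
  have N: "growth n (\<lambda>k. ln (norm_bound d h k (n - 1)))"
    using growth_norm_bound[OF h, of "n - 1" d] n by simp
  have "growth n (\<lambda>k. ln 2 + ln (norm_bound d h k (n - 1)))"
    by (intro growth_add growth_const N)
  then have H: "growth n (\<lambda>k. ln (norm_bound d h k (n - 1) + 1))"
  proof (rule growth_le)
    fix k
    have "ln (norm_bound d h k (n - 1) + 1) \<le> ln (2 * norm_bound d h k (n - 1))"
      using ge[of k] by (subst ln_le_cancel_iff) auto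
    also have "\<dots> = ln 2 + ln (norm_bound d h k (n - 1))" using ge[of k] by (subst ln_mult) auto
    finally show "\<bar>ln (norm_bound d h k (n - 1) + 1)\<bar> \<le> ln 2 + ln (norm_bound d h k (n - 1))"
      using ge[of k] by simp
  qed
  have H1: "1 \<le> norm_bound d h k (n - 1) + 1" for k using ge[of k] by simp
  note nb = growth_null_bound[OF n _ growth_deg_bound[where d = d] H H1, of "n + 1", folded cert_bound_def]
  \<comment> \<open>The difference of the two sides is \<open>n * n - n + 1\<close>.\<close>
  have "2 * n * n - 1 \<le> n * (3 * n - 1)"
    using n by (cases n) (simp_all add: algebra_simps)
  then show "growth (n * (3 * n - 1)) (\<lambda>k. real n * ln (cert_bound n d h k))"
    using growth_cmult[OF growth_mono[OF nb(1)]] by simp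
  show "1 \<le> cert_bound n d h k" using nb(2) by simp
qed

section \<open>The integer that collects the bad primes\<close>

context triangular
begin

lemma ex_cert:
  assumes fin: "finite (complex_periodic_points n F k)" and j: "j \<in> {1..n}"
  shows "\<exists>B. B \<noteq> 0 \<and> Const B \<in> idl {..<n + 1} (cert k j) \<and> iabs B \<le> cert_bound n d h k"
  unfolding cert_bound_def
proof (rule arithmetic_nullstellensatz)
  have cases: "(\<exists>i\<in>{1..n}. cert k j s = iter F k i - V i) \<or> cert k j s = iter_lin F G k j - 1" for s
    unfolding cert_def by (cases "s < n") (auto intro!: bexI[of _ "s + 1"])
  show "cert k j s \<in> bdeg {1..n} (deg_bound d k (n - 1))" for s
    using cases[of s] iter_vars j by auto
  have diff_norm: "l1 iabs (P - Q) \<le> norm_bound d h k (n - 1) + 1"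
    if "l1 iabs P \<le> norm_bound d h k (n - 1)" "l1 iabs Q \<le> 1" for P Q :: "int mpoly"
    using int_norm_l1.nu_add[of P "- Q"] that by simp
  have "l1 iabs (iter_lin F G k i) \<le> norm_bound d h k (n - 1) \<and> l1 iabs (iter F k i) \<le> norm_bound d h k (n - 1)"
    if "i \<in> {1..n}" for i using iter_bounds[of i "n - 1" k k] that by auto
  moreover have "l1 iabs (V i :: int mpoly) \<le> 1" for i by (simp add: V_def int_norm.l1_single)
  ultimately show "l1 iabs (cert k j s) \<le> norm_bound d h k (n - 1) + 1" for s
    using cases[of s] j by (elim disjE bexE) (simp_all only: diff_norm int_norm_l1.nu_1 simp_thms)
  show "0 \<le> norm_bound d h k (n - 1) + 1" using norm_bound_ge1[OF h, of d k "n - 1"] by simp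
  show "\<exists>s<n + 1. ev of_int w (cert k j s) \<noteq> 0" for w :: "nat \<Rightarrow> complex"
  proof (rule ccontr)
    assume "\<not> ?thesis"
    then have z: "ev of_int w (cert k j s) = 0" if "s < n + 1" for s using that by blast
    have "ev of_int w (iter F k i - V i) = 0" if "i \<in> {1..n}" for i
      using z[of "i - 1"] that by (cases i) (auto simp: cert_def)
    moreover have "ev of_int w (iter_lin F G k j - 1) = 0"
      using z[of n] by (simp add: cert_def)
    ultimately show False using iter_lin_ne_1[OF fin _ j] by blast
  qed
qed

lemma ex_bad_primes:
  assumes fin: "finite (complex_periodic_points n F k)" and c: "1 \<le> cert_bound n d h k"
  shows "\<exists>B :: nat. B > 0 \<and> ln (real B) \<le> real n * ln (cert_bound n d h k) \<and>
    (\<forall>p. Factorial_Ring.prime p \<longrightarrow> \<not> p dvd B \<longrightarrow>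
      finite (periodic_points_mod p n F k) \<and> card (periodic_points_mod p n F k) \<le> 1)"
proof -
  have "\<forall>j. \<exists>B. j \<in> {1..n} \<longrightarrow> B \<noteq> 0 \<and> Const B \<in> idl {..<n + 1} (cert k j) \<and> iabs B \<le> cert_bound n d h k"
    using ex_cert[OF fin] by blast
  then obtain b where b: "\<And>j. j \<in> {1..n} \<Longrightarrow> b j \<noteq> 0" "\<And>j. j \<in> {1..n} \<Longrightarrow> Const (b j) \<in> idl {..<n + 1} (cert k j)"
      "\<And>j. j \<in> {1..n} \<Longrightarrow> iabs (b j) \<le> cert_bound n d h k"
    using choice[of "\<lambda>j B. j \<in> {1..n} \<longrightarrow> B \<noteq> 0 \<and> Const B \<in> idl {..<n + 1} (cert k j) \<and> iabs B \<le> cert_bound n d h k"] by blast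
  \<comment> \<open>A prime not dividing the product divides none of the \<open>b j\<close>, so all
    coordinates are treated at once; the number of factors explains the \<open>n\<close> in front of
    the logarithm.\<close>
  define B where "B = (\<Prod>j\<in>{1..n}. nat \<bar>b j\<bar>)"
  have pos: "B > 0" unfolding B_def by (intro prod_pos) (use b(1) in auto)
  have "real B = (\<Prod>j\<in>{1..n}. iabs (b j))" by (simp add: B_def)
  also have "\<dots> \<le> (\<Prod>j\<in>{1..n}. cert_bound n d h k)" by (intro prod_mono) (use b(3) in auto)
  finally have "real B \<le> cert_bound n d h k ^ n" by simp
  then have "ln (real B) \<le> ln (cert_bound n d h k ^ n)" using pos c by (subst ln_le_cancel_iff) auto
  also have "\<dots> = real n * ln (cert_bound n d h k)" by (rule ln_realpow)
  finally have "ln (real B) \<le> real n * ln (cert_bound n d h k)" .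
  moreover have "finite (periodic_points_mod p n F k) \<and> card (periodic_points_mod p n F k) \<le> 1"
    if p: "Factorial_Ring.prime p" "\<not> p dvd B" for p
  proof (rule periodic_points_mod_le_1[OF p(1) b(2)])
    fix j assume j: "j \<in> {1..n}"
    have "nat \<bar>b j\<bar> dvd B" unfolding B_def by (rule dvd_prodI[OF _ j]) simp
    then have "\<not> p dvd nat \<bar>b j\<bar>" using p(2) dvd_trans by blast
    then show "\<not> int p dvd b j" by simp
  qed
  ultimately show ?thesis using pos by blast
qed

end

section \<open>Degree and height of the components\<close>

lemma lookup_single_mult:
  fixes P :: "('k::cancel_comm_monoid_add) \<Rightarrow>\<^sub>0 'a::comm_ring_1"
  shows "lookup (Poly_Mapping.single k c * P) (k + m) = c * lookup P m"
proof -
  have "lookup (Poly_Mapping.single k c * P) (k + m) = (\<Sum>m'\<in>keys P. if m' = m then c * lookup P m' else 0)"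
    by (cases "c = 0") (auto simp: mult_singles[of "Poly_Mapping.single k c"] lookup_sum lookup_single when_def intro!: sum.cong)
  then show ?thesis by (simp add: in_keys_iff)
qed

text \<open>A nonzero integer coefficient has absolute value at least \<open>1\<close>, so the
  logarithm in \<open>height\<close> can be undone; for a vanishing coefficient positivity of
  \<open>exp\<close> suffices.\<close>

lemma coeff_le_exp_height: "iabs (lookup P m) \<le> exp (height P)"
proof (cases "m \<in> keys P")
  case True
  let ?M = "Max ((\<lambda>m. \<bar>lookup P m\<bar>) ` keys P)"
  have le: "\<bar>lookup P m\<bar> \<le> ?M" using True by (intro Max_ge) auto
  moreover have "1 \<le> \<bar>lookup P m\<bar>" using True by (auto simp: in_keys_iff)
  ultimately have "exp (height P) = real_of_int ?M" by (simp add: height_def)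
  then show ?thesis using le by (metis of_int_abs of_int_le_iff)
qed (simp add: in_keys_iff)

lemma mdeg_le_total_deg: "m \<in> keys P \<Longrightarrow> mdeg m \<le> total_deg P"
  unfolding total_deg_def mdeg_def by (rule Max_ge) auto

lemma l1_le_exp_height:
  assumes P: "P \<in> bdeg I d" and I: "I \<subseteq> {1..n}" and c: "\<And>m. iabs (lookup P m) \<le> c"
  shows "l1 iabs P \<le> real ((d + 1) ^ n) * c"
proof -
  have c0: "0 \<le> c" using c[of 0] by linarith
  have sub: "keys P \<subseteq> {m. keys m \<subseteq> {1..n} \<and> mdeg m \<le> d}" using P I unfolding bdeg_def by auto
  have "card (keys P) \<le> card {m :: nat \<Rightarrow>\<^sub>0 nat. keys m \<subseteq> {1..n} \<and> mdeg m \<le> d}"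
    by (rule card_mono[OF finite_monomials sub]) simp
  also have "\<dots> \<le> (d + 1) ^ n" using card_monomials[of "{1..n}" d] by simp
  finally have card: "real (card (keys P)) \<le> real ((d + 1) ^ n)" by (rule of_nat_mono)
  have "l1 iabs P \<le> real (card (keys P)) * c"
    unfolding l1_def by (rule sum_bounded_above) (rule c)
  also have "\<dots> \<le> real ((d + 1) ^ n) * c" using card c0 by (rule mult_right_mono)
  finally show ?thesis .
qed

text \<open>\<open>V i\<close> does not occur in \<open>G i\<close> and \<open>H i\<close>, so
  nothing cancels in \<open>V i * G i + H i\<close>: the coefficients of both are coefficients of
  \<open>F i\<close>, and the degree and height of \<open>F i\<close> bound them.\<close>

lemma triangular_system_imp_triangular:
  assumes F: "triangular_system n F" and n: "1 \<le> n"
  defines "d \<equiv> system_deg n F"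
  shows "\<exists>G H. triangular n d (max 1 (real ((d + 1) ^ n) * exp (system_height n F))) F G H"
proof -
  obtain G G' H :: "nat \<Rightarrow> int_mpoly" and g :: "nat \<Rightarrow> int" and hn s where
    low: "\<forall>i\<in>{1..<n}. G i \<in> poly_over {i<..n} \<and> H i \<in> poly_over {i<..n} \<and> F i = Var i * G i + H i"
    and last: "F n = of_int (g n) * Var n + of_int hn"
    using F unfolding triangular_system_def
    apply (elim exE conjE)
    subgoal for G G' H g hn s by (rule that[of G H g hn]) blast+
    done
  \<comment> \<open>The linear last component is brought into the common shape with constant
    polynomials.\<close>
  define G1 where "G1 = G(n := Const (g n))"
  define H1 where "H1 = H(n := Const hn)"
  have over: "G1 i \<in> poly_over {i<..n} \<and> H1 i \<in> poly_over {i<..n} \<and> F i = V i * G1 i + H1 i"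
    if "i \<in> {1..n}" for i
  proof (cases "i = n")
    case True
    have "Const c = of_int c" for c :: int
      unfolding single_of_int[symmetric] by (simp del: single_of_int)
    then have "F n = V n * Const (g n) + Const hn"
      using last by (simp add: V_def Var_def mult.commute)
    then show ?thesis
      by (simp add: True G1_def H1_def poly_over_def)
  next
    case False
    then have "i \<in> {1..<n}" using that by auto
    then have "G i \<in> poly_over {i<..n} \<and> H i \<in> poly_over {i<..n} \<and> F i = Var i * G i + H i" using low by blast
    moreover have "G1 i = G i" "H1 i = H i" using False by (simp_all add: G1_def H1_def)
    moreover have "V i = Var i" by (simp add: V_def Var_def)
    ultimately show ?thesis by simp
  qed
  note over = over[THEN conjunct1] over[THEN conjunct2, THEN conjunct1] over[THEN conjunct2, THEN conjunct2]
  have F_deg: "mdeg m \<le> d" if "i \<in> {1..n}" "m \<in> keys (F i)" for i m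
  proof -
    have "total_deg (F i) \<le> d" unfolding d_def system_deg_def by (rule Max_ge) (use that in auto)
    then show ?thesis using mdeg_le_total_deg[OF that(2)] by simp
  qed
  have F_coeff: "iabs (lookup (F i) m) \<le> exp (system_height n F)" if "i \<in> {1..n}" for i m
  proof -
    have "height (F i) \<le> system_height n F" unfolding system_height_def by (rule Max_ge) (use that in auto)
    then show ?thesis using coeff_le_exp_height[of "F i" m] by (meson exp_le_cancel_iff order_trans)
  qed
  have G_lookup: "lookup (G1 i) m = lookup (F i) (Poly_Mapping.single i 1 + m)" if i: "i \<in> {1..n}" for i m
  proof -
    have "Poly_Mapping.single i 1 + m \<notin> keys (H1 i)"
    proof
      assume "Poly_Mapping.single i 1 + m \<in> keys (H1 i)"
      then have "keys (Poly_Mapping.single i (1 :: nat) + m) \<subseteq> {i<..n}" using over(2)[OF i] unfolding poly_over_def by blast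
      then show False by (simp add: keys_add_nat)
    qed
    then show ?thesis
      unfolding over(3)[OF i] lookup_add V_def lookup_single_mult by (simp add: in_keys_iff)
  qed
  have H_lookup: "lookup (H1 i) m = lookup (F i) m" if i: "i \<in> {1..n}" and m: "m \<in> keys (H1 i)" for i m
  proof -
    have "m \<notin> keys (V i * G1 i)"
    proof
      assume "m \<in> keys (V i * G1 i)"
      then obtain m' where "m = Poly_Mapping.single i 1 + m'" using keys_mult[of "V i" "G1 i"] by (auto simp: V_def)
      then have "i \<in> keys m" by (simp add: keys_add_nat)
      then show False using over(2)[OF i] m unfolding poly_over_def by fastforce
    qed
    then show ?thesis unfolding over(3)[OF i] lookup_add by (simp add: in_keys_iff)
  qed
  have G_deg: "G1 i \<in> bdeg {i<..n} d" if i: "i \<in> {1..n}" for i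
  proof -
    have "mdeg m \<le> d" if "m \<in> keys (G1 i)" for m
    proof -
      have "Poly_Mapping.single i 1 + m \<in> keys (F i)" using that G_lookup[OF i, of m] by (simp add: in_keys_iff)
      then show ?thesis using F_deg[OF i] by (fastforce simp: mdeg_add)
    qed
    then show ?thesis using over(1)[OF i] unfolding poly_over_def bdeg_def by blast
  qed
  have H_deg: "H1 i \<in> bdeg {i<..n} d" if i: "i \<in> {1..n}" for i
  proof -
    have "mdeg m \<le> d" if "m \<in> keys (H1 i)" for m
    proof -
      have "m \<in> keys (F i)" using that H_lookup[OF i that] by (simp add: in_keys_iff)
      then show ?thesis by (rule F_deg[OF i])
    qed
    then show ?thesis using over(2)[OF i] unfolding poly_over_def bdeg_def by blast
  qed
  have H_coeff: "iabs (lookup (H1 i) m) \<le> exp (system_height n F)" if "i \<in> {1..n}" for i m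
    using H_lookup[OF that, of m] F_coeff[OF that, of m] by (cases "m \<in> keys (H1 i)") (auto simp: in_keys_iff)
  have G_coeff: "iabs (lookup (G1 i) m) \<le> exp (system_height n F)" if "i \<in> {1..n}" for i m
    using F_coeff[OF that] by (simp add: G_lookup[OF that])
  have "triangular n d (max 1 (real ((d + 1) ^ n) * exp (system_height n F))) F G1 H1"
  proof
    fix i assume i: "i \<in> {1..n}"
    then have I: "{i<..n} \<subseteq> {1..n}" by auto
    show "F i = V i * G1 i + H1 i" "G1 i \<in> bdeg {i<..n} d" "H1 i \<in> bdeg {i<..n} d"
      using over(3) G_deg H_deg i by auto
    show "l1 iabs (G1 i) \<le> max 1 (real ((d + 1) ^ n) * exp (system_height n F))"
      using l1_le_exp_height[OF G_deg[OF i] I G_coeff[OF i]] by (rule max.coboundedI2)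
    show "l1 iabs (H1 i) \<le> max 1 (real ((d + 1) ^ n) * exp (system_height n F))"
      using l1_le_exp_height[OF H_deg[OF i] I H_coeff[OF i]] by (rule max.coboundedI2)
  qed simp
  then show ?thesis by blast
qed

theorem theorem2p1:
  shows "\<exists>(c1 :: nat \<Rightarrow> real \<Rightarrow> nat \<Rightarrow> real) (c2 :: nat \<Rightarrow> real \<Rightarrow> nat \<Rightarrow> real).
    \<forall>(n :: nat) (F :: nat \<Rightarrow> int_mpoly) (k :: nat).
      n \<ge> 1 \<longrightarrow> triangular_system n F \<longrightarrow> k \<ge> 1 \<longrightarrow> finite (complex_periodic_points n F k) \<longrightarrow>
      (\<exists>B1 :: nat. B1 > 0 \<and>
         ln (real B1) \<le> c1 (system_deg n F) (system_height n F) n * real k ^ (n * (3 * n - 1)) \<and>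
         (\<forall>p :: nat. Factorial_Ring.prime p \<longrightarrow> \<not> p dvd B1 \<longrightarrow>
            finite (periodic_points_mod p n F k) \<and>
            real (card (periodic_points_mod p n F k))
              \<le> c2 (system_deg n F) (system_height n F) n * real k ^ (n * (n - 1) div 2)))"
proof -
  \<comment> \<open>A bound for the norms: at most \<open>(d + 1) ^ n\<close> monomials, with
    coefficients bounded by the exponential of the height.\<close>
  define h0 where "h0 d \<eta> n = max 1 (real ((d + 1) ^ n) * exp \<eta>)" for d \<eta> and n :: nat
  \<comment> \<open>The constant is chosen for each degree, height and dimension before a system or
    a period is given, so it depends on nothing else.\<close>
  have "\<forall>d \<eta> n. \<exists>C. 1 \<le> n \<longrightarrow>
      (\<forall>k\<ge>1. real n * ln (cert_bound n d (h0 d \<eta> n) k) \<le> C * real k ^ (n * (3 * n - 1)))"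
  proof (intro allI)
    fix d \<eta> n
    show "\<exists>C. 1 \<le> n \<longrightarrow>
      (\<forall>k\<ge>1. real n * ln (cert_bound n d (h0 d \<eta> n) k) \<le> C * real k ^ (n * (3 * n - 1)))"
    proof (cases "1 \<le> n")
      case True
      have "1 \<le> h0 d \<eta> n" by (simp add: h0_def)
      from growth_cert_bound(1)[OF True this, of d] show ?thesis
        unfolding growth_def by (meson abs_le_D1)
    qed simp
  qed
  then obtain c1 where c1: "\<And>d \<eta> n k. 1 \<le> n \<Longrightarrow> 1 \<le> k \<Longrightarrow>
      real n * ln (cert_bound n d (h0 d \<eta> n) k) \<le> c1 d \<eta> n * real k ^ (n * (3 * n - 1))"
    by metis
  show ?thesis
  \<comment> \<open>The constant \<open>1\<close> serves as \<open>c2\<close>, since at most one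
    periodic point remains and the power of \<open>k\<close> is at least \<open>1\<close>.\<close>
  proof (rule exI[of _ c1], rule exI[of _ "\<lambda>_ _ _. 1"], intro allI impI)
    fix n k :: nat and F :: "nat \<Rightarrow> int_mpoly"
    assume n: "n \<ge> 1" and F: "triangular_system n F" and k: "k \<ge> 1" and fin: "finite (complex_periodic_points n F k)"
    let ?d = "system_deg n F" and ?\<eta> = "system_height n F"
    obtain G H where "triangular n ?d (h0 ?d ?\<eta> n) F G H"
      using triangular_system_imp_triangular[OF F n] unfolding h0_def by blast
    then interpret triangular n ?d "h0 ?d ?\<eta> n" F G H .
    obtain B1 :: nat where B1: "B1 > 0" "ln (real B1) \<le> real n * ln (cert_bound n ?d (h0 ?d ?\<eta> n) k)"
      "\<And>p. Factorial_Ring.prime p \<Longrightarrow> \<not> p dvd B1 \<Longrightarrow>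
        finite (periodic_points_mod p n F k) \<and> card (periodic_points_mod p n F k) \<le> 1"
      using ex_bad_primes[OF fin growth_cert_bound(2)[OF n h]] by blast
    have kpow: "1 \<le> real k ^ (n * (n - 1) div 2)" using k by (intro one_le_power) simp
    show "\<exists>B1 :: nat. B1 > 0 \<and>
         ln (real B1) \<le> c1 ?d ?\<eta> n * real k ^ (n * (3 * n - 1)) \<and>
         (\<forall>p :: nat. Factorial_Ring.prime p \<longrightarrow> \<not> p dvd B1 \<longrightarrow>
            finite (periodic_points_mod p n F k) \<and>
            real (card (periodic_points_mod p n F k)) \<le> 1 * real k ^ (n * (n - 1) div 2))"
    proof (intro exI[of _ B1] conjI allI impI)
      show "ln (real B1) \<le> c1 ?d ?\<eta> n * real k ^ (n * (3 * n - 1))"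
        using B1(2) c1[OF n k, of ?d ?\<eta>] by linarith
      fix p :: nat assume p: "Factorial_Ring.prime p" "\<not> p dvd B1"
      show "finite (periodic_points_mod p n F k)" using B1(3)[OF p] by blast
      have "real (card (periodic_points_mod p n F k)) \<le> 1" using B1(3)[OF p] by simp
      then show "real (card (periodic_points_mod p n F k)) \<le> 1 * real k ^ (n * (n - 1) div 2)"
        using kpow by linarith
    qed (rule B1(1))
  qed
qed

end
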